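(* Let $N\ge1$ be an integer and let $0<s<1$, $N>2s$, $0<\mu<N$, $p,q>0$, $p+q>1$. Set $$\alpha=\frac{N-\mu+2s}{p+q-1}$$ and assume that $$0<\alpha<N-2s,\qquad 0<\alpha p<N,\qquad \mu+\alpha p>N.$$ Define $$\Lambda_{N,s}(\alpha)=2^{2s}\frac{\Gamma\left(\frac{N-\alpha}{2}\right)\Gamma\left(\frac{\alpha+2s}{2}\right)}{\Gamma\left(\frac{\alpha}{2}\right)\Gamma\left(\frac{N-\alpha-2s}{2}\right)}>0$$ and $$\mathcal C_{N,\mu,\alpha,p}=\pi^{\frac N2}\frac{\Gamma\left(\frac{N-\mu}{2}\right)\Gamma\left(\frac{N-\alpha p}{2}\right)\Gamma\left(\frac{\mu+\alpha p-N}{2}\right)}{\Gamma\left(\frac{\mu}{2}\right)\Gamma\left(\frac{\alpha p}{2}\right)\Gamma\left(\frac{2N-\mu-\alpha p}{2}\right)}>0 .$$ Then there is a unique $A>0$ for which $u_*(x)=A|x|^{-\alpha}$ solves $$(-\Delta)^su=\left(\int_{\mathbb R^N\setminus\{0\}}\frac{u^p(y)}{|x-y|^\mu}\,dy\right)u^q\quad\text{in }\mathbb R^N\setminus\{0\},$$ and it is determined by $$A^{p+q-1}=\frac{\Lambda_{N,s}(\alpha)}{\mathcal C_{N,\mu,\alpha,p}} .$$ Conversely, suppose that $u(x)=B|x|^{-\beta}$, with $B,\beta>0$, is a positive radial homogeneous solution of this equation in $\mathbb R^N\setminus\{0\}$ and that $$0<\beta<N-2s,\qquad 0<\beta p<N,\qquad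 \mu+\beta p>N.$$ Then $\beta=\alpha$ and $B=A$.
   Context: The equation is understood pointwise in $\mathbb R^N\setminus\{0\}$, where $(-\Delta)^su(x)=C_{N,s}\,\mathrm{P.V.}\int_{\mathbb R^N}\frac{u(x)-u(y)}{|x-y|^{N+2s}}\,dy$ and $C_{N,s}>0$ is the constant for which $(-\Delta)^s$ has Fourier multiplier $|\xi|^{2s}$ (with $\widehat f(\xi)=\int e^{-ix\cdot\xi}f(x)\,dx$). $\Gamma$ is the Euler gamma function. *)

theory Defs
  imports "HOL-Analysis.Analysis"
begin

definition fourier :: "('a::euclidean_space \<Rightarrow> complex) \<Rightarrow> 'a \<Rightarrow> complex" where
  "fourier f \<xi> = (LINT x|lborel. exp (- (\<i> * of_real (x \<bullet> \<xi>))) * f x)"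

primrec iter_partial :: "'a::euclidean_space list \<Rightarrow> ('a \<Rightarrow> complex) \<Rightarrow> 'a \<Rightarrow> complex" where
  "iter_partial [] f = f"
| "iter_partial (b # bs) f = (\<lambda>x. frechet_derivative (iter_partial bs f) (at x) b)"

text \<open>Frechet differentiability of all iterated partial derivatives amounts to smoothness.\<close>

definition schwartz :: "('a::euclidean_space \<Rightarrow> complex) \<Rightarrow> bool" where
  "schwartz f \<longleftrightarrow> (\<forall>bs \<in> lists Basis. iter_partial bs f differentiable_on UNIV \<and>
     (\<forall>k. \<exists>M. \<forall>x. norm x ^ k * norm (iter_partial bs f x) \<le> M))"

text \<open>The principal value excludes balls centred at \<open>x\<close>; away from \<open>x\<close> the integral
  has to converge absolutely.\<close>

definition has_pv_integral ::
  "('a::euclidean_space \<Rightarrow> 'b::{banach, second_countable_topology}) \<Rightarrow> 'a \<Rightarrow> 'b \<Rightarrow> bool" where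
  "has_pv_integral g x I \<longleftrightarrow>
     (\<forall>\<epsilon>>0. set_integrable lborel {y. \<epsilon> < dist x y} g) \<and>
     ((\<lambda>\<epsilon>. LINT y:{y. \<epsilon> < dist x y}|lborel. g y) \<longlongrightarrow> I) (at_right 0)"

definition has_frac_laplacian_with ::
  "real \<Rightarrow> real \<Rightarrow> ('a::euclidean_space \<Rightarrow> 'b::{banach, second_countable_topology}) \<Rightarrow> 'a \<Rightarrow> 'b \<Rightarrow> bool" where
  "has_frac_laplacian_with c s u x L \<longleftrightarrow>
     (\<exists>I. has_pv_integral (\<lambda>y. (u x - u y) /\<^sub>R (norm (x - y) powr (real DIM('a) + 2 * s))) x I
        \<and> L = c *\<^sub>R I)"

text \<open>The constant \<open>C\<^sub>N\<^sub>,\<^sub>s\<close>: the normalisation for which the operator has the Fourier multiplier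
  \<open>|\<xi>|\<^sup>2\<^sup>s\<close> on Schwartz functions. The dimension \<open>N\<close> is carried by the type argument.\<close>

definition frac_laplacian_const :: "'a::euclidean_space itself \<Rightarrow> real \<Rightarrow> real" where
  "frac_laplacian_const _ s = (THE c. c > 0 \<and>
     (\<forall>f :: 'a \<Rightarrow> complex. schwartz f \<longrightarrow>
        (\<exists>g. (\<forall>x. has_frac_laplacian_with c s f x (g x)) \<and> integrable lborel g \<and>
             (\<forall>\<xi>. fourier g \<xi> = of_real (norm \<xi> powr (2 * s)) * fourier f \<xi>))))"

text \<open>The operator is a relation between function, point and value, so that it also records that
  the principal value exists.\<close>

definition has_frac_laplacian :: "real \<Rightarrow> ('a::euclidean_space \<Rightarrow> real) \<Rightarrow> 'a \<Rightarrow> real \<Rightarrow> bool" where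
  "has_frac_laplacian s u x L \<longleftrightarrow>
     has_frac_laplacian_with (frac_laplacian_const TYPE('a) s) s u x L"

text \<open>Pointwise solutions on the punctured space. The value \<open>u 0\<close> is irrelevant, as are the
  values of the integrands at the single points \<open>y = x\<close> and \<open>y = 0\<close>.\<close>

definition choquard_solution ::
  "real \<Rightarrow> real \<Rightarrow> real \<Rightarrow> real \<Rightarrow> ('a::euclidean_space \<Rightarrow> real) \<Rightarrow> bool" where
  "choquard_solution s \<mu> p q u \<longleftrightarrow> (\<forall>x. x \<noteq> 0 \<longrightarrow>
     set_integrable lborel (- {0}) (\<lambda>y. u y powr p / norm (x - y) powr \<mu>) \<and>
     has_frac_laplacian s u x
       ((LINT y:- {0}|lborel. u y powr p / norm (x - y) powr \<mu>) * u x powr q))"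

definition Lambda_const :: "real \<Rightarrow> real \<Rightarrow> real \<Rightarrow> real" where
  "Lambda_const N s \<alpha> = 2 powr (2 * s) *
     (Gamma ((N - \<alpha>) / 2) * Gamma ((\<alpha> + 2 * s) / 2)) /
     (Gamma (\<alpha> / 2) * Gamma ((N - \<alpha> - 2 * s) / 2))"

definition C_const :: "real \<Rightarrow> real \<Rightarrow> real \<Rightarrow> real \<Rightarrow> real" where
  "C_const N \<mu> \<alpha> p = pi powr (N / 2) *
     (Gamma ((N - \<mu>) / 2) * Gamma ((N - \<alpha> * p) / 2) * Gamma ((\<mu> + \<alpha> * p - N) / 2)) /
     (Gamma (\<mu> / 2) * Gamma (\<alpha> * p / 2) * Gamma ((2 * N - \<mu> - \<alpha> * p) / 2))"

end

theory Submission
  imports Defs "HOL-Probability.Probability"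
begin

text \<open>Both sides of the equation act on a power by multiplying it with a constant and shifting the
exponent. For \<open>u(x) = B |x|\<^sup>-\<^sup>\<beta>\<close> in the stated range of \<open>\<beta>\<close>,
the left-hand side is \<open>B \<Lambda>(\<beta>) |x|\<^sup>-\<^sup>\<beta>\<^sup>-\<^sup>2\<^sup>s\<close> (\<open>has_frac_laplacian_norm_powr\<close>), and the nonlocal
factor on the right is \<open>B\<^sup>p C(\<beta>)\<close> times the power of \<open>|x|\<close> with exponent \<open>N - \<beta>p - \<mu>\<close>
(\<open>riesz_potential_norm_powr\<close>). Comparing the two sides on two spheres, \<open>u\<close> is a solution exactly if
the exponents agree, which is the linear equation \<open>\<beta> = \<alpha>\<close>, and the coefficients agree, which is
\<open>B powr (p + q - 1) = \<Lambda>/C\<close> (\<open>choquard_solution_power_iff\<close>). Since \<open>p + q > 1\<close> the last equation has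
exactly one positive root, and every claim follows.

The work lies in the two formulas and in the value of the normalising constant, which is
characterised only by the Fourier multiplier. One device handles all three: the Gamma integral writes
a negative power of \<open>|z|\<close> as a superposition of Gaussians \<open>exp (- t |z|\<^sup>2)\<close>, so an integral of powers
over the whole space becomes an explicit Gaussian integral, followed by one-dimensional integrals of
Gamma and Beta type (\<open>nn_integral_powr_subordination\<close>). For nonnegative integrands every exchange of
integrals is Tonelli's theorem. This gives at once the Riesz potential (\<open>nn_integral_Riesz\<close>) and the
constant \<open>K\<close> in \<open>\<integral> (1 - cos (z \<bullet> \<xi>)) |z|\<^sup>-\<^sup>N\<^sup>-\<^sup>2\<^sup>s dz = K |\<xi>|\<^sup>2\<^sup>s\<close> (\<open>nn_integral_cos_kernel\<close>).

Averaging \<open>y = x + z\<close> with \<open>y = x - z\<close> replaces the principal value by half the absolutely convergent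
integral of \<open>2 u(x) - u(x + z) - u(x - z)\<close> against \<open>|z|\<^sup>-\<^sup>N\<^sup>-\<^sup>2\<^sup>s\<close>
(\<open>has_pv_integral_second_difference\<close>). For a Schwartz function this integral can be Fourier
transformed under the integral sign, and the multiplier turns out to be \<open>K |\<xi>|\<^sup>2\<^sup>s\<close>. Hence \<open>1/K\<close> is an
admissible normalisation, and it is the only one because a Gaussian is a Schwartz function whose
transform has no zeros (\<open>frac_laplacian_const_eq\<close>).

For \<open>u(x) = |x|\<^sup>-\<^sup>\<beta>\<close> the kernel and \<open>u\<close> are both written as superpositions of Gaussians, with
parameters \<open>t\<close> and \<open>\<tau> = t r\<close>. What remains is a double integral over \<open>(t, r)\<close> of a function without a
sign; it is the difference of two nonnegative functions with finite integral, and its value contains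
\<open>\<integral> r\<^sup>-\<^sup>s\<^sup>-\<^sup>1 (1 - (1 + r)\<^sup>-\<^sup>m) dr\<close> with \<open>m = (N - \<beta> - 2s)/2\<close>. The condition \<open>\<beta> < N - 2s\<close> says that \<open>m\<close>
is positive (\<open>double_integral_subordination\<close>, \<open>integral_second_difference_norm_powr\<close>).\<close>

section \<open>Gamma and Beta integrals\<close>

lemma nn_integral_scale_pos:
  fixes f :: "real \<Rightarrow> ennreal"
  assumes [measurable]: "f \<in> borel_measurable borel" and "0 < c"
  shows "(\<integral>\<^sup>+t\<in>{0<..}. f t \<partial>lborel) = ennreal c * (\<integral>\<^sup>+t\<in>{0<..}. f (c * t) \<partial>lborel)"
proof -
  have "(\<integral>\<^sup>+t\<in>{0<..}. f t \<partial>lborel) =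
      ennreal \<bar>c\<bar> * (\<integral>\<^sup>+t. f (0 + c * t) * indicator {0<..} (0 + c * t) \<partial>lborel)"
    using \<open>0 < c\<close> by (intro nn_integral_real_affine) auto
  also have "(\<integral>\<^sup>+t. f (0 + c * t) * indicator {0<..} (0 + c * t) \<partial>lborel) =
      (\<integral>\<^sup>+t\<in>{0<..}. f (c * t) \<partial>lborel)"
    using \<open>0 < c\<close> by (intro nn_integral_cong) (auto simp: indicator_def zero_less_mult_iff)
  finally show ?thesis using \<open>0 < c\<close> by simp
qed

lemma nn_integral_Gamma:
  fixes c k :: real
  assumes "0 < c" "0 < k"
  shows "(\<integral>\<^sup>+t\<in>{0<..}. ennreal (t powr (k - 1) * exp (- (c * t))) \<partial>lborel)
    = ennreal (Gamma k * c powr (- k))"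
proof -
  have "ennreal (Gamma k) = (\<integral>\<^sup>+t\<in>{0<..}. ennreal (t powr (k - 1) * exp (- t)) \<partial>lborel)"
    unfolding Gamma_conv_nn_integral_real[OF \<open>0 < k\<close>]
    by (intro nn_integral_cong) (auto simp: indicator_def exp_minus field_simps)
  also have "\<dots> = ennreal c * (\<integral>\<^sup>+t\<in>{0<..}. ennreal ((c * t) powr (k - 1) * exp (- (c * t))) \<partial>lborel)"
    using \<open>0 < c\<close> by (intro nn_integral_scale_pos) auto
  also have "(\<integral>\<^sup>+t\<in>{0<..}. ennreal ((c * t) powr (k - 1) * exp (- (c * t))) \<partial>lborel) =
     (\<integral>\<^sup>+t. ennreal (c powr (k - 1)) * (ennreal (t powr (k - 1) * exp (- (c * t))) * indicator {0<..} t) \<partial>lborel)"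
    using \<open>0 < c\<close>
    by (intro nn_integral_cong)
       (auto simp: indicator_def powr_mult ennreal_mult'[symmetric] mult.assoc)
  also have "\<dots> = ennreal (c powr (k - 1)) * (\<integral>\<^sup>+t\<in>{0<..}. ennreal (t powr (k - 1) * exp (- (c * t))) \<partial>lborel)"
    by (intro nn_integral_cmult) auto
  finally have *: "ennreal (Gamma k) = ennreal (c powr k) * (\<integral>\<^sup>+t\<in>{0<..}. ennreal (t powr (k - 1) * exp (- (c * t))) \<partial>lborel)"
    using \<open>0 < c\<close> by (simp add: mult.assoc[symmetric] ennreal_mult'[symmetric] powr_diff)
  have "ennreal (Gamma k * c powr (- k)) = ennreal (c powr (-k)) * ennreal (Gamma k)"
    using Gamma_real_pos[OF \<open>0 < k\<close>] by (simp add: ennreal_mult' mult.commute)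
  also have "\<dots> = (\<integral>\<^sup>+t\<in>{0<..}. ennreal (t powr (k - 1) * exp (- (c * t))) \<partial>lborel)"
    unfolding * using \<open>0 < c\<close>
    by (simp add: mult.assoc[symmetric] ennreal_mult'[symmetric] powr_minus)
  finally show ?thesis ..
qed


lemma nn_integral_set_swap:
  fixes F :: "real \<Rightarrow> 'b::euclidean_space \<Rightarrow> ennreal"
  assumes [measurable]: "case_prod F \<in> borel_measurable (lborel \<Otimes>\<^sub>M lborel)"
  shows "(\<integral>\<^sup>+t\<in>{0<..}. (\<integral>\<^sup>+y. F t y \<partial>lborel) \<partial>lborel) = (\<integral>\<^sup>+y. (\<integral>\<^sup>+t\<in>{0<..}. F t y \<partial>lborel) \<partial>lborel)"
proof -
  have "(\<integral>\<^sup>+t\<in>{0<..}. (\<integral>\<^sup>+y. F t y \<partial>lborel) \<partial>lborel) =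
      (\<integral>\<^sup>+t. (\<integral>\<^sup>+y. F t y * indicator {0<..} t \<partial>lborel) \<partial>lborel)"
    by (intro nn_integral_cong nn_integral_multc[symmetric]) measurable
  also have "\<dots> = (\<integral>\<^sup>+y. (\<integral>\<^sup>+t\<in>{0<..}. F t y \<partial>lborel) \<partial>lborel)"
    by (rule lborel_pair.Fubini'[symmetric]) measurable
  finally show ?thesis .
qed

text \<open>The device behind every explicit integral below: replace \<open>\<phi> powr (- k)\<close> by its Gamma integral and
exchange the integrals. Only nonnegative functions occur, so the identity holds in \<open>[0, \<infinity>]\<close> and also
serves to decide whether an integral is finite. Positivity of \<open>\<phi>\<close> is required
only almost everywhere on the support of \<open>f\<close>, because \<open>\<phi>\<close> will be \<open>|y|\<^sup>2\<close>, which vanishes at the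
origin, or a function that is positive on a half-line or an interval.\<close>

lemma nn_integral_powr_subordination:
  fixes f \<phi> :: "'b::euclidean_space \<Rightarrow> real"
  assumes [measurable]: "f \<in> borel_measurable borel" "\<phi> \<in> borel_measurable borel"
    and f: "\<And>y. 0 \<le> f y" and \<phi>: "AE y in lborel. f y = 0 \<or> 0 < \<phi> y" and "0 < k"
  shows "ennreal (Gamma k) * (\<integral>\<^sup>+y. ennreal (f y * \<phi> y powr (- k)) \<partial>lborel) =
    (\<integral>\<^sup>+t\<in>{0<..}. ennreal (t powr (k - 1)) * (\<integral>\<^sup>+y. ennreal (f y * exp (- (\<phi> y * t))) \<partial>lborel) \<partial>lborel)"
proof -
  have "ennreal (Gamma k) * (\<integral>\<^sup>+y. ennreal (f y * \<phi> y powr (- k)) \<partial>lborel) =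
      (\<integral>\<^sup>+y. ennreal (Gamma k) * ennreal (f y * \<phi> y powr (- k)) \<partial>lborel)"
    by (intro nn_integral_cmult[symmetric]) measurable
  also have "\<dots> = (\<integral>\<^sup>+y. (\<integral>\<^sup>+t\<in>{0<..}. ennreal (t powr (k - 1)) * ennreal (f y * exp (- (\<phi> y * t))) \<partial>lborel) \<partial>lborel)"
  proof (intro nn_integral_cong_AE)
    show "AE y in lborel. ennreal (Gamma k) * ennreal (f y * \<phi> y powr (- k)) =
      (\<integral>\<^sup>+t\<in>{0<..}. ennreal (t powr (k - 1)) * ennreal (f y * exp (- (\<phi> y * t))) \<partial>lborel)"
      using \<phi>
    proof eventually_elim
      case (elim y)
      show ?case
      proof (cases "f y = 0")
        case False
        with elim have pos: "0 < \<phi> y" by simp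
        have "(\<integral>\<^sup>+t\<in>{0<..}. ennreal (t powr (k - 1)) * ennreal (f y * exp (- (\<phi> y * t))) \<partial>lborel) =
           (\<integral>\<^sup>+t. ennreal (f y) * (ennreal (t powr (k - 1) * exp (- (\<phi> y * t))) * indicator {0<..} t) \<partial>lborel)"
          using f by (intro nn_integral_cong) (auto simp: ennreal_mult ac_simps)
        also have "\<dots> = ennreal (f y) * ennreal (Gamma k * \<phi> y powr (- k))"
          by (subst nn_integral_cmult) (auto simp: nn_integral_Gamma[OF pos \<open>0 < k\<close>])
        finally show ?thesis
          using f \<open>0 < k\<close> by (simp add: ennreal_mult Gamma_real_pos less_imp_le ac_simps)
      qed simp
    qed
  qed
  also have "\<dots> = (\<integral>\<^sup>+t\<in>{0<..}. (\<integral>\<^sup>+y. ennreal (t powr (k - 1)) * ennreal (f y * exp (- (\<phi> y * t))) \<partial>lborel) \<partial>lborel)"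
    by (rule nn_integral_set_swap[symmetric]) measurable
  also have "\<dots> = (\<integral>\<^sup>+t\<in>{0<..}. ennreal (t powr (k - 1)) * (\<integral>\<^sup>+y. ennreal (f y * exp (- (\<phi> y * t))) \<partial>lborel) \<partial>lborel)"
    by (intro nn_integral_cong arg_cong2[where f="(*)"] nn_integral_cmult refl) measurable
  finally show ?thesis .
qed

lemma ennreal_cancel_left:
  assumes "ennreal c * X = ennreal d" "0 < c"
  shows "X = ennreal (d / c)"
proof -
  have "X = ennreal (1 / c) * (ennreal c * X)"
    using \<open>0 < c\<close> by (simp add: mult.assoc[symmetric] ennreal_mult'[symmetric])
  also have "\<dots> = ennreal (d / c)"
    using assms by (simp add: ennreal_mult'[symmetric])
  finally show ?thesis .
qed

lemma nn_integral_real_diff: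
  fixes f g :: "'b \<Rightarrow> real"
  assumes [measurable]: "f \<in> borel_measurable M" "g \<in> borel_measurable M"
    and "\<And>y. y \<in> space M \<Longrightarrow> 0 \<le> g y" "\<And>y. y \<in> space M \<Longrightarrow> g y \<le> f y"
    and "(\<integral>\<^sup>+y. ennreal (f y) \<partial>M) = ennreal a" "(\<integral>\<^sup>+y. ennreal (g y) \<partial>M) = ennreal b" "0 \<le> b"
  shows "(\<integral>\<^sup>+y. ennreal (f y - g y) \<partial>M) = ennreal (a - b)"
proof -
  have "(\<integral>\<^sup>+y. ennreal (f y - g y) \<partial>M) = (\<integral>\<^sup>+y. ennreal (f y) - ennreal (g y) \<partial>M)"
    using assms by (intro nn_integral_cong) (simp add: ennreal_minus)
  also have "\<dots> = (\<integral>\<^sup>+y. ennreal (f y) \<partial>M) - (\<integral>\<^sup>+y. ennreal (g y) \<partial>M)"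
    using assms by (intro nn_integral_diff) (auto intro!: AE_I2 ennreal_leI)
  also have "\<dots> = ennreal (a - b)" using assms by (simp add: ennreal_minus)
  finally show ?thesis .
qed

text \<open>Subordinating \<open>(1 + r) powr (- c)\<close> turns the inner integral into a Gamma integral in \<open>r\<close> and the
outer one into a Gamma integral in \<open>t\<close>.\<close>

lemma nn_integral_Beta:
  fixes a c :: real
  assumes "0 < a" "a < c"
  shows "(\<integral>\<^sup>+r\<in>{0<..}. ennreal (r powr (a - 1) * (1 + r) powr (- c)) \<partial>lborel)
    = ennreal (Gamma a * Gamma (c - a) / Gamma c)"
proof -
  have "ennreal (Gamma c) * (\<integral>\<^sup>+r\<in>{0<..}. ennreal (r powr (a - 1) * (1 + r) powr (- c)) \<partial>lborel) =
    ennreal (Gamma c) * (\<integral>\<^sup>+r. ennreal ((indicator {0<..} r * r powr (a - 1)) * (1 + r) powr (- c)) \<partial>lborel)"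
    by (intro arg_cong2[where f="(*)"] nn_integral_cong refl) (auto simp: indicator_def)
  also have "\<dots> = (\<integral>\<^sup>+t\<in>{0<..}. ennreal (t powr (c - 1)) *
      (\<integral>\<^sup>+r. ennreal ((indicator {0<..} r * r powr (a - 1)) * exp (- ((1 + r) * t))) \<partial>lborel) \<partial>lborel)"
    using assms by (intro nn_integral_powr_subordination) (auto simp: indicator_def)
  also have "\<dots> = (\<integral>\<^sup>+t. ennreal (Gamma a) * (ennreal (t powr (c - a - 1) * exp (- (1 * t))) * indicator {0<..} t) \<partial>lborel)"
  proof (intro nn_integral_cong, goal_cases)
    case (1 t)
    have "(\<integral>\<^sup>+r. ennreal ((indicator {0<..} r * r powr (a - 1)) * exp (- ((1 + r) * t))) \<partial>lborel)
       = (\<integral>\<^sup>+r. ennreal (exp (- t)) * (ennreal (r powr (a - 1) * exp (- (t * r))) * indicator {0<..} r) \<partial>lborel)"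
      by (intro nn_integral_cong) (auto simp: indicator_def ennreal_mult'[symmetric] algebra_simps exp_add[symmetric])
    also have "\<dots> = ennreal (exp (- t)) * (\<integral>\<^sup>+r\<in>{0<..}. ennreal (r powr (a - 1) * exp (- (t * r))) \<partial>lborel)"
      by (intro nn_integral_cmult) measurable
    finally have *: "(\<integral>\<^sup>+r. ennreal ((indicator {0<..} r * r powr (a - 1)) * exp (- ((1 + r) * t))) \<partial>lborel)
      = ennreal (exp (- t) * (Gamma a * t powr (- a)))" if "0 < t"
      using nn_integral_Gamma[of t a] assms that by (simp add: ennreal_mult')
    show ?case
    proof (cases "0 < t")
      case True
      then show ?thesis
        using assms unfolding *[OF True]
        by (simp add: ennreal_mult'[symmetric] Gamma_real_pos less_imp_le powr_diff powr_add powr_minus field_simps)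
    qed simp
  qed
  also have "\<dots> = ennreal (Gamma a) * ennreal (Gamma (c - a))"
    using assms by (subst nn_integral_cmult) (auto simp: nn_integral_Gamma[of 1 "c-a", simplified])
  finally have "ennreal (Gamma c) * (\<integral>\<^sup>+r\<in>{0<..}. ennreal (r powr (a - 1) * (1 + r) powr (- c)) \<partial>lborel) = ennreal (Gamma a * Gamma (c - a))"
    using assms by (simp add: ennreal_mult Gamma_real_pos less_imp_le)
  then show ?thesis
    using assms by (intro ennreal_cancel_left) (auto simp: Gamma_real_pos)
qed

lemma nn_integral_exp_interval:
  fixes r c :: real
  assumes "0 < r" "0 \<le> c"
  shows "(\<integral>\<^sup>+v\<in>{0..c}. ennreal (exp (- (v * r))) \<partial>lborel) = ennreal ((1 - exp (- (c * r))) / r)"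
proof -
  have "((\<lambda>v. - exp (- (v * r)) / r) has_real_derivative exp (- (v * r))) (at v)" for v
    using assms by (auto intro!: derivative_eq_intros)
  then have "(\<integral>\<^sup>+v\<in>{0..c}. ennreal (exp (- (v * r))) \<partial>lborel) =
     ennreal (- exp (- (c * r)) / r - - exp (- (0 * r)) / r)"
    using assms by (intro nn_integral_FTC_Icc) auto
  also have "- exp (- (c * r)) / r - - exp (- (0 * r)) / r = (1 - exp (- (c * r))) / r"
    by (simp add: diff_divide_distrib)
  finally show ?thesis .
qed

lemma nn_integral_powr_interval:
  fixes s c :: real
  assumes "0 < s" "0 \<le> c"
  shows "(\<integral>\<^sup>+v\<in>{0..c}. ennreal (v powr (s - 1)) \<partial>lborel) = ennreal (c powr s / s)"
proof -
  have "((\<lambda>v. v powr (s - 1)) has_integral c powr (s - 1 + 1) / (s - 1 + 1)) {0..c}"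
    using assms by (intro has_integral_powr_from_0) auto
  then show ?thesis
    using nn_integral_has_integral_lebesgue[of "{0..c}" "\<lambda>v. v powr (s - 1)" "c powr s / s"]
    by (simp add: nn_integral_completion mult.commute ennreal_indicator indicator_mult_ennreal)
qed

text \<open>Here \<open>(1 - exp (- (c * r))) / r\<close> is the integral of \<open>exp (- (v * r))\<close> over \<open>0 \<le> v \<le> c\<close>. This is again a
subordination, now with \<open>\<phi> v = v\<close> and exponent \<open>1 - s\<close>, and leaves \<open>\<integral> v powr (s - 1)\<close> over the
interval.\<close>

lemma nn_integral_one_minus_exp:
  fixes s c :: real
  assumes "0 < s" "s < 1" "0 \<le> c"
  shows "(\<integral>\<^sup>+r\<in>{0<..}. ennreal (r powr (- s - 1) * (1 - exp (- (c * r)))) \<partial>lborel)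
    = ennreal (c powr s * Gamma (1 - s) / s)"
proof -
  have "(\<integral>\<^sup>+r\<in>{0<..}. ennreal (r powr (- s - 1) * (1 - exp (- (c * r)))) \<partial>lborel) =
    (\<integral>\<^sup>+r\<in>{0<..}. ennreal (r powr ((1 - s) - 1)) * (\<integral>\<^sup>+v. ennreal (indicator {0..c} v * exp (- (v * r))) \<partial>lborel) \<partial>lborel)"
  proof (intro nn_integral_cong, goal_cases)
    case (1 r)
    have "(\<integral>\<^sup>+v. ennreal (indicator {0..c} v * exp (- (v * r))) \<partial>lborel) = (\<integral>\<^sup>+v\<in>{0..c}. ennreal (exp (- (v * r))) \<partial>lborel)"
      by (intro nn_integral_cong) (auto simp: indicator_def)
    then have *: "(\<integral>\<^sup>+v. ennreal (indicator {0..c} v * exp (- (v * r))) \<partial>lborel) = ennreal ((1 - exp (- (c * r))) / r)"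
      if "0 < r"
      using assms that by (simp add: nn_integral_exp_interval)
    show ?case
      using assms
      by (cases "0 < r") (auto simp: * ennreal_mult'[symmetric] powr_diff powr_minus field_simps)
  qed
  also have "\<dots> = ennreal (Gamma (1 - s)) * (\<integral>\<^sup>+v. ennreal (indicator {0..c} v * v powr (- (1 - s))) \<partial>lborel)"
    using assms AE_lborel_singleton[of "0::real"]
    by (intro nn_integral_powr_subordination[symmetric]) (auto elim!: eventually_mono simp: indicator_def)
  also have "(\<integral>\<^sup>+v. ennreal (indicator {0..c} v * v powr (- (1 - s))) \<partial>lborel) = (\<integral>\<^sup>+v\<in>{0..c}. ennreal (v powr (s - 1)) \<partial>lborel)"
    by (intro nn_integral_cong) (auto simp: indicator_def)
  also have "\<dots> = ennreal (c powr s / s)" using assms by (intro nn_integral_powr_interval) auto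
  finally show ?thesis
    using assms by (simp add: ennreal_mult'[symmetric] Gamma_real_pos less_imp_le mult.commute)
qed

text \<open>Writing \<open>Gamma m * (1 - (1 + r) powr (- m))\<close> as the integral of
\<open>t powr (m - 1) * exp (- t) * (1 - exp (- (r * t)))\<close> over \<open>t > 0\<close> reduces the claim to the preceding one.
Up to sign, the value is the analytic continuation of the Beta integral from \<open>a > 0\<close> to \<open>a = -s\<close>.\<close>

lemma nn_integral_one_minus_powr:
  fixes s m :: real
  assumes "0 < s" "s < 1" "0 < m"
  shows "(\<integral>\<^sup>+r\<in>{0<..}. ennreal (r powr (- s - 1) * (1 - (1 + r) powr (- m))) \<partial>lborel)
    = ennreal (Gamma (1 - s) / s * (Gamma (m + s) / Gamma m))"
proof -
  have Gm: "0 < Gamma m" "0 < Gamma (1 - s)" "0 < Gamma (m + s)" using assms by (auto simp: Gamma_real_pos)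
  have *: "(\<integral>\<^sup>+t. ennreal (indicator {0<..} t * t powr (m - 1) * exp (- t) - indicator {0<..} t * t powr (m - 1) * exp (- ((1 + r) * t))) \<partial>lborel)
       = ennreal (Gamma m - Gamma m * (1 + r) powr (- m))" if "0 < r" for r
  proof (rule nn_integral_real_diff)
    show "(\<integral>\<^sup>+t. ennreal (indicator {0<..} t * t powr (m - 1) * exp (- t)) \<partial>lborel) = ennreal (Gamma m)"
      using nn_integral_Gamma[of 1 m] assms
      by (auto simp: indicator_mult_ennreal ac_simps ennreal_indicator intro!: nn_integral_cong)
    show "(\<integral>\<^sup>+t. ennreal (indicator {0<..} t * t powr (m - 1) * exp (- ((1 + r) * t))) \<partial>lborel) = ennreal (Gamma m * (1 + r) powr (- m))"
      using nn_integral_Gamma[of "1 + r" m] assms \<open>0 < r\<close>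
      by (auto simp: indicator_mult_ennreal ac_simps intro!: nn_integral_cong)
  qed (use that Gm in \<open>auto simp: indicator_def intro!: mult_left_mono\<close>)
  have "ennreal (Gamma m) * (\<integral>\<^sup>+r\<in>{0<..}. ennreal (r powr (- s - 1) * (1 - (1 + r) powr (- m))) \<partial>lborel) =
    (\<integral>\<^sup>+r\<in>{0<..}. ennreal (Gamma m) * ennreal (r powr (- s - 1) * (1 - (1 + r) powr (- m))) \<partial>lborel)"
    by (subst nn_integral_cmult[symmetric]) (auto simp: mult.assoc)
  also have "\<dots> = (\<integral>\<^sup>+r\<in>{0<..}. (\<integral>\<^sup>+t. ennreal (r powr (- s - 1)) * ennreal (indicator {0<..} t * t powr (m - 1) * exp (- t) - indicator {0<..} t * t powr (m - 1) * exp (- ((1 + r) * t))) \<partial>lborel) \<partial>lborel)"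
  proof (intro nn_integral_cong, goal_cases)
    case (1 r)
    show ?case
    proof (cases "0 < r")
      case True
      have "(\<integral>\<^sup>+t. ennreal (r powr (- s - 1)) * ennreal (indicator {0<..} t * t powr (m - 1) * exp (- t) - indicator {0<..} t * t powr (m - 1) * exp (- ((1 + r) * t))) \<partial>lborel)
        = ennreal (r powr (- s - 1)) * ennreal (Gamma m - Gamma m * (1 + r) powr (- m))"
        unfolding *[OF True, symmetric] by (rule nn_integral_cmult) measurable
      also have "\<dots> = ennreal (Gamma m) * ennreal (r powr (- s - 1) * (1 - (1 + r) powr (- m)))"
        using Gm by (simp add: ennreal_mult'[symmetric] algebra_simps)
      finally show ?thesis by simp
    qed simp
  qed
  also have "\<dots> = (\<integral>\<^sup>+t. (\<integral>\<^sup>+r\<in>{0<..}. ennreal (r powr (- s - 1)) * ennreal (indicator {0<..} t * t powr (m - 1) * exp (- t) - indicator {0<..} t * t powr (m - 1) * exp (- ((1 + r) * t))) \<partial>lborel) \<partial>lborel)"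
    by (rule nn_integral_set_swap) measurable
  also have "\<dots> = (\<integral>\<^sup>+t. ennreal (indicator {0<..} t * t powr (m - 1) * exp (- t)) * ennreal (t powr s * Gamma (1 - s) / s) \<partial>lborel)"
  proof (intro nn_integral_cong, goal_cases)
    case (1 t)
    have "(\<integral>\<^sup>+r\<in>{0<..}. ennreal (r powr (- s - 1)) * ennreal (indicator {0<..} t * t powr (m - 1) * exp (- t) - indicator {0<..} t * t powr (m - 1) * exp (- ((1 + r) * t))) \<partial>lborel)
       = (\<integral>\<^sup>+r. ennreal (indicator {0<..} t * t powr (m - 1) * exp (- t)) * (ennreal (r powr (- s - 1) * (1 - exp (- (t * r)))) * indicator {0<..} r) \<partial>lborel)"
      by (intro nn_integral_cong) (auto simp: indicator_def ennreal_mult'[symmetric] algebra_simps exp_add[symmetric])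
    also have "\<dots> = ennreal (indicator {0<..} t * t powr (m - 1) * exp (- t)) * (\<integral>\<^sup>+r\<in>{0<..}. ennreal (r powr (- s - 1) * (1 - exp (- (t * r)))) \<partial>lborel)"
      by (intro nn_integral_cmult) measurable
    finally show ?case
      using assms by (cases "0 < t") (auto simp: nn_integral_one_minus_exp)
  qed
  also have "\<dots> = (\<integral>\<^sup>+t. ennreal (Gamma (1 - s) / s) * (ennreal (t powr ((m + s) - 1) * exp (- (1 * t))) * indicator {0<..} t) \<partial>lborel)"
    using assms Gm
    by (intro nn_integral_cong) (auto simp: indicator_def ennreal_mult'[symmetric] powr_add powr_diff field_simps)
  also have "\<dots> = ennreal (Gamma (1 - s) / s) * ennreal (Gamma (m + s))"
    using assms by (subst nn_integral_cmult) (auto simp: nn_integral_Gamma[of 1 "m+s", simplified])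
  finally have "ennreal (Gamma m) * (\<integral>\<^sup>+r\<in>{0<..}. ennreal (r powr (- s - 1) * (1 - (1 + r) powr (- m))) \<partial>lborel)
     = ennreal (Gamma (1 - s) / s * Gamma (m + s))"
    using assms Gm by (simp add: ennreal_mult'[symmetric])
  from ennreal_cancel_left[OF this] Gm show ?thesis by simp
qed

section \<open>Gaussian integrals\<close>

lemma borel_measurable_cis [measurable]: "cis \<in> borel_measurable borel"
  by (intro borel_measurable_continuous_onI continuous_intros)

text \<open>A rescaling of the characteristic function of the standard normal distribution.\<close>

lemma integral_exp_char_real:
  fixes \<tau> \<xi> :: real
  assumes "0 < \<tau>"
  shows "integrable lborel (\<lambda>x. cis (\<xi> * x) * of_real (exp (- (\<tau> * x\<^sup>2))))" (is "integrable _ ?f")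
    and "(LINT x|lborel. cis (\<xi> * x) * of_real (exp (- (\<tau> * x\<^sup>2)))) =
      of_real (sqrt (pi / \<tau>) * exp (- (\<xi>\<^sup>2 / (4 * \<tau>))))"
proof -
  define c where "c = sqrt (2 * \<tau>)"
  have c: "0 < c" "c\<^sup>2 = 2 * \<tau>" using assms by (auto simp: c_def)
  have nd: "std_normal_density (c * x) = exp (- (\<tau> * x\<^sup>2)) / sqrt (2 * pi)" for x
    using c by (simp add: std_normal_density_def power_mult_distrib)
  have int1: "integrable lborel (\<lambda>x. std_normal_density x *\<^sub>R cis (t * x))" for t
    by (rule Bochner_Integration.integrable_bound[OF integrable_std_normal_moment[of 0]]) auto
  have val1: "(LINT x|lborel. std_normal_density x *\<^sub>R cis (t * x)) = of_real (exp (- (t\<^sup>2) / 2))" for t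
  proof -
    have "(LINT x|lborel. std_normal_density x *\<^sub>R cis (t * x)) = char std_normal_distribution t"
      unfolding char_def by (subst integral_density) (auto simp: cis_conv_exp)
    then show ?thesis by (simp add: char_std_normal_distribution)
  qed
  have eq: "std_normal_density (0 + c * x) *\<^sub>R cis (\<xi> / c * (0 + c * x)) = (1 / sqrt (2 * pi)) *\<^sub>R ?f x" for x
    using c by (simp add: nd scaleR_conv_of_real)
  have int2: "integrable lborel (\<lambda>x. (1 / sqrt (2 * pi)) *\<^sub>R ?f x)"
    using lborel_integrable_real_affine[OF int1[of "\<xi> / c"], of c 0] c unfolding eq by simp
  show int: "integrable lborel ?f"
    using integrable_scaleR_right[OF int2, of "sqrt (2 * pi)"] by simp
  have "of_real (exp (- ((\<xi> / c)\<^sup>2) / 2)) = \<bar>c\<bar> *\<^sub>R (LINT x|lborel. (1 / sqrt (2 * pi)) *\<^sub>R ?f x)"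
    unfolding val1[symmetric] eq[symmetric] using c
    by (intro lborel_integral_real_affine) auto
  then have "(LINT x|lborel. ?f x) = of_real (sqrt (2 * pi) / c * exp (- ((\<xi> / c)\<^sup>2) / 2))"
    using c by (simp add: scaleR_conv_of_real field_simps)
  also have "(\<xi> / c)\<^sup>2 / 2 = \<xi>\<^sup>2 / (4 * \<tau>)" using c by (simp add: power_divide)
  then have "- ((\<xi> / c)\<^sup>2) / 2 = - (\<xi>\<^sup>2 / (4 * \<tau>))" by simp
  also have "sqrt (2 * pi) / c = sqrt (pi / \<tau>)"
    using assms by (simp add: c_def real_sqrt_divide[symmetric])
  finally show "(LINT x|lborel. ?f x) = of_real (sqrt (pi / \<tau>) * exp (- (\<xi>\<^sup>2 / (4 * \<tau>))))" .
qed

lemma lborel_integral_prod: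
  fixes f :: "'b::euclidean_space \<Rightarrow> real \<Rightarrow> complex"
  assumes int: "\<And>b. b \<in> Basis \<Longrightarrow> integrable lborel (f b)"
  shows "integrable lborel (\<lambda>x::'b. \<Prod>b\<in>Basis. f b (x \<bullet> b))"
    and "(LINT x::'b|lborel. (\<Prod>b\<in>Basis. f b (x \<bullet> b))) = (\<Prod>b\<in>Basis. LINT x|lborel. f b x)"
proof -
  interpret product_sigma_finite "\<lambda>_::'b. lborel :: real measure" ..
  have [measurable]: "b \<in> Basis \<Longrightarrow> f b \<in> borel_measurable borel" for b
    using int[of b] by auto
  have *: "(\<Sum>c\<in>Basis. x c *\<^sub>R c) \<bullet> b = x b" if "b \<in> Basis" for x and b :: 'b
    using that by simp
  show "integrable lborel (\<lambda>x::'b. \<Prod>b\<in>Basis. f b (x \<bullet> b))"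
    apply (subst lborel_eq, subst integrable_distr_eq)
    using product_integrable_prod[OF finite_Basis int] by (auto simp: * cong: prod.cong)
  show "(LINT x::'b|lborel. (\<Prod>b\<in>Basis. f b (x \<bullet> b))) = (\<Prod>b\<in>Basis. LINT x|lborel. f b x)"
    apply (subst lborel_eq, subst integral_distr)
    using product_integral_prod[OF finite_Basis int] by (auto simp: * cong: prod.cong)
qed

lemma norm_sq_eq_sum_Basis: "(norm x)\<^sup>2 = (\<Sum>b\<in>Basis. (x \<bullet> b)\<^sup>2)" for x :: "'a::euclidean_space"
  unfolding power2_norm_eq_inner by (subst euclidean_inner) (simp add: power2_eq_square)

lemma gaussian_fourier:
  fixes \<xi> :: "'a::euclidean_space"
  assumes "0 < \<tau>"
  shows "integrable lborel (\<lambda>z::'a. cis (z \<bullet> \<xi>) * of_real (exp (- (\<tau> * (norm z)\<^sup>2))))"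
    and "(LINT z::'a|lborel. cis (z \<bullet> \<xi>) * of_real (exp (- (\<tau> * (norm z)\<^sup>2)))) =
      of_real ((pi / \<tau>) powr (DIM('a) / 2) * exp (- ((norm \<xi>)\<^sup>2 / (4 * \<tau>))))"
proof -
  have eq: "cis (z \<bullet> \<xi>) * of_real (exp (- (\<tau> * (norm z)\<^sup>2))) =
     (\<Prod>b\<in>Basis. cis ((\<xi> \<bullet> b) * (z \<bullet> b)) * of_real (exp (- (\<tau> * (z \<bullet> b)\<^sup>2))))" for z
  proof -
    have "cis (z \<bullet> \<xi>) = (\<Prod>b\<in>Basis. cis ((\<xi> \<bullet> b) * (z \<bullet> b)))"
      by (subst euclidean_inner) (simp add: cis_conv_exp sum_distrib_left exp_sum mult.commute)
    moreover have "exp (- (\<tau> * (norm z)\<^sup>2)) = (\<Prod>b\<in>Basis. exp (- (\<tau> * (z \<bullet> b)\<^sup>2)))"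
      by (simp add: norm_sq_eq_sum_Basis sum_distrib_left exp_sum sum_negf[symmetric])
    ultimately show ?thesis by (simp add: prod.distrib)
  qed
  note * = lborel_integral_prod[where f="\<lambda>b x. cis ((\<xi> \<bullet> b) * x) * of_real (exp (- (\<tau> * x\<^sup>2)))",
      OF integral_exp_char_real(1)[OF assms]]
  show "integrable lborel (\<lambda>z::'a. cis (z \<bullet> \<xi>) * of_real (exp (- (\<tau> * (norm z)\<^sup>2))))"
    unfolding eq by (rule *(1))
  have "(LINT z::'a|lborel. cis (z \<bullet> \<xi>) * of_real (exp (- (\<tau> * (norm z)\<^sup>2)))) =
     (\<Prod>b\<in>(Basis::'a set). of_real (sqrt (pi / \<tau>) * exp (- ((\<xi> \<bullet> b)\<^sup>2 / (4 * \<tau>)))))"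
    unfolding eq *(2) integral_exp_char_real(2)[OF assms] ..
  also have "\<dots> = of_real (sqrt (pi / \<tau>) ^ DIM('a) * exp (- ((norm \<xi>)\<^sup>2 / (4 * \<tau>))))"
    by (simp add: prod.distrib norm_sq_eq_sum_Basis sum_divide_distrib exp_sum sum_negf[symmetric])
  also have "sqrt (pi / \<tau>) ^ DIM('a) = (pi / \<tau>) powr (DIM('a) / 2)"
    using assms by (simp add: powr_half_sqrt[symmetric] powr_powr powr_realpow[symmetric])
  finally show "(LINT z::'a|lborel. cis (z \<bullet> \<xi>) * of_real (exp (- (\<tau> * (norm z)\<^sup>2)))) =
      of_real ((pi / \<tau>) powr (DIM('a) / 2) * exp (- ((norm \<xi>)\<^sup>2 / (4 * \<tau>))))" .
qed

lemma nn_integral_gaussian: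
  assumes "0 < \<tau>"
  shows "(\<integral>\<^sup>+(z::'a::euclidean_space). ennreal (exp (- (\<tau> * (norm z)\<^sup>2))) \<partial>lborel) = ennreal ((pi / \<tau>) powr (DIM('a) / 2))"
proof -
  have int: "integrable lborel (\<lambda>z::'a. exp (- (\<tau> * (norm z)\<^sup>2)))"
    using integrable_Re[OF gaussian_fourier(1)[OF assms, where \<xi>="0::'a"]] by simp
  have "(LINT z::'a|lborel. exp (- (\<tau> * (norm z)\<^sup>2))) = (pi / \<tau>) powr (DIM('a) / 2)"
    using integral_Re[OF gaussian_fourier(1)[OF assms, where \<xi>="0::'a"]]
      gaussian_fourier(2)[OF assms, where \<xi>="0::'a"] by simp
  then show ?thesis using int by (subst nn_integral_eq_integral) auto
qed

lemma nn_integral_gaussian_cos: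
  fixes \<xi> :: "'a::euclidean_space"
  assumes "0 < \<tau>"
  shows "(\<integral>\<^sup>+(z::'a). ennreal ((1 - cos (z \<bullet> \<xi>)) * exp (- (\<tau> * (norm z)\<^sup>2))) \<partial>lborel) =
    ennreal ((pi / \<tau>) powr (DIM('a) / 2) * (1 - exp (- ((norm \<xi>)\<^sup>2 / (4 * \<tau>)))))"
proof -
  note c = integrable_Re[OF gaussian_fourier(1)[OF assms, where \<xi>=\<xi>]]
    integral_Re[OF gaussian_fourier(1)[OF assms, where \<xi>=\<xi>]] gaussian_fourier(2)[OF assms, where \<xi>=\<xi>]
  note o = integrable_Re[OF gaussian_fourier(1)[OF assms, where \<xi>="0::'a"]]
    integral_Re[OF gaussian_fourier(1)[OF assms, where \<xi>="0::'a"]] gaussian_fourier(2)[OF assms, where \<xi>="0::'a"]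
  have eq: "(1 - cos (z \<bullet> \<xi>)) * exp (- (\<tau> * (norm z)\<^sup>2)) =
     exp (- (\<tau> * (norm z)\<^sup>2)) - cos (z \<bullet> \<xi>) * exp (- (\<tau> * (norm z)\<^sup>2))" for z
    by (simp add: algebra_simps)
  have "integrable lborel (\<lambda>z::'a. (1 - cos (z \<bullet> \<xi>)) * exp (- (\<tau> * (norm z)\<^sup>2)))"
    unfolding eq using c(1) o(1) by (intro Bochner_Integration.integrable_diff) (auto simp: cis.sel)
  moreover have "(LINT z::'a|lborel. (1 - cos (z \<bullet> \<xi>)) * exp (- (\<tau> * (norm z)\<^sup>2))) =
     (pi / \<tau>) powr (DIM('a) / 2) * (1 - exp (- ((norm \<xi>)\<^sup>2 / (4 * \<tau>))))"
    unfolding eq using c o by (subst Bochner_Integration.integral_diff) (auto simp: algebra_simps)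
  ultimately show ?thesis
    by (subst nn_integral_eq_integral) (auto simp: AE_I2)
qed

lemma nn_integral_translate:
  fixes f :: "'a::euclidean_space \<Rightarrow> ennreal"
  assumes [measurable]: "f \<in> borel_measurable borel"
  shows "(\<integral>\<^sup>+z. f (x + z) \<partial>lborel) = (\<integral>\<^sup>+z. f z \<partial>lborel)"
proof -
  have "(\<integral>\<^sup>+z. f z \<partial>lborel) = (\<integral>\<^sup>+z. f z \<partial>distr lborel borel ((+) x))"
    by (simp add: lborel_distr_plus)
  also have "\<dots> = (\<integral>\<^sup>+z. f (x + z) \<partial>lborel)" by (subst nn_integral_distr) auto
  finally show ?thesis ..
qed

lemma gaussian_complete_square:
  fixes x z :: "'a::real_inner"
  assumes "0 < t + (\<tau>::real)"
  shows "t * (norm (x + z))\<^sup>2 + \<tau> * (norm z)\<^sup>2 =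
    (t + \<tau>) * (norm ((t / (t + \<tau>)) *\<^sub>R x + z))\<^sup>2 + t * \<tau> / (t + \<tau>) * (norm x)\<^sup>2"
proof -
  define r where "r = t / (t + \<tau>)"
  have rt: "(t + \<tau>) * r = t" using assms by (simp add: r_def)
  have 2: "t * \<tau> / (t + \<tau>) = t - r * t" using assms by (simp add: r_def field_simps)
  have "(t + \<tau>) * (norm (r *\<^sub>R x + z))\<^sup>2 =
     ((t + \<tau>) * r) * r * (x \<bullet> x) + 2 * ((t + \<tau>) * r) * (x \<bullet> z) + (t + \<tau>) * (z \<bullet> z)"
    unfolding power2_norm_eq_inner by (simp add: inner_commute algebra_simps)
  then show ?thesis unfolding rt 2 r_def[symmetric]
    unfolding power2_norm_eq_inner by (simp add: inner_commute algebra_simps)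
qed

text \<open>By completing the square the product is one Gaussian, centred at a multiple of \<open>x\<close>, times a factor
that does not depend on \<open>z\<close>.\<close>

lemma nn_integral_gaussian_product:
  fixes x :: "'a::euclidean_space"
  assumes "0 < t" "0 < \<tau>"
  shows "(\<integral>\<^sup>+(z::'a). ennreal (exp (- (t * (norm (x + z))\<^sup>2)) * exp (- (\<tau> * (norm z)\<^sup>2))) \<partial>lborel) =
    ennreal ((pi / (t + \<tau>)) powr (DIM('a) / 2) * exp (- (t * \<tau> / (t + \<tau>) * (norm x)\<^sup>2)))"
proof -
  define y where "y = (t / (t + \<tau>)) *\<^sub>R x"
  define C where "C = exp (- (t * \<tau> / (t + \<tau>) * (norm x)\<^sup>2))"
  have "(\<integral>\<^sup>+(z::'a). ennreal (exp (- (t * (norm (x + z))\<^sup>2)) * exp (- (\<tau> * (norm z)\<^sup>2))) \<partial>lborel)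
    = (\<integral>\<^sup>+(z::'a). ennreal C * ennreal (exp (- ((t + \<tau>) * (norm (y + z))\<^sup>2))) \<partial>lborel)"
  proof (intro nn_integral_cong)
    fix z :: 'a
    have "exp (- (t * (norm (x + z))\<^sup>2)) * exp (- (\<tau> * (norm z)\<^sup>2)) = exp (- (t * (norm (x + z))\<^sup>2 + \<tau> * (norm z)\<^sup>2))"
      by (simp add: exp_add[symmetric])
    also have "\<dots> = C * exp (- ((t + \<tau>) * (norm (y + z))\<^sup>2))"
      using assms by (subst gaussian_complete_square) (auto simp: C_def y_def exp_add[symmetric])
    finally show "ennreal (exp (- (t * (norm (x + z))\<^sup>2)) * exp (- (\<tau> * (norm z)\<^sup>2))) =
        ennreal C * ennreal (exp (- ((t + \<tau>) * (norm (y + z))\<^sup>2)))"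
      by (simp add: ennreal_mult' C_def)
  qed
  also have "\<dots> = ennreal C * (\<integral>\<^sup>+(z::'a). ennreal (exp (- ((t + \<tau>) * (norm z)\<^sup>2))) \<partial>lborel)"
    by (subst nn_integral_cmult, measurable,
        subst nn_integral_translate[where f="\<lambda>z. ennreal (exp (- ((t + \<tau>) * (norm z)\<^sup>2)))"]) auto
  also have "\<dots> = ennreal (C * (pi / (t + \<tau>)) powr (DIM('a) / 2))"
    using assms by (simp add: nn_integral_gaussian ennreal_mult' C_def)
  finally show ?thesis unfolding C_def by (simp add: mult.commute)
qed

section \<open>Integrals of power kernels\<close>

lemma norm_sq_powr: "((norm y)\<^sup>2) powr a = norm y powr (2 * a)" for y :: "'a::real_normed_vector"
proof (cases "y = 0")
  case False
  then have "(norm y)\<^sup>2 = norm y powr 2" by simp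
  then show ?thesis by (simp only: powr_powr)
qed simp

lemma norm_powr_neg_eq: "norm y powr (- b) = ((norm y)\<^sup>2) powr (- (b / 2))" for y :: "'a::real_normed_vector"
  by (simp add: norm_sq_powr)

lemma nn_integral_norm_powr:
  fixes f :: "'a::euclidean_space \<Rightarrow> real"
  assumes "f \<in> borel_measurable borel" "\<And>y. 0 \<le> f y" "0 < b"
  shows "ennreal (Gamma (b / 2)) * (\<integral>\<^sup>+y. ennreal (f y * norm y powr (- b)) \<partial>lborel) =
    (\<integral>\<^sup>+t\<in>{0<..}. ennreal (t powr (b / 2 - 1)) * (\<integral>\<^sup>+y. ennreal (f y * exp (- (t * (norm y)\<^sup>2))) \<partial>lborel) \<partial>lborel)"
  unfolding norm_powr_neg_eq using assms AE_lborel_singleton[of "0::'a"]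
  by (subst nn_integral_powr_subordination) (auto simp: mult.commute)

text \<open>Subordinating both powers, with parameters \<open>t\<close> and \<open>\<tau>\<close>, leaves the Gaussian product integral. After
\<open>\<tau> = t r\<close> the exponent is linear in \<open>t\<close>, so the \<open>t\<close>-integral is a Gamma integral, which converges because
\<open>\<mu> + \<alpha> p > N\<close>. The remaining \<open>r\<close>-integral is a Beta integral; it converges at \<open>0\<close> because \<open>\<alpha> p < N\<close> and
at infinity because \<open>\<mu> < N\<close>.\<close>

lemma nn_integral_Riesz:
  fixes x :: "'a::euclidean_space" and \<alpha> p \<mu> :: real
  assumes x: "x \<noteq> 0" and \<mu>: "0 < \<mu>" "\<mu> < DIM('a)"
    and ap: "0 < \<alpha> * p" "\<alpha> * p < DIM('a)" "\<mu> + \<alpha> * p > DIM('a)"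
  shows "(\<integral>\<^sup>+y. ennreal (norm (x - y) powr (- \<mu>) * norm y powr (- (\<alpha> * p))) \<partial>lborel) =
    ennreal (C_const DIM('a) \<mu> \<alpha> p * norm x powr (DIM('a) - \<alpha> * p - \<mu>))"
proof -
  define N where "N = real DIM('a)"
  define b where "b = \<alpha> * p"
  note b = ap(1,2)[folded b_def] and bm = ap(3)[folded b_def]
  define w where "w = (norm x)\<^sup>2"
  define k where "k = (\<mu> + b - N) / 2"
  have w: "0 < w" using x by (simp add: w_def)
  have k: "0 < k" using bm by (simp add: k_def N_def)
  define I where "I = (\<integral>\<^sup>+y. ennreal (norm (x - y) powr (- \<mu>) * norm y powr (- b)) \<partial>lborel)"
  define G where "G t \<tau> = (pi / (t + \<tau>)) powr (N / 2) * exp (- (t * \<tau> / (t + \<tau>) * w))" for t \<tau> :: real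
  have [measurable]: "case_prod G \<in> borel_measurable (borel \<Otimes>\<^sub>M borel)" unfolding G_def by measurable
  have G0: "0 \<le> G t \<tau>" for t \<tau> by (simp add: G_def)
  have inner: "ennreal (Gamma (\<mu> / 2)) * (\<integral>\<^sup>+y. ennreal (norm (x - y) powr (- \<mu>) * exp (- (t * (norm y)\<^sup>2))) \<partial>lborel)
     = (\<integral>\<^sup>+\<tau>\<in>{0<..}. ennreal (\<tau> powr (\<mu> / 2 - 1)) * ennreal (G t \<tau>) \<partial>lborel)" if "0 < t" for t
  proof -
    have "(\<integral>\<^sup>+y. ennreal (norm (x - y) powr (- \<mu>) * exp (- (t * (norm y)\<^sup>2))) \<partial>lborel) =
       (\<integral>\<^sup>+z. ennreal (exp (- (t * (norm (x + z))\<^sup>2)) * norm z powr (- \<mu>)) \<partial>lborel)"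
      by (subst nn_integral_translate[symmetric, of _ x]) (auto simp: mult.commute)
    then have "ennreal (Gamma (\<mu> / 2)) * (\<integral>\<^sup>+y. ennreal (norm (x - y) powr (- \<mu>) * exp (- (t * (norm y)\<^sup>2))) \<partial>lborel)
       = (\<integral>\<^sup>+\<tau>\<in>{0<..}. ennreal (\<tau> powr (\<mu> / 2 - 1)) *
          (\<integral>\<^sup>+z. ennreal (exp (- (t * (norm (x + z))\<^sup>2)) * exp (- (\<tau> * (norm z)\<^sup>2))) \<partial>lborel) \<partial>lborel)"
      using \<mu> by (simp add: nn_integral_norm_powr)
    also have "\<dots> = (\<integral>\<^sup>+\<tau>\<in>{0<..}. ennreal (\<tau> powr (\<mu> / 2 - 1)) * ennreal (G t \<tau>) \<partial>lborel)"
      using that by (intro nn_integral_cong)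
        (auto simp: indicator_def nn_integral_gaussian_product G_def N_def w_def)
    finally show ?thesis .
  qed
  have "ennreal (Gamma (b / 2) * Gamma (\<mu> / 2)) * I = ennreal (Gamma (\<mu> / 2)) * (ennreal (Gamma (b / 2)) * I)"
    using b \<mu> by (simp add: ennreal_mult Gamma_real_pos less_imp_le ac_simps)
  also have "\<dots> = ennreal (Gamma (\<mu> / 2)) * (\<integral>\<^sup>+t\<in>{0<..}. ennreal (t powr (b / 2 - 1)) *
       (\<integral>\<^sup>+y. ennreal (norm (x - y) powr (- \<mu>) * exp (- (t * (norm y)\<^sup>2))) \<partial>lborel) \<partial>lborel)"
    unfolding I_def using b by (subst nn_integral_norm_powr) auto
  also have "\<dots> = (\<integral>\<^sup>+t\<in>{0<..}. ennreal (t powr (b / 2 - 1)) * (ennreal (Gamma (\<mu> / 2)) *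
       (\<integral>\<^sup>+y. ennreal (norm (x - y) powr (- \<mu>) * exp (- (t * (norm y)\<^sup>2))) \<partial>lborel)) \<partial>lborel)"
    by (subst nn_integral_cmult[symmetric]) (auto simp: ac_simps)
  also have "\<dots> = (\<integral>\<^sup>+t\<in>{0<..}. ennreal (t powr (b / 2 - 1)) *
       (\<integral>\<^sup>+\<tau>\<in>{0<..}. ennreal (\<tau> powr (\<mu> / 2 - 1)) * ennreal (G t \<tau>) \<partial>lborel) \<partial>lborel)"
    by (intro nn_integral_cong) (auto simp: indicator_def inner)
  also have "\<dots> = (\<integral>\<^sup>+t\<in>{0<..}. (\<integral>\<^sup>+r. ennreal (r powr (\<mu> / 2 - 1) * (1 + r) powr (- (N / 2)) * pi powr (N / 2)) *
       ennreal (t powr (k - 1) * exp (- ((r / (1 + r) * w) * t))) * indicator {0<..} r \<partial>lborel) \<partial>lborel)"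
  proof (intro nn_integral_cong, goal_cases)
    case (1 t)
    show ?case
    proof (cases "0 < t")
      case True
      have "ennreal (t powr (b / 2 - 1)) * (\<integral>\<^sup>+\<tau>\<in>{0<..}. ennreal (\<tau> powr (\<mu> / 2 - 1)) * ennreal (G t \<tau>) \<partial>lborel)
        = ennreal (t powr (b / 2 - 1)) * (ennreal t * (\<integral>\<^sup>+r\<in>{0<..}. ennreal ((t * r) powr (\<mu> / 2 - 1)) * ennreal (G t (t * r)) \<partial>lborel))"
        using True by (subst nn_integral_scale_pos[of _ t]) auto
      also have "\<dots> = (\<integral>\<^sup>+r. ennreal (t powr (b / 2 - 1)) * (ennreal t * (ennreal ((t * r) powr (\<mu> / 2 - 1)) * ennreal (G t (t * r)) * indicator {0<..} r)) \<partial>lborel)"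
        by (simp add: nn_integral_cmult)
      also have "\<dots> = (\<integral>\<^sup>+r. ennreal (r powr (\<mu> / 2 - 1) * (1 + r) powr (- (N / 2)) * pi powr (N / 2)) *
         ennreal (t powr (k - 1) * exp (- ((r / (1 + r) * w) * t))) * indicator {0<..} r \<partial>lborel)"
      proof (intro nn_integral_cong, goal_cases)
        case (1 r)
        show ?case
        proof (cases "0 < r")
          case r: True
          have tr: "t + t * r = t * (1 + r)" by (simp add: algebra_simps)
          have G: "G t (t * r) = pi powr (N / 2) * t powr (- (N / 2)) * (1 + r) powr (- (N / 2)) * exp (- ((r / (1 + r) * w) * t))"
          proof -
            have 1: "(pi / (t * (1 + r))) powr (N / 2) = pi powr (N / 2) * t powr (- (N / 2)) * (1 + r) powr (- (N / 2))"
              using True r by (simp add: powr_divide powr_mult powr_minus_divide)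
            have 2: "t * (t * r) / (t * (1 + r)) * w = (r / (1 + r) * w) * t"
              using True r by simp
            show ?thesis unfolding G_def tr 1 2 ..
          qed
          have e: "t powr (b / 2 - 1) * (t * ((t * r) powr (\<mu> / 2 - 1) * t powr (- (N / 2)))) = r powr (\<mu> / 2 - 1) * t powr (k - 1)"
          proof -
            have "t powr (k - 1) = t powr (b / 2 - 1) * t powr 1 * t powr (\<mu> / 2 - 1) * t powr (- (N / 2))"
              unfolding powr_add[symmetric]
              by (rule arg_cong[where f="\<lambda>z. t powr z"]) (simp add: k_def field_simps)
            then show ?thesis using True r by (simp add: powr_mult)
          qed
          have "t powr (b / 2 - 1) * (t * ((t * r) powr (\<mu> / 2 - 1) * G t (t * r))) =
             (t powr (b / 2 - 1) * (t * ((t * r) powr (\<mu> / 2 - 1) * t powr (- (N / 2))))) * (pi powr (N / 2) * (1 + r) powr (- (N / 2)) * exp (- ((r / (1 + r) * w) * t)))"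
            unfolding G by (simp only: ac_simps)
          then show ?thesis using True r unfolding e
            by (simp add: ennreal_mult'[symmetric] G0 ac_simps)
        qed simp
      qed
      finally show ?thesis using True by simp
    qed simp
  qed
  also have "\<dots> = (\<integral>\<^sup>+r. (\<integral>\<^sup>+t\<in>{0<..}. ennreal (r powr (\<mu> / 2 - 1) * (1 + r) powr (- (N / 2)) * pi powr (N / 2)) *
       ennreal (t powr (k - 1) * exp (- ((r / (1 + r) * w) * t))) * indicator {0<..} r \<partial>lborel) \<partial>lborel)"
    by (rule nn_integral_set_swap) measurable
  also have "\<dots> = (\<integral>\<^sup>+r. ennreal (pi powr (N / 2) * Gamma k * w powr (- k)) *
       (ennreal (r powr ((N - b) / 2 - 1) * (1 + r) powr (- (N / 2 - k))) * indicator {0<..} r) \<partial>lborel)"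
  proof (intro nn_integral_cong, goal_cases)
    case (1 r)
    show ?case
    proof (cases "0 < r")
      case True
      have pos: "0 < r / (1 + r) * w" using True w by simp
      have "(\<integral>\<^sup>+t\<in>{0<..}. ennreal (r powr (\<mu> / 2 - 1) * (1 + r) powr (- (N / 2)) * pi powr (N / 2)) *
         ennreal (t powr (k - 1) * exp (- ((r / (1 + r) * w) * t))) * indicator {0<..} r \<partial>lborel)
        = (\<integral>\<^sup>+t. ennreal (r powr (\<mu> / 2 - 1) * (1 + r) powr (- (N / 2)) * pi powr (N / 2)) *
         (ennreal (t powr (k - 1) * exp (- ((r / (1 + r) * w) * t))) * indicator {0<..} t) \<partial>lborel)"
        using True by (simp add: mult.assoc)
      also have "\<dots> = ennreal (r powr (\<mu> / 2 - 1) * (1 + r) powr (- (N / 2)) * pi powr (N / 2)) *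
         ennreal (Gamma k * (r / (1 + r) * w) powr (- k))"
        by (subst nn_integral_cmult, measurable, subst nn_integral_Gamma[OF pos k]) simp
      also have "\<dots> = ennreal (pi powr (N / 2) * Gamma k * w powr (- k)) *
         ennreal (r powr ((N - b) / 2 - 1) * (1 + r) powr (- (N / 2 - k)))"
      proof -
        have 1: "(r / (1 + r) * w) powr (- k) = r powr (- k) * (1 + r) powr k * w powr (- k)"
          using True w by (simp add: powr_mult powr_divide powr_minus field_simps)
        have 2: "r powr ((N - b) / 2 - 1) = r powr (\<mu> / 2 - 1) * r powr (- k)"
          unfolding powr_add[symmetric]
          by (rule arg_cong[where f="\<lambda>z. r powr z"]) (simp add: k_def field_simps)
        have 3: "(1 + r) powr (- (N / 2 - k)) = (1 + r) powr (- (N / 2)) * (1 + r) powr k"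
          unfolding powr_add[symmetric] by simp
        have "(r powr (\<mu> / 2 - 1) * (1 + r) powr (- (N / 2)) * pi powr (N / 2)) * (Gamma k * (r / (1 + r) * w) powr (- k))
           = (pi powr (N / 2) * Gamma k * w powr (- k)) * (r powr ((N - b) / 2 - 1) * (1 + r) powr (- (N / 2 - k)))"
          unfolding 1 2 3 by (simp only: ac_simps)
        then show ?thesis using Gamma_real_pos[OF k]
          by (simp add: ennreal_mult'[symmetric])
      qed
      finally show ?thesis using True by simp
    qed simp
  qed
  also have "\<dots> = ennreal (pi powr (N / 2) * Gamma k * w powr (- k)) *
     ennreal (Gamma ((N - b) / 2) * Gamma (N / 2 - k - (N - b) / 2) / Gamma (N / 2 - k))"
    using b \<mu> bm by (subst nn_integral_cmult, measurable, subst nn_integral_Beta) (auto simp: N_def k_def field_simps)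
  also have "N / 2 - k - (N - b) / 2 = (N - \<mu>) / 2" by (simp add: k_def field_simps)
  also have "N / 2 - k = (2 * N - \<mu> - b) / 2" by (simp add: k_def field_simps)
  also have "w powr (- k) = norm x powr (N - b - \<mu>)"
    unfolding w_def norm_sq_powr
    by (rule arg_cong[where f="\<lambda>z. norm x powr z"]) (simp add: k_def field_simps)
  finally have "ennreal (Gamma (b / 2) * Gamma (\<mu> / 2)) * I =
     ennreal ((pi powr (N / 2) * Gamma k * norm x powr (N - b - \<mu>)) * (Gamma ((N - b) / 2) * Gamma ((N - \<mu>) / 2) / Gamma ((2 * N - \<mu> - b) / 2)))"
    using Gamma_real_pos[OF k] by (subst (asm) ennreal_mult'[symmetric]) simp_all
  moreover have "0 < Gamma (b / 2) * Gamma (\<mu> / 2)" using b \<mu> by (simp add: Gamma_real_pos)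
  ultimately have "I = ennreal ((pi powr (N / 2) * Gamma k * norm x powr (N - b - \<mu>)) * (Gamma ((N - b) / 2) * Gamma ((N - \<mu>) / 2) / Gamma ((2 * N - \<mu> - b) / 2)) / (Gamma (b / 2) * Gamma (\<mu> / 2)))"
    by (rule ennreal_cancel_left)
  also have "\<dots> = ennreal (C_const N \<mu> \<alpha> p * norm x powr (N - b - \<mu>))"
    by (rule arg_cong[where f=ennreal]) (simp add: C_const_def k_def b_def ac_simps)
  finally show ?thesis unfolding I_def N_def b_def .
qed

text \<open>The constant \<open>K\<close> for which \<open>1 - cos (z \<bullet> \<xi>)\<close>, integrated against \<open>|z|\<^sup>-\<^sup>N\<^sup>-\<^sup>2\<^sup>s\<close>, gives
\<open>K |\<xi>|\<^sup>2\<^sup>s\<close>; the reciprocal of the normalising constant of the fractional Laplacian.\<close>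
definition frac_kernel_const :: "real \<Rightarrow> real \<Rightarrow> real" where
  "frac_kernel_const N s = pi powr (N / 2) * Gamma (1 - s) / (s * 4 powr s * Gamma (N / 2 + s))"

lemma frac_kernel_const_pos: "0 < s \<Longrightarrow> s < 1 \<Longrightarrow> 0 \<le> N \<Longrightarrow> 0 < frac_kernel_const N s"
  by (simp add: frac_kernel_const_def Gamma_real_pos)


text \<open>Subordinating the kernel \<open>|z|\<^sup>-\<^sup>N\<^sup>-\<^sup>2\<^sup>s\<close> produces Gaussian integrals that depend on \<open>1/t\<close>, whereas the
one-dimensional integrals above are in terms of \<open>t\<close>; this substitution relates them.\<close>

lemma nn_integral_inversion:
  fixes f :: "real \<Rightarrow> real"
  assumes [measurable]: "f \<in> borel_measurable borel" and nn: "\<And>r. 0 < r \<Longrightarrow> 0 \<le> f r"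
    and a: "(\<integral>\<^sup>+r\<in>{0<..}. ennreal (f r) \<partial>lborel) = ennreal a" "0 \<le> a"
  shows "(\<integral>\<^sup>+t\<in>{0<..}. ennreal (t powr (- 2) * f (1 / t)) \<partial>lborel) = ennreal a"
proof -
  have "((\<lambda>r. indicator {0<..} r * f r) has_integral a) UNIV"
  proof (rule nn_integral_has_integral)
    have "(\<integral>\<^sup>+x. ennreal (indicator {0<..} x * f x) \<partial>lborel) = (\<integral>\<^sup>+r\<in>{0<..}. ennreal (f r) \<partial>lborel)"
      by (intro nn_integral_cong) (simp add: indicator_def)
    then show "(\<integral>\<^sup>+x. ennreal (indicator {0<..} x * f x) \<partial>lborel) = ennreal a" using a by simp
  qed (use a nn in \<open>auto simp: indicator_def\<close>)
  moreover have "(\<lambda>r. indicator {0<..} r * f r) = (\<lambda>r. if r \<in> {0<..} then f r else 0)"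
    by (auto simp: indicator_def)
  ultimately have "(f has_integral a) {0<..}"
    by (simp only: has_integral_restrict_UNIV)
  then have 1: "f absolutely_integrable_on {0<..}" "integral {0<..} f = a"
    using nn by (auto intro!: nonnegative_absolutely_integrable_1 integral_unique dest: has_integral_integrable)
  have img: "(\<lambda>t. 1 / t) ` {0<..} = {0::real<..}"
  proof (intro set_eqI iffI)
    fix x :: real assume "x \<in> {0<..}"
    then show "x \<in> (\<lambda>t. 1 / t) ` {0<..}" by (intro image_eqI[of _ _ "1 / x"]) auto
  qed auto
  have "(\<lambda>t. \<bar>- (1 / t\<^sup>2)\<bar> * f (1 / t)) absolutely_integrable_on {0<..} \<and>
     integral {0<..} (\<lambda>t. \<bar>- (1 / t\<^sup>2)\<bar> * f (1 / t)) = a"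
    by (subst has_absolute_integral_change_of_variables_1')
       (use 1 img in \<open>auto intro!: derivative_eq_intros simp: inj_on_def power2_eq_square\<close>)
  then have "((\<lambda>t. \<bar>- (1 / t\<^sup>2)\<bar> * f (1 / t)) has_integral a) {0<..}"
    by (auto simp: absolutely_integrable_on_def has_integral_iff)
  then have "((\<lambda>t. t powr (- 2) * f (1 / t)) has_integral a) {0<..}"
    by (rule has_integral_eq[rotated]) (auto simp: powr_minus powr_numeral field_simps)
  then show ?thesis
    using nn by (intro nn_integral_has_integral_lebesgue') auto
qed

lemma nn_integral_cos_kernel:
  fixes \<xi> :: "'a::euclidean_space" and s :: real
  assumes s: "0 < s" "s < 1"
  shows "(\<integral>\<^sup>+(z::'a). ennreal ((1 - cos (z \<bullet> \<xi>)) * norm z powr (- (DIM('a) + 2 * s))) \<partial>lborel) =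
    ennreal (frac_kernel_const DIM('a) s * norm \<xi> powr (2 * s))"
proof -
  define N where "N = real DIM('a)"
  define c where "c = (norm \<xi>)\<^sup>2 / 4"
  have N: "0 < N" by (simp add: N_def)
  have G: "0 < Gamma (N / 2 + s)" using N s by (simp add: Gamma_real_pos)
  have half: "(DIM('a) + 2 * s) / 2 = N / 2 + s" by (simp add: N_def)
  have inv: "(\<integral>\<^sup>+t\<in>{0<..}. ennreal (t powr (- 2) * ((1 / t) powr (- s - 1) * (1 - exp (- (c * (1 / t)))))) \<partial>lborel)
     = ennreal (c powr s * Gamma (1 - s) / s)"
    using s nn_integral_one_minus_exp[OF s, of c]
    by (intro nn_integral_inversion) (auto simp: c_def Gamma_real_pos less_imp_le)
  have "ennreal (Gamma (N / 2 + s)) * (\<integral>\<^sup>+(z::'a). ennreal ((1 - cos (z \<bullet> \<xi>)) * norm z powr (- (DIM('a) + 2 * s))) \<partial>lborel)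
    = (\<integral>\<^sup>+t\<in>{0<..}. ennreal (t powr (N / 2 + s - 1)) *
        (\<integral>\<^sup>+(z::'a). ennreal ((1 - cos (z \<bullet> \<xi>)) * exp (- (t * (norm z)\<^sup>2))) \<partial>lborel) \<partial>lborel)"
    using nn_integral_norm_powr[where f="\<lambda>z. 1 - cos (z \<bullet> \<xi>)" and b="DIM('a) + 2 * s"] s
    unfolding half by (simp add: add_nonneg_pos)
  also have "\<dots> = (\<integral>\<^sup>+t. ennreal (pi powr (N / 2)) * (ennreal (t powr (- 2) * ((1 / t) powr (- s - 1) * (1 - exp (- (c * (1 / t)))))) * indicator {0<..} t) \<partial>lborel)"
  proof (intro nn_integral_cong, goal_cases)
    case (1 t)
    show ?case
    proof (cases "0 < t")
      case True
      have 1: "(\<integral>\<^sup>+(z::'a). ennreal ((1 - cos (z \<bullet> \<xi>)) * exp (- (t * (norm z)\<^sup>2))) \<partial>lborel)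
         = ennreal ((pi / t) powr (N / 2) * (1 - exp (- (c * (1 / t)))))"
        using True by (subst nn_integral_gaussian_cos) (auto simp: N_def c_def field_simps)
      have 2: "(pi / t) powr (N / 2) = pi powr (N / 2) * t powr (- (N / 2))"
        using True by (simp add: powr_divide powr_minus field_simps)
      have 3: "t powr (- 2) * (1 / t) powr (- s - 1) = t powr (s - 1)"
      proof -
        have "1 / t = t powr (- 1)" using True by (simp add: powr_minus_divide)
        then show ?thesis by (simp only: powr_powr powr_add[symmetric]) simp
      qed
      have 4: "t powr (s - 1) = t powr (N / 2 + s - 1) * t powr (- (N / 2))"
        unfolding powr_add[symmetric] by simp
      have "t powr (N / 2 + s - 1) * ((pi / t) powr (N / 2) * (1 - exp (- (c * (1 / t)))))
         = pi powr (N / 2) * ((t powr (- 2) * (1 / t) powr (- s - 1)) * (1 - exp (- (c * (1 / t)))))"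
        unfolding 3 unfolding 2 4 by (simp only: ac_simps)
      then have "ennreal (t powr (N / 2 + s - 1)) * ennreal ((pi / t) powr (N / 2) * (1 - exp (- (c * (1 / t)))))
         = ennreal (pi powr (N / 2)) * ennreal (t powr (- 2) * ((1 / t) powr (- s - 1) * (1 - exp (- (c * (1 / t))))))"
        by (subst (1 2) ennreal_mult'[symmetric]) (simp_all only: powr_ge_zero mult.assoc)
      then show ?thesis
        using True unfolding 1 by (simp add: mult.assoc)
    qed simp
  qed
  also have "\<dots> = ennreal (pi powr (N / 2) * (c powr s * Gamma (1 - s) / s))"
    by (subst nn_integral_cmult, measurable, subst inv) (rule ennreal_mult'[symmetric], simp)
  finally have "(\<integral>\<^sup>+(z::'a). ennreal ((1 - cos (z \<bullet> \<xi>)) * norm z powr (- (DIM('a) + 2 * s))) \<partial>lborel) =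
     ennreal (pi powr (N / 2) * (c powr s * Gamma (1 - s) / s) / Gamma (N / 2 + s))"
    using G by (rule ennreal_cancel_left)
  also have "c powr s = norm \<xi> powr (2 * s) / 4 powr s"
    by (simp add: c_def powr_divide norm_sq_powr)
  also have "pi powr (N / 2) * (norm \<xi> powr (2 * s) / 4 powr s * Gamma (1 - s) / s) / Gamma (N / 2 + s) =
     frac_kernel_const N s * norm \<xi> powr (2 * s)"
    by (simp add: frac_kernel_const_def ac_simps)
  finally show ?thesis unfolding N_def .
qed

text \<open>The factor \<open>1 - exp (- |z|\<^sup>2)\<close> is comparable to the minimum of \<open>1\<close> and \<open>|z|\<^sup>2\<close>. It is the smooth stand-in
for that minimum whose integral against the kernel can be computed, and it is the majorant used
both near and away from the singularity in what follows.\<close>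

lemma nn_integral_gauss_kernel:
  fixes s :: real
  assumes s: "0 < s" "s < 1"
  shows "(\<integral>\<^sup>+(z::'a::euclidean_space). ennreal ((1 - exp (- (norm z)\<^sup>2)) * norm z powr (- (DIM('a) + 2 * s))) \<partial>lborel) < \<infinity>"
proof -
  define N where "N = real DIM('a)"
  have N: "0 < N" by (simp add: N_def)
  have G: "0 < Gamma (N / 2 + s)" using N s by (simp add: Gamma_real_pos)
  have half: "(DIM('a) + 2 * s) / 2 = N / 2 + s" by (simp add: N_def)
  define A where "A = Gamma (1 - s) / s * (Gamma (N / 2 + s) / Gamma (N / 2))"
  have "0 \<le> A" using s N by (simp add: A_def Gamma_real_pos less_imp_le)
  have inv: "(\<integral>\<^sup>+t\<in>{0<..}. ennreal (t powr (- 2) * ((1 / t) powr (- s - 1) * (1 - (1 + 1 / t) powr (- (N / 2))))) \<partial>lborel)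
     = ennreal A"
    using N \<open>0 \<le> A\<close> nn_integral_one_minus_powr[OF s, of "N / 2"]
    by (intro nn_integral_inversion) (auto simp: A_def powr_minus inverse_le_1_iff ge_one_powr_ge_zero)
  have "ennreal (Gamma (N / 2 + s)) * (\<integral>\<^sup>+(z::'a). ennreal ((1 - exp (- (norm z)\<^sup>2)) * norm z powr (- (DIM('a) + 2 * s))) \<partial>lborel)
    = (\<integral>\<^sup>+t\<in>{0<..}. ennreal (t powr (N / 2 + s - 1)) *
        (\<integral>\<^sup>+(z::'a). ennreal ((1 - exp (- (norm z)\<^sup>2)) * exp (- (t * (norm z)\<^sup>2))) \<partial>lborel) \<partial>lborel)"
    using nn_integral_norm_powr[where f="\<lambda>z::'a. 1 - exp (- (norm z)\<^sup>2)" and b="DIM('a) + 2 * s"] s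
    unfolding half by (simp add: add_nonneg_pos)
  also have "\<dots> = (\<integral>\<^sup>+t. ennreal (pi powr (N / 2)) * (ennreal (t powr (- 2) * ((1 / t) powr (- s - 1) * (1 - (1 + 1 / t) powr (- (N / 2))))) * indicator {0<..} t) \<partial>lborel)"
  proof (intro nn_integral_cong, goal_cases)
    case (1 t)
    show ?case
    proof (cases "0 < t")
      case True
      have "(\<integral>\<^sup>+(z::'a). ennreal (exp (- (t * (norm z)\<^sup>2)) - exp (- ((t + 1) * (norm z)\<^sup>2))) \<partial>lborel)
         = ennreal ((pi / t) powr (N / 2) - (pi / (t + 1)) powr (N / 2))"
        using True by (intro nn_integral_real_diff) (auto simp: nn_integral_gaussian N_def mult_right_mono)
      also have "(\<lambda>z::'a. ennreal (exp (- (t * (norm z)\<^sup>2)) - exp (- ((t + 1) * (norm z)\<^sup>2)))) =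
         (\<lambda>z. ennreal ((1 - exp (- (norm z)\<^sup>2)) * exp (- (t * (norm z)\<^sup>2))))"
        by (simp add: algebra_simps exp_add[symmetric])
      finally have 1: "(\<integral>\<^sup>+(z::'a). ennreal ((1 - exp (- (norm z)\<^sup>2)) * exp (- (t * (norm z)\<^sup>2))) \<partial>lborel)
         = ennreal ((pi / t) powr (N / 2) - (pi / (t + 1)) powr (N / 2))" .
      have "1 + 1 / t = (t + 1) / t" using True by (simp add: field_simps)
      then have 2: "(pi / t) powr (N / 2) - (pi / (t + 1)) powr (N / 2) =
          pi powr (N / 2) * t powr (- (N / 2)) * (1 - (1 + 1 / t) powr (- (N / 2)))"
        using True by (simp add: powr_divide powr_minus field_simps)
      have 3: "t powr (- 2) * (1 / t) powr (- s - 1) = t powr (s - 1)"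
      proof -
        have "1 / t = t powr (- 1)" using True by (simp add: powr_minus_divide)
        then show ?thesis by (simp only: powr_powr powr_add[symmetric]) simp
      qed
      have 4: "t powr (s - 1) = t powr (N / 2 + s - 1) * t powr (- (N / 2))"
        unfolding powr_add[symmetric] by simp
      have "t powr (N / 2 + s - 1) * ((pi / t) powr (N / 2) - (pi / (t + 1)) powr (N / 2))
         = pi powr (N / 2) * ((t powr (- 2) * (1 / t) powr (- s - 1)) * (1 - (1 + 1 / t) powr (- (N / 2))))"
        unfolding 3 unfolding 2 4 by (simp only: ac_simps)
      then have "ennreal (t powr (N / 2 + s - 1)) * ennreal ((pi / t) powr (N / 2) - (pi / (t + 1)) powr (N / 2))
         = ennreal (pi powr (N / 2)) * ennreal (t powr (- 2) * ((1 / t) powr (- s - 1) * (1 - (1 + 1 / t) powr (- (N / 2)))))"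
        by (subst (1 2) ennreal_mult'[symmetric]) (simp_all only: powr_ge_zero mult.assoc)
      then show ?thesis
        using True unfolding 1 by (simp add: mult.assoc)
    qed simp
  qed
  also have "\<dots> = ennreal (pi powr (N / 2) * A)"
    by (subst nn_integral_cmult, measurable, subst inv) (rule ennreal_mult'[symmetric], simp)
  finally have "(\<integral>\<^sup>+(z::'a). ennreal ((1 - exp (- (norm z)\<^sup>2)) * norm z powr (- (DIM('a) + 2 * s))) \<partial>lborel) =
     ennreal (pi powr (N / 2) * A / Gamma (N / 2 + s))"
    using G by (rule ennreal_cancel_left)
  then show ?thesis by simp
qed

section \<open>Principal values and second differences\<close>

lemma lborel_distr_isometry:
  fixes x :: "'a::euclidean_space"
  assumes "\<bar>c\<bar> = 1"
  shows "distr lborel borel (\<lambda>z. x + c *\<^sub>R z) = lborel"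
proof -
  have "c \<noteq> 0" using assms by auto
  from lborel_affine[OF this, of x] show ?thesis using assms by (simp add: density_1)
qed

lemma
  fixes f :: "'a::euclidean_space \<Rightarrow> 'b::{banach, second_countable_topology}"
  assumes [measurable]: "f \<in> borel_measurable borel" and c: "\<bar>c\<bar> = 1"
  shows integrable_isometry: "integrable lborel (\<lambda>z. f (x + c *\<^sub>R z)) \<longleftrightarrow> integrable lborel f"
    and integral_isometry: "(LINT z|lborel. f (x + c *\<^sub>R z)) = (LINT z|lborel. f z)"
proof -
  show "integrable lborel (\<lambda>z. f (x + c *\<^sub>R z)) \<longleftrightarrow> integrable lborel f"
    using integrable_distr_eq[of "\<lambda>z. x + c *\<^sub>R z" lborel borel f] lborel_distr_isometry[OF c, of x] by simp
  show "(LINT z|lborel. f (x + c *\<^sub>R z)) = (LINT z|lborel. f z)"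
    using integral_distr[of "\<lambda>z. x + c *\<^sub>R z" lborel borel f] lborel_distr_isometry[OF c, of x] by simp
qed

lemma integrable_gauss_kernel:
  fixes s :: real
  assumes s: "0 < s" "s < (1::real)"
  shows "integrable lborel (\<lambda>z::'a::euclidean_space. (1 - exp (- (norm z)\<^sup>2)) * norm z powr (- (DIM('a) + 2 * s)))"
  using nn_integral_gauss_kernel[OF s, where 'a='a]
  by (intro integrableI_nonneg) auto

text \<open>For \<open>|z| > \<epsilon>\<close> the factor \<open>1 - exp (- |z|\<^sup>2)\<close> is bounded below by \<open>1 - exp (- \<epsilon>\<^sup>2)\<close>.\<close>

lemma integrable_kernel_tail:
  fixes s \<epsilon> :: real
  assumes s: "0 < s" "s < (1::real)" and \<epsilon>: "0 < \<epsilon>"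
  shows "set_integrable lborel {z::'a::euclidean_space. \<epsilon> < norm z} (\<lambda>z. norm z powr (- (DIM('a) + 2 * s)))"
  unfolding set_integrable_def
proof (rule Bochner_Integration.integrable_bound)
  define c where "c = 1 - exp (- \<epsilon>\<^sup>2)"
  have c: "0 < c" using \<epsilon> by (simp add: c_def)
  show "integrable lborel (\<lambda>z::'a. (1 / c) * ((1 - exp (- (norm z)\<^sup>2)) * norm z powr (- (DIM('a) + 2 * s))))"
    using integrable_gauss_kernel[OF s] by (rule integrable_mult_right)
  show "AE z::'a in lborel. norm (indicator {z. \<epsilon> < norm z} z *\<^sub>R norm z powr (- (DIM('a) + 2 * s)))
    \<le> norm ((1 / c) * ((1 - exp (- (norm z)\<^sup>2)) * norm z powr (- (DIM('a) + 2 * s))))"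
  proof (rule AE_I2)
    fix z :: 'a
    show "norm (indicator {z. \<epsilon> < norm z} z *\<^sub>R norm z powr (- (DIM('a) + 2 * s)))
      \<le> norm ((1 / c) * ((1 - exp (- (norm z)\<^sup>2)) * norm z powr (- (DIM('a) + 2 * s))))"
    proof (cases "\<epsilon> < norm z")
      case True
      then have "\<epsilon>\<^sup>2 \<le> (norm z)\<^sup>2" using \<epsilon> by (intro power_mono) auto
      then have "1 \<le> (1 / c) * (1 - exp (- (norm z)\<^sup>2))" using c by (simp add: field_simps c_def)
      from mult_right_mono[OF this, of "norm z powr (- (DIM('a) + 2 * s))"] True c show ?thesis
        by (simp add: abs_mult)
    qed simp
  qed
qed auto

text \<open>The function \<open>t \<mapsto> g t + g (- t)\<close> has derivative \<open>g' t - g' (- t)\<close>, which the mean value inequality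
bounds by \<open>2 B |t|\<close>; a second application bounds the difference of its values at \<open>1\<close> and \<open>0\<close>.\<close>

lemma second_difference_bound:
  fixes g :: "real \<Rightarrow> 'b::real_normed_vector"
  assumes g: "\<And>t. t \<in> {-1..1} \<Longrightarrow> (g has_vector_derivative g' t) (at t)"
    and g': "\<And>t. t \<in> {-1..1} \<Longrightarrow> (g' has_vector_derivative g'' t) (at t)"
    and B: "\<And>t. t \<in> {-1..1} \<Longrightarrow> norm (g'' t) \<le> B"
  shows "norm (2 *\<^sub>R g 0 - g 1 - g (- 1)) \<le> 2 * B"
proof -
  have bound: "norm (f b - f a) \<le> C * \<bar>b - a\<bar>"
    if f: "\<And>t. t \<in> S \<Longrightarrow> (f has_vector_derivative f' t) (at t)"
      and C: "\<And>t. t \<in> S \<Longrightarrow> norm (f' t) \<le> C" and S: "convex S" "a \<in> S" "b \<in> S"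
    for f f' :: "real \<Rightarrow> 'b" and S a b C
  proof -
    have "norm (f b - f a) \<le> C * norm (b - a)"
    proof (rule differentiable_bound[OF S(1) _ _ S(3,2)])
      show "(f has_derivative (\<lambda>h. h *\<^sub>R f' t)) (at t within S)" if "t \<in> S" for t
        using f[OF that] by (auto simp: has_vector_derivative_def intro: has_derivative_at_withinI)
      show "onorm (\<lambda>h. h *\<^sub>R f' t) \<le> C" if "t \<in> S" for t
      proof (rule onorm_bound)
        show "0 \<le> C" using C[OF that] norm_ge_zero order_trans by blast
        show "norm (h *\<^sub>R f' t) \<le> C * norm h" for h
          using mult_left_mono[OF C[OF that], of "\<bar>h\<bar>"] by (simp add: mult.commute)
      qed
    qed
    then show ?thesis by simp
  qed
  have B0: "0 \<le> B" using B[of 0] norm_ge_zero[of "g'' 0"] by (simp del: norm_ge_zero)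
  define h where "h t = g t + g (- t)" for t
  have h: "(h has_vector_derivative (g' t - g' (- t))) (at t)" if "t \<in> {0..1}" for t
  proof -
    have "((\<lambda>t. g (- t)) has_vector_derivative (- 1) *\<^sub>R g' (- t)) (at t)"
    proof -
      have "(uminus has_vector_derivative (- 1)) (at t)" by (auto intro!: derivative_eq_intros)
      from vector_diff_chain_at[OF this g[of "- t"]] that show ?thesis by (simp add: o_def)
    qed
    then show ?thesis
      unfolding h_def using g[of t] that by (auto intro!: derivative_eq_intros)
  qed
  have h': "norm (g' t - g' (- t)) \<le> 2 * B" if t: "t \<in> {0..1}" for t
  proof -
    have "norm (g' t - g' (- t)) \<le> B * \<bar>t - (- t)\<bar>"
      using t by (intro bound[where S="{-1..1}" and f'=g'']) (auto intro: g' B)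
    also have "\<dots> \<le> B * 2" using t B0 by (intro mult_left_mono) auto
    finally show ?thesis by simp
  qed
  have "norm (h 1 - h 0) \<le> 2 * B * \<bar>1 - 0\<bar>"
    using h' by (intro bound[where S="{0..1}"]) (auto intro: h)
  also have "h 1 - h 0 = - (2 *\<^sub>R g 0 - g 1 - g (- 1))"
    by (simp add: h_def scaleR_2)
  finally show ?thesis by (simp only: norm_minus_cancel) simp
qed

lemma le_one_minus_exp:
  assumes "0 \<le> v" "v \<le> R"
  shows "v \<le> (1 + R) * (1 - exp (- (v::real)))"
proof -
  have "exp (- v) \<le> 1 / (1 + v)"
    using exp_ge_add_one_self[of v] assms by (simp add: exp_minus field_simps)
  then have "v / (1 + v) \<le> 1 - exp (- v)" using assms by (simp add: field_simps)
  then have "v \<le> (1 + v) * (1 - exp (- v))" using assms by (simp add: field_simps)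
  also have "\<dots> \<le> (1 + R) * (1 - exp (- v))" using assms by (intro mult_right_mono) auto
  finally show ?thesis .
qed

text \<open>A function whose truncated integrals exist and whose second difference at \<open>x\<close> is quadratically small.
Since the truncation region is symmetric about \<open>x\<close>, the truncated integral over \<open>y = x + z\<close> equals that
over \<open>y = x - z\<close>, so their mean is half the truncated integral of the second difference. The latter is
integrable over the whole space, and dominated convergence removes the truncation.\<close>

context
  fixes u :: "'a::euclidean_space \<Rightarrow> 'b::{banach, second_countable_topology}" and s r B :: real and x :: 'a
  assumes s: "0 < s" "s < 1"
    and u_meas [measurable]: "u \<in> borel_measurable borel"
    and tail: "\<And>\<epsilon>. 0 < \<epsilon> \<Longrightarrow> set_integrable lborel {y. \<epsilon> < dist x y}
      (\<lambda>y. (u x - u y) /\<^sub>R norm (x - y) powr (DIM('a) + 2 * s))"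
    and r: "0 < r"
    and near: "\<And>z. norm z \<le> r \<Longrightarrow> norm (2 *\<^sub>R u x - u (x + z) - u (x - z)) \<le> B * (norm z)\<^sup>2"
begin

private definition trunc :: "real \<Rightarrow> 'a \<Rightarrow> 'b" where
  "trunc \<epsilon> y = indicator {y. \<epsilon> < dist x y} y *\<^sub>R ((u x - u y) /\<^sub>R norm (x - y) powr (DIM('a) + 2 * s))"

private definition sdiff :: "'a \<Rightarrow> 'b" where
  "sdiff z = (2 *\<^sub>R u x - u (x + z) - u (x - z)) /\<^sub>R norm z powr (DIM('a) + 2 * s)"

private lemma trunc_meas [measurable]: "trunc \<epsilon> \<in> borel_measurable borel"
  unfolding trunc_def by measurable

private lemma sdiff_meas [measurable]: "sdiff \<in> borel_measurable borel"
  unfolding sdiff_def by measurable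

private lemma trunc_sum:
  "trunc \<epsilon> (x + 1 *\<^sub>R z) + trunc \<epsilon> (x + (- 1) *\<^sub>R z) = indicator {z. \<epsilon> < norm z} z *\<^sub>R sdiff z"
proof -
  have "(u x - u (x + z)) + (u x - u (x - z)) = 2 *\<^sub>R u x - u (x + z) - u (x - z)"
    by (simp add: scaleR_2)
  then show ?thesis
    by (simp add: trunc_def sdiff_def dist_norm indicator_def scaleR_add_right[symmetric])
qed

private lemma trunc_integrable: "0 < \<epsilon> \<Longrightarrow> integrable lborel (trunc \<epsilon>)"
  using tail[of \<epsilon>] unfolding set_integrable_def trunc_def[abs_def] .

private lemma sdiff_tail:
  assumes "0 < \<epsilon>"
  shows "integrable lborel (\<lambda>z. indicator {z. \<epsilon> < norm z} z *\<^sub>R sdiff z)"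
    and "(LINT z|lborel. indicator {z. \<epsilon> < norm z} z *\<^sub>R sdiff z) = 2 *\<^sub>R (LINT y|lborel. trunc \<epsilon> y)"
proof -
  have *: "integrable lborel (\<lambda>z. trunc \<epsilon> (x + c *\<^sub>R z))" "(LINT z|lborel. trunc \<epsilon> (x + c *\<^sub>R z)) = (LINT y|lborel. trunc \<epsilon> y)"
    if "\<bar>c\<bar> = 1" for c
    using that trunc_integrable[OF assms] by (simp_all add: integrable_isometry integral_isometry)
  show "integrable lborel (\<lambda>z. indicator {z. \<epsilon> < norm z} z *\<^sub>R sdiff z)"
    unfolding trunc_sum[symmetric] by (intro Bochner_Integration.integrable_add *) auto
  show "(LINT z|lborel. indicator {z. \<epsilon> < norm z} z *\<^sub>R sdiff z) = 2 *\<^sub>R (LINT y|lborel. trunc \<epsilon> y)"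
    unfolding trunc_sum[symmetric]
    by (subst Bochner_Integration.integral_add[OF *(1) *(1)]) (simp_all only: *(2) abs_one abs_minus scaleR_2)
qed

lemma second_difference_integrable:
  "integrable lborel (\<lambda>z. (2 *\<^sub>R u x - u (x + z) - u (x - z)) /\<^sub>R norm z powr (DIM('a) + 2 * s))"
proof -
  have B0: "0 \<le> B"
  proof -
    obtain z :: 'a where "norm z = r" using r vector_choose_size[of r] by auto
    with near[of z] have "0 \<le> B * r\<^sup>2" using norm_ge_zero order_trans by blast
    then show ?thesis using r by (simp add: zero_le_mult_iff)
  qed
  have "integrable lborel (\<lambda>z. indicator {z. \<not> r < norm z} z *\<^sub>R sdiff z)"
  proof (rule Bochner_Integration.integrable_bound)
    show "integrable lborel (\<lambda>z::'a. (B * (1 + r\<^sup>2)) * ((1 - exp (- (norm z)\<^sup>2)) * norm z powr (- (DIM('a) + 2 * s))))"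
      using integrable_gauss_kernel[OF s] by (rule integrable_mult_right)
    show "AE z in lborel. norm (indicator {z. \<not> r < norm z} z *\<^sub>R sdiff z) \<le>
       norm ((B * (1 + r\<^sup>2)) * ((1 - exp (- (norm z)\<^sup>2)) * norm z powr (- (DIM('a) + 2 * s))))"
    proof (rule AE_I2)
      fix z :: 'a
      show "norm (indicator {z. \<not> r < norm z} z *\<^sub>R sdiff z) \<le>
         norm ((B * (1 + r\<^sup>2)) * ((1 - exp (- (norm z)\<^sup>2)) * norm z powr (- (DIM('a) + 2 * s))))"
      proof (cases "norm z \<le> r")
        case True
        then have "(norm z)\<^sup>2 \<le> (1 + r\<^sup>2) * (1 - exp (- (norm z)\<^sup>2))"
          by (intro le_one_minus_exp) (auto intro: power_mono)
        then have "norm (2 *\<^sub>R u x - u (x + z) - u (x - z)) \<le> B * ((1 + r\<^sup>2) * (1 - exp (- (norm z)\<^sup>2)))"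
          using near[OF True] B0 by (meson mult_left_mono order_trans)
        from mult_right_mono[OF this, of "norm z powr (- (DIM('a) + 2 * s))"] True B0
        show ?thesis by (simp add: sdiff_def powr_minus abs_mult ac_simps del: minus_add_distrib)
      qed simp
    qed
  qed auto
  from Bochner_Integration.integrable_add[OF this sdiff_tail(1)[OF r]]
  have "integrable lborel (\<lambda>z. indicator {z. \<not> r < norm z} z *\<^sub>R sdiff z + indicator {z. r < norm z} z *\<^sub>R sdiff z)" .
  also have "(\<lambda>z. indicator {z. \<not> r < norm z} z *\<^sub>R sdiff z + indicator {z. r < norm z} z *\<^sub>R sdiff z) = sdiff"
    by (auto simp: indicator_def)
  finally show ?thesis unfolding sdiff_def[abs_def] .
qed

lemma has_pv_integral_second_difference:
  "has_pv_integral (\<lambda>y. (u x - u y) /\<^sub>R norm (x - y) powr (DIM('a) + 2 * s)) x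
    ((1 / 2) *\<^sub>R (LINT z|lborel. (2 *\<^sub>R u x - u (x + z) - u (x - z)) /\<^sub>R norm z powr (DIM('a) + 2 * s)))"
proof -
  have int: "integrable lborel sdiff"
    using second_difference_integrable unfolding sdiff_def[abs_def] .
  have "((\<lambda>\<epsilon>. LINT y|lborel. trunc \<epsilon> y) \<longlongrightarrow> (1 / 2) *\<^sub>R (LINT z|lborel. sdiff z)) (at_right 0)"
  proof (rule tendsto_at_right_sequentially[of 0 1])
    fix S :: "nat \<Rightarrow> real"
    assume S: "\<And>n. 0 < S n" "S \<longlonglongrightarrow> 0"
    have "(\<lambda>n. LINT z|lborel. indicator {z. S n < norm z} z *\<^sub>R sdiff z) \<longlonglongrightarrow> (LINT z|lborel. sdiff z)"
    proof (rule integral_dominated_convergence[where w="\<lambda>z. norm (sdiff z)"])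
      show "AE z in lborel. (\<lambda>n. indicator {z. S n < norm z} z *\<^sub>R sdiff z) \<longlonglongrightarrow> sdiff z"
      proof (rule AE_I2)
        fix z :: 'a
        show "(\<lambda>n. indicator {z. S n < norm z} z *\<^sub>R sdiff z) \<longlonglongrightarrow> sdiff z"
        proof (cases "z = 0")
          \<comment> \<open>No truncation ever reaches \<open>z = 0\<close>, but there the quotient is \<open>0\<close> by convention.\<close>
          case True
          then show ?thesis by (simp add: sdiff_def)
        next
          case False
          then have "eventually (\<lambda>n. S n < norm z) sequentially"
            using order_tendstoD(2)[OF S(2)] by simp
          then have "eventually (\<lambda>n. indicator {z. S n < norm z} z *\<^sub>R sdiff z = sdiff z) sequentially"
            by eventually_elim simp
          then show ?thesis by (rule tendsto_eventually)
        qed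
      qed
    qed (use int in \<open>auto simp: indicator_def\<close>)
    then have "(\<lambda>n. (1 / 2) *\<^sub>R (2 *\<^sub>R (LINT y|lborel. trunc (S n) y))) \<longlonglongrightarrow> (1 / 2) *\<^sub>R (LINT z|lborel. sdiff z)"
      unfolding sdiff_tail(2)[OF S(1)] by (intro tendsto_intros)
    then show "(\<lambda>n. LINT y|lborel. trunc (S n) y) \<longlonglongrightarrow> (1 / 2) *\<^sub>R (LINT z|lborel. sdiff z)" by simp
  qed simp
  then show ?thesis
    using tail unfolding has_pv_integral_def set_lebesgue_integral_def trunc_def[abs_def] sdiff_def[abs_def] by blast
qed

end

section \<open>The fractional Laplacian of a power\<close>

text \<open>On \<open>|x - y| > \<epsilon>\<close> the kernel is at most a constant times \<open>|x - y|\<^sup>-\<^sup>\<mu>\<close> for any \<open>\<mu> \<le> N + 2s\<close>. With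
\<open>\<mu> = N - \<beta>/2\<close> the product with \<open>|y|\<^sup>-\<^sup>\<beta>\<close> is a convergent Riesz integral, which takes care of the
singularity at the origin and of infinity at the same time.\<close>

lemma set_integrable_power_over_kernel:
  fixes x :: "'a::euclidean_space" and s \<beta> \<epsilon> :: real
  assumes s: "0 < s" "s < 1" and x: "x \<noteq> 0" and \<beta>: "0 < \<beta>" "\<beta> < DIM('a)" and \<epsilon>: "0 < \<epsilon>"
  shows "set_integrable lborel {y. \<epsilon> < dist x y}
    (\<lambda>y. (norm x powr (- \<beta>) - norm y powr (- \<beta>)) /\<^sub>R norm (x - y) powr (DIM('a) + 2 * s))"
proof -
  define K where "K = DIM('a) + 2 * s"
  define \<mu> where "\<mu> = DIM('a) - \<beta> / 2"
  have "set_integrable lborel {y. \<epsilon> < dist x y} (\<lambda>y. norm x powr (- \<beta>) * norm (x - y) powr (- K))"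
  proof -
    have "integrable lborel (\<lambda>z::'a. indicator {z. \<epsilon> < norm z} z *\<^sub>R norm z powr (- K))"
      using integrable_kernel_tail[OF s \<epsilon>] unfolding set_integrable_def K_def .
    then have "integrable lborel (\<lambda>y::'a. indicator {z. \<epsilon> < norm z} (x + (- 1) *\<^sub>R y) *\<^sub>R norm (x + (- 1) *\<^sub>R y) powr (- K))"
      by (subst integrable_isometry) auto
    then have "integrable lborel (\<lambda>y::'a. norm x powr (- \<beta>) * (indicator {z. \<epsilon> < norm z} (x + (- 1) *\<^sub>R y) *\<^sub>R norm (x + (- 1) *\<^sub>R y) powr (- K)))"
      by (rule integrable_mult_right)
    then show ?thesis
      unfolding set_integrable_def by (simp add: dist_norm indicator_def ac_simps)
  qed
  moreover have "set_integrable lborel {y. \<epsilon> < dist x y} (\<lambda>y. norm y powr (- \<beta>) * norm (x - y) powr (- K))"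
    unfolding set_integrable_def
  proof (rule Bochner_Integration.integrable_bound)
    have "(\<integral>\<^sup>+y. ennreal (norm (x - y) powr (- \<mu>) * norm y powr (- (\<beta> * 1))) \<partial>lborel) < \<infinity>"
      using \<beta> by (subst nn_integral_Riesz[OF x]) (auto simp: \<mu>_def)
    then have "integrable lborel (\<lambda>y. norm (x - y) powr (- \<mu>) * norm y powr (- \<beta>))"
      by (intro integrableI_nonneg) auto
    then show "integrable lborel (\<lambda>y. \<epsilon> powr (\<mu> - K) * (norm (x - y) powr (- \<mu>) * norm y powr (- \<beta>)))"
      by (rule integrable_mult_right)
    show "AE y in lborel. norm (indicator {y. \<epsilon> < dist x y} y *\<^sub>R (norm y powr (- \<beta>) * norm (x - y) powr (- K)))
      \<le> norm (\<epsilon> powr (\<mu> - K) * (norm (x - y) powr (- \<mu>) * norm y powr (- \<beta>)))"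
    proof (rule AE_I2)
      fix y
      show "norm (indicator {y. \<epsilon> < dist x y} y *\<^sub>R (norm y powr (- \<beta>) * norm (x - y) powr (- K)))
        \<le> norm (\<epsilon> powr (\<mu> - K) * (norm (x - y) powr (- \<mu>) * norm y powr (- \<beta>)))"
      proof (cases "\<epsilon> < dist x y")
        case True
        have "norm (x - y) powr (- K) = norm (x - y) powr (\<mu> - K) * norm (x - y) powr (- \<mu>)"
          unfolding powr_add[symmetric] by simp
        also have "\<dots> \<le> \<epsilon> powr (\<mu> - K) * norm (x - y) powr (- \<mu>)"
          using True \<epsilon> s \<beta>
          by (intro mult_right_mono powr_mono2') (auto simp: dist_norm \<mu>_def K_def)
        finally have "norm (x - y) powr (- K) * norm y powr (- \<beta>) \<le> \<epsilon> powr (\<mu> - K) * norm (x - y) powr (- \<mu>) * norm y powr (- \<beta>)"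
          by (rule mult_right_mono) simp
        with True show ?thesis by (simp add: abs_mult ac_simps)
      qed simp
    qed
  qed auto
  ultimately have "set_integrable lborel {y. \<epsilon> < dist x y}
     (\<lambda>y. norm x powr (- \<beta>) * norm (x - y) powr (- K) - norm y powr (- \<beta>) * norm (x - y) powr (- K))"
    by (rule set_integral_diff)
  also have "(\<lambda>y. norm x powr (- \<beta>) * norm (x - y) powr (- K) - norm y powr (- \<beta>) * norm (x - y) powr (- K)) =
     (\<lambda>y. (norm x powr (- \<beta>) - norm y powr (- \<beta>)) /\<^sub>R norm (x - y) powr K)"
    by (simp add: powr_minus left_diff_distrib[symmetric] mult.commute)
  finally show ?thesis unfolding K_def .
qed

text \<open>On the segment from \<open>x - z\<close> to \<open>x + z\<close> with \<open>|z| \<le> |x|/2\<close> the squared norm \<open>w\<close> stays above \<open>|x|\<^sup>2/4\<close>. So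
\<open>w powr (- \<beta>/2)\<close> has a second derivative along the segment that is bounded by a constant times
\<open>|z|\<^sup>2\<close>, namely through \<open>w'\<^sup>2\<close> and \<open>w'' = 2 |z|\<^sup>2\<close>.\<close>

lemma second_difference_norm_powr:
  fixes x :: "'a::euclidean_space" and \<beta> :: real
  assumes x: "x \<noteq> 0" and \<beta>: "0 < \<beta>"
  obtains B where "\<And>z. norm z \<le> norm x / 2 \<Longrightarrow>
    norm (2 *\<^sub>R norm x powr (- \<beta>) - norm (x + z) powr (- \<beta>) - norm (x - z) powr (- \<beta>)) \<le> B * (norm z)\<^sup>2"
proof -
  define b where "b = - (\<beta> / 2)"
  define m where "m = (norm x)\<^sup>2 / 4"
  define C where "C = \<bar>b * (b - 1)\<bar> * m powr (b - 2) * (16 * (norm x)\<^sup>2) + \<bar>b\<bar> * m powr (b - 1) * 2"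
  have m: "0 < m" using x by (simp add: m_def)
  have b: "b < 0" using \<beta> by (simp add: b_def)
  have main: "norm (2 *\<^sub>R norm x powr (- \<beta>) - norm (x + z) powr (- \<beta>) - norm (x - z) powr (- \<beta>)) \<le> (2 * C) * (norm z)\<^sup>2"
    if z: "norm z \<le> norm x / 2" for z
  proof -
    define w where "w t = (norm (x + t *\<^sub>R z))\<^sup>2" for t
    define w' where "w' t = 2 * (x \<bullet> z) + 2 * t * (norm z)\<^sup>2" for t
    have w_eq: "w t = (norm x)\<^sup>2 + 2 * t * (x \<bullet> z) + t\<^sup>2 * (norm z)\<^sup>2" for t
      unfolding w_def power2_norm_eq_inner by (simp add: inner_commute algebra_simps power2_eq_square)
    have wm: "m \<le> w t" if "t \<in> {-1..1}" for t
    proof -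
      have "norm (t *\<^sub>R z) \<le> 1 * norm z" unfolding norm_scaleR using that by (intro mult_right_mono) auto
      then have "norm x / 2 \<le> norm (x + t *\<^sub>R z)"
        using z norm_triangle_ineq4[of "x + t *\<^sub>R z" "t *\<^sub>R z"] by simp
      then have "(norm x / 2)\<^sup>2 \<le> w t" unfolding w_def by (intro power_mono) auto
      then show ?thesis by (simp add: m_def power_divide)
    qed
    have dw: "(w has_real_derivative w' t) (at t)" for t
      unfolding w_eq[abs_def] w'_def by (auto intro!: derivative_eq_intros simp: algebra_simps)
    have dw': "(w' has_real_derivative 2 * (norm z)\<^sup>2) (at t)" for t
      unfolding w'_def by (auto intro!: derivative_eq_intros)
    define g where "g t = w t powr b" for t
    define g' where "g' t = b * w t powr (b - 1) * w' t" for t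
    define g'' where "g'' t = b * (b - 1) * w t powr (b - 2) * (w' t)\<^sup>2 + b * w t powr (b - 1) * (2 * (norm z)\<^sup>2)" for t
    have "norm (2 *\<^sub>R g 0 - g 1 - g (- 1)) \<le> 2 * (C * (norm z)\<^sup>2)"
    proof (rule second_difference_bound)
      fix t :: real assume t: "t \<in> {-1..1}"
      have w0: "0 < w t" using wm[OF t] m by simp
      have dp: "((\<lambda>t. w t powr c) has_real_derivative c * w t powr (c - 1) * w' t) (at t)" for c
        using DERIV_fun_powr[OF dw w0, of c] by simp
      show "(g has_vector_derivative g' t) (at t)"
        unfolding has_real_derivative_iff_has_vector_derivative[symmetric] g_def g'_def
        using dp[of b] by simp
      have "((\<lambda>t. b * w t powr (b - 1) * w' t) has_real_derivative
         b * ((b - 1) * w t powr (b - 1 - 1) * w' t) * w' t + b * w t powr (b - 1) * (2 * (norm z)\<^sup>2)) (at t)"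
        by (rule DERIV_cong[OF DERIV_mult[OF DERIV_cmult[OF dp[of "b - 1"], of b] dw']]) simp
      then show "(g' has_vector_derivative g'' t) (at t)"
        unfolding has_real_derivative_iff_has_vector_derivative[symmetric] g'_def[abs_def] g''_def
        by (rule DERIV_cong) (simp add: power2_eq_square)
      have 1: "w t powr (b - 2) \<le> m powr (b - 2)" "w t powr (b - 1) \<le> m powr (b - 1)"
        using m wm[OF t] b by (auto intro!: powr_mono2')
      have "\<bar>w' t\<bar> \<le> 4 * (norm x * norm z)"
      proof -
        have "\<bar>w' t\<bar> \<le> 2 * \<bar>x \<bullet> z\<bar> + 2 * \<bar>t\<bar> * (norm z)\<^sup>2"
          unfolding w'_def by (rule order_trans[OF abs_triangle_ineq]) (simp add: abs_mult)
        also have "\<dots> \<le> 2 * (norm x * norm z) + 2 * (norm x * norm z)"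
        proof (intro add_mono mult_left_mono Cauchy_Schwarz_ineq2)
          have "2 * \<bar>t\<bar> * (norm z)\<^sup>2 \<le> 2 * 1 * (norm z)\<^sup>2"
            using t by (intro mult_right_mono mult_left_mono) auto
          also have "\<dots> = 2 * (norm z * norm z)" by (simp add: power2_eq_square)
          also have "\<dots> \<le> 2 * (norm x * norm z)"
            using z norm_ge_zero[of x] by (intro mult_left_mono mult_right_mono) (linarith | simp)+
          finally show "2 * \<bar>t\<bar> * (norm z)\<^sup>2 \<le> 2 * (norm x * norm z)" .
        qed simp
        finally show ?thesis by simp
      qed
      then have "\<bar>w' t\<bar>\<^sup>2 \<le> (4 * (norm x * norm z))\<^sup>2" by (intro power_mono) auto
      then have 2: "(w' t)\<^sup>2 \<le> 16 * (norm x)\<^sup>2 * (norm z)\<^sup>2" by (simp add: power_mult_distrib)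
      have "norm (g'' t) \<le> \<bar>b * (b - 1)\<bar> * w t powr (b - 2) * (w' t)\<^sup>2 + \<bar>b\<bar> * w t powr (b - 1) * (2 * (norm z)\<^sup>2)"
        unfolding g''_def by (rule order_trans[OF norm_triangle_ineq]) (simp add: abs_mult)
      also have "\<dots> \<le> \<bar>b * (b - 1)\<bar> * m powr (b - 2) * (16 * (norm x)\<^sup>2 * (norm z)\<^sup>2) + \<bar>b\<bar> * m powr (b - 1) * (2 * (norm z)\<^sup>2)"
        using 1 2 by (intro add_mono mult_mono) auto
      also have "\<dots> = C * (norm z)\<^sup>2" by (simp add: C_def algebra_simps)
      finally show "norm (g'' t) \<le> C * (norm z)\<^sup>2" .
    qed
    moreover have "g 0 = norm x powr (- \<beta>)" "g 1 = norm (x + z) powr (- \<beta>)" "g (- 1) = norm (x - z) powr (- \<beta>)"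
      by (simp_all add: g_def w_def norm_sq_powr b_def)
    ultimately show ?thesis by simp
  qed
  then show thesis by (rule that)
qed

lemma has_bochner_integral_from_nn:
  fixes f :: "'b \<Rightarrow> real"
  assumes "f \<in> borel_measurable M" "\<And>y. y \<in> space M \<Longrightarrow> 0 \<le> f y" "(\<integral>\<^sup>+y. ennreal (f y) \<partial>M) = ennreal a" "0 \<le> a"
  shows "has_bochner_integral M f a"
  using assms by (intro has_bochner_integral_nn_integral) (auto intro: AE_I2)

lemma has_bochner_integral_pair_from_nn:
  fixes f :: "real \<Rightarrow> real \<Rightarrow> real"
  assumes [measurable]: "case_prod f \<in> borel_measurable (lborel \<Otimes>\<^sub>M lborel)"
    and "\<And>t r. 0 \<le> f t r" "(\<integral>\<^sup>+r. \<integral>\<^sup>+t. ennreal (f t r) \<partial>lborel \<partial>lborel) = ennreal a" "0 \<le> a"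
  shows "has_bochner_integral (lborel \<Otimes>\<^sub>M lborel) (case_prod f) a"
proof (rule has_bochner_integral_from_nn)
  have "(\<integral>\<^sup>+p. ennreal (case p of (t, r) \<Rightarrow> f t r) \<partial>(lborel \<Otimes>\<^sub>M lborel)) = (\<integral>\<^sup>+r. \<integral>\<^sup>+t. ennreal (f t r) \<partial>lborel \<partial>lborel)"
    by (subst lborel_pair.nn_integral_snd[symmetric]) auto
  then show "(\<integral>\<^sup>+p. ennreal (case p of (t, r) \<Rightarrow> f t r) \<partial>(lborel \<Otimes>\<^sub>M lborel)) = ennreal a"
    using assms by simp
qed (use assms in auto)

text \<open>Subordinating the power gives the convolution as an integral over \<open>r = \<tau>/t\<close>. Its value \<open>y\<close> is
left unevaluated, as the same expression occurs as a section of the double integral below and is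
evaluated there by integrating over \<open>t\<close> first. Finiteness follows from comparison with a Beta integral and needs \<open>\<beta> < N\<close>.\<close>

lemma gauss_convolution_norm_powr:
  fixes x :: "'a::euclidean_space" and \<beta> t :: real
  assumes \<beta>: "0 < \<beta>" "\<beta> < DIM('a)" and t: "0 < t"
  obtains y where "0 \<le> y"
    "has_bochner_integral lborel (\<lambda>r. indicator {0<..} r * (r powr (\<beta> / 2 - 1) * (1 + r) powr (- (DIM('a) / 2)) *
       exp (- (t * (r / (1 + r)) * (norm x)\<^sup>2)))) y"
    "has_bochner_integral lborel (\<lambda>z::'a. exp (- (t * (norm z)\<^sup>2)) * norm (x + z) powr (- \<beta>))
       (pi powr (DIM('a) / 2) * t powr ((\<beta> - DIM('a)) / 2) * y / Gamma (\<beta> / 2))"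
proof -
  define N where "N = real DIM('a)"
  define w where "w = (norm x)\<^sup>2"
  define f where "f r = indicator {0<..} r * (r powr (\<beta> / 2 - 1) * (1 + r) powr (- (N / 2)) * exp (- (t * (r / (1 + r)) * w)))" for r :: real
  have [measurable]: "f \<in> borel_measurable borel" unfolding f_def by measurable
  have f0: "0 \<le> f r" for r by (simp add: f_def)
  have G: "0 < Gamma (\<beta> / 2)" using \<beta> by (simp add: Gamma_real_pos)
  have "(\<integral>\<^sup>+r. ennreal (f r) \<partial>lborel) \<le> (\<integral>\<^sup>+r\<in>{0<..}. ennreal (r powr (\<beta> / 2 - 1) * (1 + r) powr (- (N / 2))) \<partial>lborel)"
  proof (intro nn_integral_mono)
    fix r :: real
    have "exp (- (t * (r / (1 + r)) * w)) \<le> 1" if "0 < r" using that t by (simp add: w_def)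
    then show "ennreal (f r) \<le> ennreal (r powr (\<beta> / 2 - 1) * (1 + r) powr (- (N / 2))) * indicator {0<..} r"
      by (auto simp: f_def indicator_def intro!: ennreal_leI mult_left_le)
  qed
  also have "\<dots> < \<infinity>" using \<beta> by (subst nn_integral_Beta) (auto simp: N_def)
  finally obtain y where y: "0 \<le> y" "(\<integral>\<^sup>+r. ennreal (f r) \<partial>lborel) = ennreal y"
    by (cases "\<integral>\<^sup>+r. ennreal (f r) \<partial>lborel") auto
  have b1: "has_bochner_integral lborel f y"
    by (rule has_bochner_integral_from_nn) (use y f0 in auto)
  define V where "V = (\<integral>\<^sup>+(z::'a). ennreal (exp (- (t * (norm z)\<^sup>2)) * norm (x + z) powr (- \<beta>)) \<partial>lborel)"
  have "V = (\<integral>\<^sup>+(z::'a). ennreal (exp (- (t * (norm (- x + z))\<^sup>2)) * norm z powr (- \<beta>)) \<partial>lborel)"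
    unfolding V_def
    using nn_integral_translate[of "\<lambda>z. ennreal (exp (- (t * (norm (- x + z))\<^sup>2)) * norm z powr (- \<beta>))" x] by simp
  then have "ennreal (Gamma (\<beta> / 2)) * V = (\<integral>\<^sup>+\<tau>\<in>{0<..}. ennreal (\<tau> powr (\<beta> / 2 - 1)) *
      (\<integral>\<^sup>+(z::'a). ennreal (exp (- (t * (norm (- x + z))\<^sup>2)) * exp (- (\<tau> * (norm z)\<^sup>2))) \<partial>lborel) \<partial>lborel)"
    using \<beta> by (simp add: nn_integral_norm_powr)
  also have "\<dots> = (\<integral>\<^sup>+\<tau>\<in>{0<..}. ennreal (\<tau> powr (\<beta> / 2 - 1) * ((pi / (t + \<tau>)) powr (N / 2) * exp (- (t * \<tau> / (t + \<tau>) * w)))) \<partial>lborel)"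
  proof (intro nn_integral_cong, goal_cases)
    case (1 \<tau>)
    show ?case
    proof (cases "0 < \<tau>")
      case True
      from nn_integral_gaussian_product[OF t True, of "- x"] show ?thesis
        by (simp add: N_def w_def ennreal_mult')
    qed simp
  qed
  also have "\<dots> = ennreal t * (\<integral>\<^sup>+r\<in>{0<..}. ennreal ((t * r) powr (\<beta> / 2 - 1) * ((pi / (t + t * r)) powr (N / 2) * exp (- (t * (t * r) / (t + t * r) * w)))) \<partial>lborel)"
    using t by (intro nn_integral_scale_pos) auto
  also have "\<dots> = (\<integral>\<^sup>+r. ennreal t * (ennreal ((t * r) powr (\<beta> / 2 - 1) * ((pi / (t + t * r)) powr (N / 2) * exp (- (t * (t * r) / (t + t * r) * w)))) * indicator {0<..} r) \<partial>lborel)"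
    by (rule nn_integral_cmult[symmetric]) measurable
  also have "\<dots> = (\<integral>\<^sup>+r. ennreal (pi powr (N / 2) * t powr ((\<beta> - N) / 2)) * ennreal (f r) \<partial>lborel)"
  proof (intro nn_integral_cong, goal_cases)
    case (1 r)
    show ?case
    proof (cases "0 < r")
      case True
      have tr: "t + t * r = t * (1 + r)" by (simp add: algebra_simps)
      have 1: "(pi / (t * (1 + r))) powr (N / 2) = pi powr (N / 2) * t powr (- (N / 2)) * (1 + r) powr (- (N / 2))"
        using True t by (simp add: powr_divide powr_mult powr_minus_divide)
      have 2: "t * (t * r) / (t * (1 + r)) * w = t * (r / (1 + r)) * w" using t True by simp
      have 3: "(t * r) powr (\<beta> / 2 - 1) = t powr (\<beta> / 2 - 1) * r powr (\<beta> / 2 - 1)"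
        using t True by (simp add: powr_mult)
      have "t powr ((\<beta> - N) / 2) = t powr 1 * t powr (\<beta> / 2 - 1) * t powr (- (N / 2))"
        unfolding powr_add[symmetric] by (rule arg_cong[where f="\<lambda>z. t powr z"]) (simp add: field_simps)
      then have 4: "t powr ((\<beta> - N) / 2) = t * t powr (\<beta> / 2 - 1) * t powr (- (N / 2))" using t by simp
      have "t * ((t * r) powr (\<beta> / 2 - 1) * ((pi / (t + t * r)) powr (N / 2) * exp (- (t * (t * r) / (t + t * r) * w)))) =
        pi powr (N / 2) * t powr ((\<beta> - N) / 2) * (r powr (\<beta> / 2 - 1) * (1 + r) powr (- (N / 2)) * exp (- (t * (r / (1 + r)) * w)))"
        unfolding tr 1 2 3 4 by (simp only: ac_simps)
      also have "\<dots> = pi powr (N / 2) * t powr ((\<beta> - N) / 2) * f r" using True by (simp add: f_def)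
      finally have "ennreal t * ennreal ((t * r) powr (\<beta> / 2 - 1) * ((pi / (t + t * r)) powr (N / 2) * exp (- (t * (t * r) / (t + t * r) * w))))
         = ennreal (pi powr (N / 2) * t powr ((\<beta> - N) / 2)) * ennreal (f r)"
        using t by (subst (1 2) ennreal_mult'[symmetric]) simp_all
      then show ?thesis using True by simp
    qed (simp add: f_def)
  qed
  also have "\<dots> = ennreal (pi powr (N / 2) * t powr ((\<beta> - N) / 2) * y)"
    by (subst nn_integral_cmult) (auto simp: y ennreal_mult')
  finally have "V = ennreal (pi powr (N / 2) * t powr ((\<beta> - N) / 2) * y / Gamma (\<beta> / 2))"
    using G by (rule ennreal_cancel_left)
  then have b2: "has_bochner_integral lborel (\<lambda>z::'a. exp (- (t * (norm z)\<^sup>2)) * norm (x + z) powr (- \<beta>))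
       (pi powr (N / 2) * t powr ((\<beta> - N) / 2) * y / Gamma (\<beta> / 2))"
    unfolding V_def using y G by (intro has_bochner_integral_from_nn) auto
  show thesis
    by (rule that[OF y(1)]) (use b1 b2 in \<open>simp_all add: f_def[abs_def] N_def w_def\<close>)
qed

text \<open>The integrand changes sign, so Tonelli's theorem does not apply to it directly. Inserting
\<open>(1 + r) powr (- N/2) * exp (- (t * r * w))\<close> between the two terms splits it as \<open>A - B\<close> with \<open>A\<close> and \<open>B\<close>
nonnegative. With \<open>k = s + \<beta>/2\<close>, integrating in \<open>t\<close> first gives \<open>\<Gamma>(k) w\<^sup>-\<^sup>k\<close> times
\<open>r\<^sup>-\<^sup>s\<^sup>-\<^sup>1 (1 - (1 + r)\<^sup>-\<^sup>N\<^sup>/\<^sup>2)\<close> for \<open>A\<close> and \<open>r\<^sup>-\<^sup>s\<^sup>-\<^sup>1 ((1 + r)\<^sup>-\<^sup>m - (1 + r)\<^sup>-\<^sup>N\<^sup>/\<^sup>2)\<close> for \<open>B\<close>, both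
integrable on \<open>r > 0\<close>. In the difference the terms with exponent \<open>N/2\<close> cancel.\<close>

lemma double_integral_subordination:
  fixes N \<beta> s w :: real
  defines "k \<equiv> s + \<beta> / 2" and "m \<equiv> N / 2 - (s + \<beta> / 2)"
  assumes s: "0 < s" "s < 1" and \<beta>: "0 < \<beta>" "\<beta> < N - 2 * s" and w: "0 < w"
  shows "has_bochner_integral (lborel \<Otimes>\<^sub>M lborel)
    (\<lambda>(t, r). indicator {0<..} t * indicator {0<..} r * t powr (k - 1) * r powr (\<beta> / 2 - 1) *
       (exp (- (t * r * w)) - (1 + r) powr (- (N / 2)) * exp (- (t * (r / (1 + r)) * w))))
    (Gamma k * w powr (- k) * (Gamma (1 - s) / s * (Gamma (m + s) / Gamma m)))"
proof -
  have k: "0 < k" using s \<beta> by (simp add: k_def)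
  have m: "0 < m" using \<beta> by (simp add: m_def)
  have Nk: "N / 2 - k = m" by (simp add: k_def m_def)
  have N: "0 < N / 2" using s \<beta> by simp
  define E where "E m = Gamma (1 - s) / s * (Gamma (m + s) / Gamma m)" for m
  have E0: "0 \<le> E m" if "0 < m" for m using s that by (simp add: E_def Gamma_real_pos less_imp_le)
  have Gk: "0 < Gamma k" using k by (simp add: Gamma_real_pos)
  define A where "A t r = indicator {0<..} t * indicator {0<..} r * t powr (k - 1) * r powr (\<beta> / 2 - 1) *
     (exp (- (t * r * w)) * (1 - (1 + r) powr (- (N / 2))))" for t r :: real
  define B where "B t r = indicator {0<..} t * indicator {0<..} r * t powr (k - 1) * r powr (\<beta> / 2 - 1) *
     ((1 + r) powr (- (N / 2)) * (exp (- (t * (r / (1 + r)) * w)) - exp (- (t * r * w))))" for t r :: real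
  have [measurable]: "case_prod A \<in> borel_measurable (lborel \<Otimes>\<^sub>M lborel)" "case_prod B \<in> borel_measurable (lborel \<Otimes>\<^sub>M lborel)"
    unfolding A_def B_def by measurable
  have le1: "(1 + r) powr (- c) \<le> 1" if "0 < r" "0 < c" for r c :: real
    using that by (simp add: powr_minus inverse_le_1_iff ge_one_powr_ge_zero)
  have A0: "0 \<le> A t r" for t r using le1[OF _ N, of r] by (auto simp: A_def indicator_def)
  have frac: "r / (1 + r) \<le> r" if "0 < r" for r :: real using that by (simp add: field_simps)
  have B0: "0 \<le> B t r" for t r
  proof (cases "0 < t \<and> 0 < r")
    case True
    then have "t * (r / (1 + r)) * w \<le> t * r * w" using frac[of r] w by (intro mult_left_mono mult_right_mono) auto
    then show ?thesis by (simp add: B_def)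
  qed (auto simp: B_def)
  have inner_exp: "(\<integral>\<^sup>+t. ennreal (indicator {0<..} t * t powr (k - 1) * exp (- (t * c * w))) \<partial>lborel) = ennreal (Gamma k * (c powr (- k) * w powr (- k)))"
    if "0 < c" for c
  proof -
    have "(\<integral>\<^sup>+t. ennreal (indicator {0<..} t * t powr (k - 1) * exp (- (t * c * w))) \<partial>lborel) =
       (\<integral>\<^sup>+t\<in>{0<..}. ennreal (t powr (k - 1) * exp (- ((c * w) * t))) \<partial>lborel)"
      by (intro nn_integral_cong) (auto simp: indicator_def ac_simps)
    then show ?thesis using that w k by (simp add: nn_integral_Gamma powr_mult)
  qed
  have kb: "r powr (\<beta> / 2 - 1) * r powr (- k) = r powr (- s - 1)" for r :: real
    unfolding powr_add[symmetric] by (rule arg_cong[where f="\<lambda>z. r powr z"]) (simp add: k_def)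
  have E_int: "(\<integral>\<^sup>+r. ennreal (indicator {0<..} r * r powr (- s - 1) * (1 - (1 + r) powr (- m))) \<partial>lborel) = ennreal (E m)"
    if "0 < m" for m
  proof -
    have "(\<integral>\<^sup>+r. ennreal (indicator {0<..} r * r powr (- s - 1) * (1 - (1 + r) powr (- m))) \<partial>lborel) =
       (\<integral>\<^sup>+r\<in>{0<..}. ennreal (r powr (- s - 1) * (1 - (1 + r) powr (- m))) \<partial>lborel)"
      by (intro nn_integral_cong) (auto simp: indicator_def)
    then show ?thesis using nn_integral_one_minus_powr[OF s that] by (simp add: E_def)
  qed
  define D where "D = Gamma k * w powr (- k)"
  have D0: "0 \<le> D" using Gk by (simp add: D_def)
  have bA: "has_bochner_integral (lborel \<Otimes>\<^sub>M lborel) (case_prod A) (D * E (N / 2))"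
  proof (rule has_bochner_integral_pair_from_nn)
    have "(\<integral>\<^sup>+r. \<integral>\<^sup>+t. ennreal (A t r) \<partial>lborel \<partial>lborel) =
       (\<integral>\<^sup>+r. ennreal D * ennreal (indicator {0<..} r * r powr (- s - 1) * (1 - (1 + r) powr (- (N / 2)))) \<partial>lborel)"
    proof (intro nn_integral_cong, goal_cases)
      case (1 r)
      show ?case
      proof (cases "0 < r")
        case True
        define q where "q = r powr (\<beta> / 2 - 1) * (1 - (1 + r) powr (- (N / 2)))"
        have q: "0 \<le> q" using le1[OF True N] by (simp add: q_def)
        have "(\<integral>\<^sup>+t. ennreal (A t r) \<partial>lborel) = (\<integral>\<^sup>+t. ennreal q * ennreal (indicator {0<..} t * t powr (k - 1) * exp (- (t * r * w))) \<partial>lborel)"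
          using True q by (intro nn_integral_cong) (simp add: A_def q_def ennreal_mult'[symmetric] ac_simps)
        also have "\<dots> = ennreal q * ennreal (Gamma k * (r powr (- k) * w powr (- k)))"
          using True by (subst nn_integral_cmult) (auto simp: inner_exp)
        also have "\<dots> = ennreal (q * (Gamma k * (r powr (- k) * w powr (- k))))" using q by (rule ennreal_mult'[symmetric])
        also have "q * (Gamma k * (r powr (- k) * w powr (- k))) = D * ((r powr (\<beta> / 2 - 1) * r powr (- k)) * (1 - (1 + r) powr (- (N / 2))))"
          unfolding q_def D_def by (simp only: ac_simps)
        finally show ?thesis using True D0 unfolding kb by (simp add: ennreal_mult'[symmetric])
      qed (simp add: A_def)
    qed
    also have "\<dots> = ennreal (D * E (N / 2))"
      using N by (subst nn_integral_cmult, measurable, subst E_int) (auto simp: ennreal_mult'[symmetric] D0)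
    finally show "(\<integral>\<^sup>+r. \<integral>\<^sup>+t. ennreal (A t r) \<partial>lborel \<partial>lborel) = ennreal (D * E (N / 2))" .
  qed (use A0 D0 E0[OF N] in auto)
  have E_diff: "(\<integral>\<^sup>+r. ennreal (indicator {0<..} r * r powr (- s - 1) * (1 - (1 + r) powr (- (N / 2))) -
      indicator {0<..} r * r powr (- s - 1) * (1 - (1 + r) powr (- m))) \<partial>lborel) = ennreal (E (N / 2) - E m)"
  proof (rule nn_integral_real_diff)
    fix r :: real
    show "0 \<le> indicator {0<..} r * r powr (- s - 1) * (1 - (1 + r) powr (- m))"
      using le1[OF _ m, of r] by (auto simp: indicator_def)
    show "indicator {0<..} r * r powr (- s - 1) * (1 - (1 + r) powr (- m)) \<le>
       indicator {0<..} r * r powr (- s - 1) * (1 - (1 + r) powr (- (N / 2)))"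
      using k Nk by (auto simp: indicator_def intro!: mult_left_mono powr_mono)
  qed (use E_int[OF N] E_int[OF m] E0[OF m] in auto)
  have "E m \<le> E (N / 2)"
  proof -
    have "ennreal (E m) \<le> ennreal (E (N / 2))"
      unfolding E_int[OF N, symmetric] E_int[OF m, symmetric] using k Nk
      by (intro nn_integral_mono ennreal_leI) (auto simp: indicator_def intro!: mult_left_mono powr_mono)
    then show ?thesis using E0[OF N] by (simp add: ennreal_le_iff)
  qed
  have bB: "has_bochner_integral (lborel \<Otimes>\<^sub>M lborel) (case_prod B) (D * (E (N / 2) - E m))"
  proof (rule has_bochner_integral_pair_from_nn)
    have "(\<integral>\<^sup>+r. \<integral>\<^sup>+t. ennreal (B t r) \<partial>lborel \<partial>lborel) =
       (\<integral>\<^sup>+r. ennreal D * ennreal (indicator {0<..} r * r powr (- s - 1) * (1 - (1 + r) powr (- (N / 2))) -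
          indicator {0<..} r * r powr (- s - 1) * (1 - (1 + r) powr (- m))) \<partial>lborel)"
    proof (intro nn_integral_cong, goal_cases)
      case (1 r)
      show ?case
      proof (cases "0 < r")
        case True
        define q where "q = r powr (\<beta> / 2 - 1) * (1 + r) powr (- (N / 2))"
        have q: "0 \<le> q" by (simp add: q_def)
        define c where "c = r / (1 + r)"
        have c: "0 < c" "c \<le> r" using True frac by (auto simp: c_def)
        have ck: "c powr (- k) = r powr (- k) * (1 + r) powr k"
          using True by (simp add: c_def powr_divide powr_minus_divide)
        have "(\<integral>\<^sup>+t. ennreal (B t r) \<partial>lborel) = (\<integral>\<^sup>+t. ennreal q * ennreal (indicator {0<..} t * t powr (k - 1) * exp (- (t * c * w)) -
             indicator {0<..} t * t powr (k - 1) * exp (- (t * r * w))) \<partial>lborel)"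
          using True q by (intro nn_integral_cong) (simp add: B_def q_def c_def ennreal_mult'[symmetric] algebra_simps)
        also have "\<dots> = ennreal q * ennreal (Gamma k * (c powr (- k) * w powr (- k)) - Gamma k * (r powr (- k) * w powr (- k)))"
        proof (subst nn_integral_cmult, measurable, subst nn_integral_real_diff)
          show "indicator {0<..} t * t powr (k - 1) * exp (- (t * r * w)) \<le> indicator {0<..} t * t powr (k - 1) * exp (- (t * c * w))" for t :: real
            using c w by (auto simp: indicator_def intro!: mult_left_mono mult_right_mono)
        qed (use True c Gk inner_exp in auto)
        also have "\<dots> = ennreal (q * (Gamma k * (c powr (- k) * w powr (- k)) - Gamma k * (r powr (- k) * w powr (- k))))"
          using q by (rule ennreal_mult'[symmetric])
        also have "q * (Gamma k * (c powr (- k) * w powr (- k)) - Gamma k * (r powr (- k) * w powr (- k))) =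
          D * ((r powr (\<beta> / 2 - 1) * r powr (- k)) * ((1 + r) powr (- (N / 2)) * (1 + r) powr k) - (r powr (\<beta> / 2 - 1) * r powr (- k)) * (1 + r) powr (- (N / 2)))"
          unfolding q_def D_def ck by (simp add: algebra_simps)
        also have "(1 + r) powr (- (N / 2)) * (1 + r) powr k = (1 + r) powr (- m)"
          unfolding powr_add[symmetric] by (simp add: Nk[symmetric])
        finally show ?thesis using True D0 unfolding kb by (simp add: ennreal_mult'[symmetric] algebra_simps)
      qed (simp add: B_def)
    qed
    also have "\<dots> = ennreal (D * (E (N / 2) - E m))"
      by (subst nn_integral_cmult, measurable, subst E_diff) (auto simp: ennreal_mult'[symmetric] D0)
    finally show "(\<integral>\<^sup>+r. \<integral>\<^sup>+t. ennreal (B t r) \<partial>lborel \<partial>lborel) = ennreal (D * (E (N / 2) - E m))" .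
  qed (use B0 D0 \<open>E m \<le> E (N / 2)\<close> in auto)
  have "has_bochner_integral (lborel \<Otimes>\<^sub>M lborel) (\<lambda>p. case_prod A p - case_prod B p) (D * E (N / 2) - D * (E (N / 2) - E m))"
    by (rule has_bochner_integral_diff[OF bA bB])
  also have "D * E (N / 2) - D * (E (N / 2) - E m) = Gamma k * w powr (- k) * (Gamma (1 - s) / s * (Gamma (m + s) / Gamma m))"
    by (simp add: D_def E_def algebra_simps)
  also have "(\<lambda>p. case_prod A p - case_prod B p) = (\<lambda>(t, r). indicator {0<..} t * indicator {0<..} r * t powr (k - 1) * r powr (\<beta> / 2 - 1) *
       (exp (- (t * r * w)) - (1 + r) powr (- (N / 2)) * exp (- (t * (r / (1 + r)) * w))))"
    by (auto simp: A_def B_def algebra_simps)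
  finally show ?thesis .
qed

text \<open>The kernel is subordinated with parameter \<open>t\<close>. The exchange of the integrals over \<open>z\<close> and \<open>t\<close> is
justified by the absolute convergence of the second difference integral. For fixed \<open>t\<close> the
\<open>z\<close>-integral consists of Gaussian convolutions of the power, and it equals, up to a constant, the
\<open>r\<close>-section of the double integral evaluated before.\<close>

lemma integral_second_difference_norm_powr:
  fixes x :: "'a::euclidean_space" and s \<beta> :: real
  assumes s: "0 < s" "s < 1" and x: "x \<noteq> 0" and \<beta>: "0 < \<beta>" "\<beta> < DIM('a) - 2 * s"
    and D_int: "integrable lborel (\<lambda>z::'a. (2 *\<^sub>R norm x powr (- \<beta>) - norm (x + z) powr (- \<beta>) - norm (x - z) powr (- \<beta>)) /\<^sub>R norm z powr (DIM('a) + 2 * s))"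
  shows "(LINT z|lborel. (2 *\<^sub>R norm x powr (- \<beta>) - norm (x + z) powr (- \<beta>) - norm (x - z) powr (- \<beta>)) /\<^sub>R norm z powr (DIM('a) + 2 * s))
    = 2 * (frac_kernel_const DIM('a) s * (Lambda_const DIM('a) s \<beta> * norm x powr (- \<beta> - 2 * s)))"
proof -
  define N where "N = real DIM('a)"
  define a where "a = N / 2 + s"
  define k where "k = s + \<beta> / 2"
  define m where "m = N / 2 - k"
  define w where "w = (norm x)\<^sup>2"
  define \<delta> where "\<delta> z = 2 *\<^sub>R norm x powr (- \<beta>) - norm (x + z) powr (- \<beta>) - norm (x - z) powr (- \<beta>)" for z
  define D where "D z = \<delta> z /\<^sub>R norm z powr (DIM('a) + 2 * s)" for z
  have [measurable]: "\<delta> \<in> borel_measurable borel" unfolding \<delta>_def by measurable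
  have a: "0 < a" using s by (simp add: a_def N_def)
  have w: "0 < w" using x by (simp add: w_def)
  have Ga: "0 < Gamma a" and Gb: "0 < Gamma (\<beta> / 2)" using a \<beta> by (simp_all add: Gamma_real_pos)
  have D_int': "integrable lborel D" using D_int by (simp add: D_def[abs_def] \<delta>_def)
  define F where "F z t = indicator {0<..} t * t powr (a - 1) * exp (- (t * (norm z)\<^sup>2)) * \<delta> z" for z :: 'a and t :: real
  have [measurable]: "case_prod F \<in> borel_measurable (lborel \<Otimes>\<^sub>M lborel)" unfolding F_def by measurable
  have sub: "has_bochner_integral lborel (\<lambda>t. indicator {0<..} t * t powr (a - 1) * exp (- (t * (norm z)\<^sup>2)))
      (Gamma a / norm z powr (DIM('a) + 2 * s))" if "z \<noteq> 0" for z :: 'a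
  proof (rule has_bochner_integral_from_nn)
    have "(\<integral>\<^sup>+t. ennreal (indicator {0<..} t * t powr (a - 1) * exp (- (t * (norm z)\<^sup>2))) \<partial>lborel) =
       (\<integral>\<^sup>+t\<in>{0<..}. ennreal (t powr (a - 1) * exp (- ((norm z)\<^sup>2 * t))) \<partial>lborel)"
      by (intro nn_integral_cong) (auto simp: indicator_def mult.commute)
    also have "\<dots> = ennreal (Gamma a * norm z powr (2 * - a))"
      using that a nn_integral_Gamma[of "(norm z)\<^sup>2" a] by (simp add: norm_sq_powr)
    also have "norm z powr (2 * - a) = 1 / norm z powr (DIM('a) + 2 * s)"
      unfolding powr_minus_divide[symmetric]
      by (rule arg_cong[where f="\<lambda>c. norm z powr c"]) (simp add: a_def N_def)
    finally show "(\<integral>\<^sup>+t. ennreal (indicator {0<..} t * t powr (a - 1) * exp (- (t * (norm z)\<^sup>2))) \<partial>lborel)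
       = ennreal (Gamma a / norm z powr (DIM('a) + 2 * s))" by simp
  qed (use Ga in auto)
  have nz: "AE z::'a in lborel. z \<noteq> 0" by (rule AE_lborel_singleton)
  have F_int: "integrable (lborel \<Otimes>\<^sub>M lborel) (case_prod F)"
  proof (rule lborel_pair.Fubini_integrable)
    have *: "(LINT t|lborel. norm (case (z, t) of (z, t) \<Rightarrow> F z t)) = Gamma a * norm (D z)" if "z \<noteq> 0" for z
    proof -
      have "(LINT t|lborel. norm (case (z, t) of (z, t) \<Rightarrow> F z t)) =
        (LINT t|lborel. (indicator {0<..} t * t powr (a - 1) * exp (- (t * (norm z)\<^sup>2))) * \<bar>\<delta> z\<bar>)"
        by (intro Bochner_Integration.integral_cong) (auto simp: F_def abs_mult)
      also have "\<dots> = Gamma a / norm z powr (DIM('a) + 2 * s) * \<bar>\<delta> z\<bar>"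
        by (rule has_bochner_integral_integral_eq[OF has_bochner_integral_mult_left[OF sub[OF that]]])
      finally show ?thesis by (simp add: D_def abs_mult divide_inverse)
    qed
    have "integrable lborel (\<lambda>z. Gamma a * norm (D z))" using D_int' by (intro integrable_mult_right integrable_norm)
    then show "integrable lborel (\<lambda>z. LINT t|lborel. norm (case (z, t) of (z, t) \<Rightarrow> F z t))"
      by (rule integrable_cong_AE_imp) (use nz in \<open>auto elim!: eventually_mono simp: *[simplified]\<close>)
    show "AE z in lborel. integrable lborel (\<lambda>t. case (z, t) of (z, t) \<Rightarrow> F z t)"
      using nz
    proof eventually_elim
      case (elim z)
      show ?case
        using has_bochner_integral_mult_left[OF sub[OF elim], of "\<delta> z"]
        by (simp add: F_def has_bochner_integral_iff)
    qed
  qed measurable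
  have inner_t: "(LINT t|lborel. F z t) = Gamma a * D z" if "z \<noteq> 0" for z
    using has_bochner_integral_integral_eq[OF has_bochner_integral_mult_left[OF sub[OF that], of "\<delta> z"]]
    by (simp add: F_def D_def divide_inverse)
  have "(LINT z|lborel. LINT t|lborel. F z t) = (LINT z|lborel. Gamma a * D z)"
    by (rule integral_cong_AE) (use nz in \<open>auto elim!: eventually_mono simp: inner_t D_def\<close>)
  then have swap: "Gamma a * (LINT z|lborel. D z) = (LINT t|lborel. LINT z|lborel. F z t)"
    using lborel_pair.Fubini_integral[OF F_int] by simp
  define h where "h t r = indicator {0<..} t * indicator {0<..} r * t powr (k - 1) * r powr (\<beta> / 2 - 1) *
     (exp (- (t * r * w)) - (1 + r) powr (- (N / 2)) * exp (- (t * (r / (1 + r)) * w)))" for t r :: real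
  have inner_z: "(LINT z|lborel. F z t) = 2 * pi powr (N / 2) / Gamma (\<beta> / 2) * (LINT r|lborel. h t r)" for t
  proof (cases "0 < t")
    case t: True
    obtain y where y: "0 \<le> y"
      "has_bochner_integral lborel (\<lambda>r. indicator {0<..} r * (r powr (\<beta> / 2 - 1) * (1 + r) powr (- (DIM('a) / 2)) *
         exp (- (t * (r / (1 + r)) * (norm x)\<^sup>2)))) y"
      "has_bochner_integral lborel (\<lambda>z::'a. exp (- (t * (norm z)\<^sup>2)) * norm (x + z) powr (- \<beta>))
         (pi powr (DIM('a) / 2) * t powr ((\<beta> - DIM('a)) / 2) * y / Gamma (\<beta> / 2))"
      using gauss_convolution_norm_powr[of \<beta> t x] s \<beta> t by auto
    define V where "V = pi powr (N / 2) * t powr ((\<beta> - N) / 2) * y / Gamma (\<beta> / 2)"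
    have V1: "has_bochner_integral lborel (\<lambda>z::'a. exp (- (t * (norm z)\<^sup>2)) * norm (x + z) powr (- \<beta>)) V"
      using y(3) by (simp add: V_def N_def)
    have V2: "has_bochner_integral lborel (\<lambda>z::'a. exp (- (t * (norm z)\<^sup>2)) * norm (x - z) powr (- \<beta>)) V"
      using integrable_isometry[of "\<lambda>z::'a. exp (- (t * (norm z)\<^sup>2)) * norm (x + z) powr (- \<beta>)" "- 1" 0]
        integral_isometry[of "\<lambda>z::'a. exp (- (t * (norm z)\<^sup>2)) * norm (x + z) powr (- \<beta>)" "- 1" 0] V1
      by (simp add: has_bochner_integral_iff)
    have V0: "has_bochner_integral lborel (\<lambda>z::'a. exp (- (t * (norm z)\<^sup>2))) ((pi / t) powr (N / 2))"
      using nn_integral_gaussian[OF t, where 'a='a] by (intro has_bochner_integral_from_nn) (auto simp: N_def)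
    have "has_bochner_integral lborel (\<lambda>z::'a. t powr (a - 1) * (exp (- (t * (norm z)\<^sup>2)) * (2 * norm x powr (- \<beta>)) -
        exp (- (t * (norm z)\<^sup>2)) * norm (x + z) powr (- \<beta>) - exp (- (t * (norm z)\<^sup>2)) * norm (x - z) powr (- \<beta>)))
       (t powr (a - 1) * ((pi / t) powr (N / 2) * (2 * norm x powr (- \<beta>)) - V - V))"
      by (intro has_bochner_integral_mult_right has_bochner_integral_diff has_bochner_integral_mult_left V0 V1 V2)
    also have "(\<lambda>z::'a. t powr (a - 1) * (exp (- (t * (norm z)\<^sup>2)) * (2 * norm x powr (- \<beta>)) -
        exp (- (t * (norm z)\<^sup>2)) * norm (x + z) powr (- \<beta>) - exp (- (t * (norm z)\<^sup>2)) * norm (x - z) powr (- \<beta>))) =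
        (\<lambda>z. F z t)"
      using t by (simp add: F_def \<delta>_def algebra_simps)
    finally have L: "(LINT z|lborel. F z t) = t powr (a - 1) * ((pi / t) powr (N / 2) * (2 * norm x powr (- \<beta>)) - V - V)"
      by (rule has_bochner_integral_integral_eq)
    have X: "has_bochner_integral lborel (\<lambda>r. indicator {0<..} r * (r powr (\<beta> / 2 - 1) * exp (- (t * r * w)))) (Gamma (\<beta> / 2) * (t * w) powr (- (\<beta> / 2)))"
    proof (rule has_bochner_integral_from_nn)
      have "(\<integral>\<^sup>+r. ennreal (indicator {0<..} r * (r powr (\<beta> / 2 - 1) * exp (- (t * r * w)))) \<partial>lborel) =
         (\<integral>\<^sup>+r\<in>{0<..}. ennreal (r powr (\<beta> / 2 - 1) * exp (- ((t * w) * r))) \<partial>lborel)"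
        by (intro nn_integral_cong) (auto simp: indicator_def ac_simps)
      also have "\<dots> = ennreal (Gamma (\<beta> / 2) * (t * w) powr (- (\<beta> / 2)))"
        using t w \<beta> by (intro nn_integral_Gamma) auto
      finally show "(\<integral>\<^sup>+r. ennreal (indicator {0<..} r * (r powr (\<beta> / 2 - 1) * exp (- (t * r * w)))) \<partial>lborel) =
         ennreal (Gamma (\<beta> / 2) * (t * w) powr (- (\<beta> / 2)))" .
    qed (use Gb in auto)
    have "has_bochner_integral lborel (\<lambda>r. t powr (k - 1) * (indicator {0<..} r * (r powr (\<beta> / 2 - 1) * exp (- (t * r * w))) -
        indicator {0<..} r * (r powr (\<beta> / 2 - 1) * (1 + r) powr (- (DIM('a) / 2)) * exp (- (t * (r / (1 + r)) * (norm x)\<^sup>2)))))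
       (t powr (k - 1) * (Gamma (\<beta> / 2) * (t * w) powr (- (\<beta> / 2)) - y))"
      by (intro has_bochner_integral_mult_right has_bochner_integral_diff X y(2))
    also have "(\<lambda>r. t powr (k - 1) * (indicator {0<..} r * (r powr (\<beta> / 2 - 1) * exp (- (t * r * w))) -
        indicator {0<..} r * (r powr (\<beta> / 2 - 1) * (1 + r) powr (- (DIM('a) / 2)) * exp (- (t * (r / (1 + r)) * (norm x)\<^sup>2))))) = h t"
      using t by (auto simp: h_def N_def w_def algebra_simps)
    finally have R: "(LINT r|lborel. h t r) = t powr (k - 1) * (Gamma (\<beta> / 2) * (t * w) powr (- (\<beta> / 2)) - y)"
      by (rule has_bochner_integral_integral_eq)
    have u: "(t * w) powr (- (\<beta> / 2)) = t powr (- (\<beta> / 2)) * norm x powr (- \<beta>)"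
      using t w by (simp add: powr_mult w_def norm_sq_powr)
    have e1: "(pi / t) powr (N / 2) = pi powr (N / 2) * t powr (- (N / 2))"
      using t by (simp add: powr_divide powr_minus_divide)
    have e2: "t powr (a - 1) * t powr (- (N / 2)) = t powr (k - 1) * t powr (- (\<beta> / 2))"
      unfolding powr_add[symmetric] by (simp add: a_def k_def)
    have e3: "t powr (a - 1) * t powr ((\<beta> - N) / 2) = t powr (k - 1)"
      unfolding powr_add[symmetric] by (rule arg_cong[where f="\<lambda>z. t powr z"]) (simp add: a_def k_def field_simps)
    have "(LINT z|lborel. F z t) = 2 * pi powr (N / 2) * ((t powr (a - 1) * t powr (- (N / 2))) * norm x powr (- \<beta>))
       - 2 * pi powr (N / 2) * ((t powr (a - 1) * t powr ((\<beta> - N) / 2)) * y / Gamma (\<beta> / 2))"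
      unfolding L e1 V_def by (simp add: algebra_simps)
    also have "\<dots> = 2 * pi powr (N / 2) / Gamma (\<beta> / 2) * (LINT r|lborel. h t r)"
      unfolding e2 e3 R u using Gb by (simp add: field_simps)
    finally show ?thesis .
  qed (simp add: F_def h_def)
  have b: "has_bochner_integral (lborel \<Otimes>\<^sub>M lborel) (\<lambda>(t, r). h t r)
     (Gamma k * w powr (- k) * (Gamma (1 - s) / s * (Gamma (m + s) / Gamma m)))"
    using double_integral_subordination[OF s \<beta>(1), of N w] \<beta> w
    by (simp add: h_def k_def m_def N_def)
  have "(LINT t|lborel. LINT r|lborel. h t r) = Gamma k * w powr (- k) * (Gamma (1 - s) / s * (Gamma (m + s) / Gamma m))"
    using lborel_pair.integral_fst'[of "\<lambda>(t, r). h t r"] b by (simp add: has_bochner_integral_iff)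
  then have "Gamma a * (LINT z|lborel. D z) = 2 * pi powr (N / 2) / Gamma (\<beta> / 2) *
      (Gamma k * w powr (- k) * (Gamma (1 - s) / s * (Gamma (m + s) / Gamma m)))"
    unfolding swap inner_z by simp
  then have "(LINT z|lborel. D z) = 2 * pi powr (N / 2) / Gamma (\<beta> / 2) *
      (Gamma k * w powr (- k) * (Gamma (1 - s) / s * (Gamma (m + s) / Gamma m))) / Gamma a"
    using Ga by (metis nonzero_mult_div_cancel_left less_irrefl)
  also have "\<dots> = 2 * (frac_kernel_const N s * (Lambda_const N s \<beta> * norm x powr (- \<beta> - 2 * s)))"
  proof -
    have 1: "w powr (- k) = norm x powr (- \<beta> - 2 * s)" unfolding w_def norm_sq_powr
      by (rule arg_cong[where f="\<lambda>c. norm x powr c"]) (simp add: k_def)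
    have 2: "2 powr (2 * s) = (4::real) powr s" using powr_powr[of 2 2 s] by simp
    have 3: "k = (\<beta> + 2 * s) / 2" "m + s = (N - \<beta>) / 2" "m = (N - \<beta> - 2 * s) / 2"
      by (simp_all add: k_def m_def field_simps)
    show ?thesis unfolding 1 frac_kernel_const_def Lambda_const_def 2 3(1)[symmetric] 3(2)[symmetric] 3(3)[symmetric] a_def[symmetric]
      by (simp add: ac_simps)
  qed
  finally show ?thesis by (simp add: D_def \<delta>_def N_def)
qed

section \<open>The normalising constant\<close>

lemma integrable_inverse_power:
  "integrable lborel (\<lambda>x::'a::euclidean_space. 1 / (1 + (norm x)\<^sup>2) ^ DIM('a))"
proof -
  define N where "N = real DIM('a)"
  have N: "0 < N" by (simp add: N_def)
  have GN: "0 < Gamma N" using N by (simp add: Gamma_real_pos)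
  have "ennreal (Gamma N) * (\<integral>\<^sup>+(x::'a). ennreal (1 * (1 + (norm x)\<^sup>2) powr (- N)) \<partial>lborel) =
    (\<integral>\<^sup>+t\<in>{0<..}. ennreal (t powr (N - 1)) * (\<integral>\<^sup>+(x::'a). ennreal (1 * exp (- ((1 + (norm x)\<^sup>2) * t))) \<partial>lborel) \<partial>lborel)"
    using N by (intro nn_integral_powr_subordination) (auto intro!: AE_I2 add_pos_nonneg)
  also have "\<dots> = (\<integral>\<^sup>+t. ennreal (pi powr (N / 2)) * (ennreal (t powr (N / 2 - 1) * exp (- (1 * t))) * indicator {0<..} t) \<partial>lborel)"
  proof (intro nn_integral_cong, goal_cases)
    case (1 t)
    show ?case
    proof (cases "0 < t")
      case True
      have "(\<integral>\<^sup>+(x::'a). ennreal (1 * exp (- ((1 + (norm x)\<^sup>2) * t))) \<partial>lborel) =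
        (\<integral>\<^sup>+(x::'a). ennreal (exp (- t)) * ennreal (exp (- (t * (norm x)\<^sup>2))) \<partial>lborel)"
        by (intro nn_integral_cong) (simp add: ennreal_mult'[symmetric] exp_add[symmetric] algebra_simps)
      also have "\<dots> = ennreal (exp (- t) * (pi / t) powr (N / 2))"
        using True by (subst nn_integral_cmult) (auto simp: nn_integral_gaussian N_def ennreal_mult')
      finally have 1: "(\<integral>\<^sup>+(x::'a). ennreal (1 * exp (- ((1 + (norm x)\<^sup>2) * t))) \<partial>lborel) = \<dots>" .
      have 2: "(pi / t) powr (N / 2) = pi powr (N / 2) * t powr (- (N / 2))"
        using True by (simp add: powr_divide powr_minus_divide)
      have 3: "t powr (N / 2 - 1) = t powr (N - 1) * t powr (- (N / 2))"
        unfolding powr_add[symmetric] by simp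
      show ?thesis using True unfolding 1 2 3 by (simp add: ennreal_mult'[symmetric] ac_simps)
    qed simp
  qed
  also have "\<dots> = ennreal (pi powr (N / 2)) * ennreal (Gamma (N / 2))"
    using N by (subst nn_integral_cmult, measurable, subst nn_integral_Gamma) auto
  finally have "ennreal (Gamma N) * (\<integral>\<^sup>+(x::'a). ennreal (1 * (1 + (norm x)\<^sup>2) powr (- N)) \<partial>lborel) =
     ennreal (pi powr (N / 2) * Gamma (N / 2))" by (simp add: ennreal_mult')
  from ennreal_cancel_left[OF this GN] have "integrable lborel (\<lambda>x::'a. (1 + (norm x)\<^sup>2) powr (- N))"
    by (intro integrableI_nonneg) auto
  also have "(\<lambda>x::'a. (1 + (norm x)\<^sup>2) powr (- N)) = (\<lambda>x. 1 / (1 + (norm x)\<^sup>2) ^ DIM('a))"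
    by (simp add: N_def powr_minus_divide powr_realpow add_pos_nonneg)
  finally show ?thesis .
qed

lemma schwartz_differentiable:
  assumes "schwartz f" "bs \<in> lists Basis"
  shows "iter_partial bs f differentiable (at x)"
  using assms unfolding schwartz_def differentiable_on_def by auto

lemma schwartz_decay:
  fixes f :: "'a::euclidean_space \<Rightarrow> complex"
  assumes "schwartz f" "bs \<in> lists Basis"
  obtains M where "0 \<le> M" "\<And>x. norm (iter_partial bs f x) \<le> M / (1 + (norm x)\<^sup>2) ^ m"
proof -
  have "\<exists>M. \<forall>x. norm x ^ k * norm (iter_partial bs f x) \<le> M" for k
    using assms unfolding schwartz_def by auto
  then obtain M where M: "norm x ^ k * norm (iter_partial bs f x) \<le> M k" for x k by metis
  define C where "C = 2 ^ m * (M 0 + M (2 * m))"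
  have le: "norm (iter_partial bs f x) * (1 + (norm x)\<^sup>2) ^ m \<le> C" for x
  proof -
    have "(1 + (norm x)\<^sup>2) ^ m \<le> (2 * max 1 ((norm x)\<^sup>2)) ^ m" by (intro power_mono) auto
    also have "\<dots> = 2 ^ m * max 1 ((norm x)\<^sup>2) ^ m" by (simp add: power_mult_distrib)
    also have "max 1 ((norm x)\<^sup>2) ^ m \<le> norm x ^ 0 + norm x ^ (2 * m)" by (auto simp: max_def power_mult)
    finally have "norm (iter_partial bs f x) * (1 + (norm x)\<^sup>2) ^ m \<le>
       norm (iter_partial bs f x) * (2 ^ m * (norm x ^ 0 + norm x ^ (2 * m)))"
      by (intro mult_left_mono) auto
    also have "\<dots> = 2 ^ m * (norm x ^ 0 * norm (iter_partial bs f x) + norm x ^ (2 * m) * norm (iter_partial bs f x))"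
      by (simp add: algebra_simps)
    also have "\<dots> \<le> C" unfolding C_def by (intro mult_left_mono add_mono M) auto
    finally show ?thesis .
  qed
  show thesis
  proof (rule that)
    show "0 \<le> C" using order_trans[OF norm_ge_zero, of "iter_partial bs f 0" C] le[of 0] by simp
    show "norm (iter_partial bs f x) \<le> C / (1 + (norm x)\<^sup>2) ^ m" for x
      using le[of x] by (simp add: pos_le_divide_eq add_pos_nonneg)
  qed
qed

lemma schwartz_measurable:
  assumes "schwartz f"
  shows "f \<in> borel_measurable borel"
proof -
  have "f differentiable (at x)" for x using schwartz_differentiable[OF assms, of "[]"] by simp
  then show ?thesis
    by (intro borel_measurable_continuous_onI continuous_at_imp_continuous_on)
       (auto intro: differentiable_imp_continuous_within)
qed

lemma schwartz_integrable:
  fixes f :: "'a::euclidean_space \<Rightarrow> complex"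
  assumes "schwartz f"
  shows "integrable lborel f"
proof -
  obtain M where M: "0 \<le> M" "\<And>x. norm (iter_partial [] f x) \<le> M / (1 + (norm x)\<^sup>2) ^ DIM('a)"
    using schwartz_decay[OF assms, of "[]" "DIM('a)"] by auto
  show ?thesis
  proof (rule Bochner_Integration.integrable_bound)
    show "integrable lborel (\<lambda>x::'a. M * (1 / (1 + (norm x)\<^sup>2) ^ DIM('a)))"
      using integrable_inverse_power by (rule integrable_mult_right)
    show "AE x in lborel. norm (f x) \<le> norm (M * (1 / (1 + (norm x)\<^sup>2) ^ DIM('a)))"
      using M by (auto intro!: AE_I2)
  qed (use schwartz_measurable[OF assms] in auto)
qed

lemma has_vector_derivative_along_line:
  fixes h :: "'a::euclidean_space \<Rightarrow> complex"
  assumes "h differentiable (at (x + t *\<^sub>R z))"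
  shows "((\<lambda>t. h (x + t *\<^sub>R z)) has_vector_derivative
    (\<Sum>b\<in>Basis. (z \<bullet> b) *\<^sub>R frechet_derivative h (at (x + t *\<^sub>R z)) b)) (at t)"
proof -
  let ?D = "frechet_derivative h (at (x + t *\<^sub>R z))"
  have D: "(h has_derivative ?D) (at (x + t *\<^sub>R z))" using assms by (simp add: frechet_derivative_works)
  then have lin: "linear ?D" by (rule has_derivative_linear)
  have "((\<lambda>t. x + t *\<^sub>R z) has_derivative (\<lambda>r. r *\<^sub>R z)) (at t)" by (auto intro!: derivative_eq_intros)
  from has_derivative_compose[OF this D] have "((\<lambda>t. h (x + t *\<^sub>R z)) has_derivative (\<lambda>r. ?D (r *\<^sub>R z))) (at t)" .
  moreover have "?D z = (\<Sum>b\<in>Basis. (z \<bullet> b) *\<^sub>R ?D b)"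
    using linear_sum[OF lin, of "\<lambda>b. (z \<bullet> b) *\<^sub>R b" Basis] by (simp add: euclidean_representation linear_scale[OF lin])
  ultimately show ?thesis
    by (simp add: has_vector_derivative_def linear_scale[OF lin])
qed

text \<open>Along the segment through \<open>x\<close> in direction \<open>z\<close> the second derivative is a combination of the iterated
partial derivatives with coefficients at most \<open>|z|\<^sup>2\<close>. Their decay in \<open>x + t z\<close> becomes decay in \<open>x\<close>
because \<open>|z| \<le> 1\<close>. The power \<open>N\<close> makes the bound integrable in \<open>x\<close>.\<close>

lemma schwartz_second_difference:
  fixes f :: "'a::euclidean_space \<Rightarrow> complex"
  assumes f: "schwartz f"
  obtains C where "0 \<le> C" "\<And>x z. norm z \<le> 1 \<Longrightarrow>
    norm (2 *\<^sub>R f x - f (x + z) - f (x - z)) \<le> C / (1 + (norm x)\<^sup>2) ^ DIM('a) * (norm z)\<^sup>2"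
proof -
  let ?N = "DIM('a)"
  have "\<exists>M. 0 \<le> M \<and> (\<forall>x. norm (iter_partial [c, b] f x) \<le> M / (1 + (norm x)\<^sup>2) ^ ?N)"
    if "b \<in> Basis" "c \<in> Basis" for b c
    using schwartz_decay[OF f, of "[c, b]" ?N] that by (metis lists.Cons lists.Nil)
  then obtain M where M: "\<And>b c. b \<in> Basis \<Longrightarrow> c \<in> Basis \<Longrightarrow> 0 \<le> M b c"
    "\<And>b c x. b \<in> Basis \<Longrightarrow> c \<in> Basis \<Longrightarrow> norm (iter_partial [c, b] f x) \<le> M b c / (1 + (norm x)\<^sup>2) ^ ?N"
    by metis
  define S where "S = (\<Sum>b\<in>Basis. \<Sum>c\<in>Basis. M b c)"
  have S0: "0 \<le> S" unfolding S_def by (intro sum_nonneg M)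
  have main: "norm (2 *\<^sub>R f x - f (x + z) - f (x - z)) \<le> (2 * 3 ^ ?N * S) / (1 + (norm x)\<^sup>2) ^ ?N * (norm z)\<^sup>2"
    if z: "norm z \<le> 1" for x z
  proof -
    define W where "W = 3 ^ ?N / (1 + (norm x)\<^sup>2) ^ ?N"
    have *: "1 / q \<le> c / p" if "p \<le> c * q" "0 < p" "0 < q" for p q c :: real
      using that by (simp add: field_simps)
    have W: "1 / (1 + (norm (x + t *\<^sub>R z))\<^sup>2) ^ ?N \<le> W" if "t \<in> {-1..1}" for t
    proof -
      have "norm (t *\<^sub>R z) \<le> 1 * 1" unfolding norm_scaleR using that z by (intro mult_mono) auto
      then have "norm x \<le> norm (x + t *\<^sub>R z) + 1"
        using norm_triangle_ineq4[of "x + t *\<^sub>R z" "t *\<^sub>R z"] by simp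
      then have "(norm x)\<^sup>2 \<le> (norm (x + t *\<^sub>R z) + 1)\<^sup>2" by (intro power_mono) auto
      also have "\<dots> \<le> 2 * (norm (x + t *\<^sub>R z))\<^sup>2 + 2"
        using sum_squares_bound[of "norm (x + t *\<^sub>R z)" 1] by (simp add: power2_sum)
      finally have "1 + (norm x)\<^sup>2 \<le> 3 * (1 + (norm (x + t *\<^sub>R z))\<^sup>2)"
        unfolding distrib_left using zero_le_power2[of "norm (x + t *\<^sub>R z)"] by linarith
      then have "(1 + (norm x)\<^sup>2) ^ ?N \<le> (3 * (1 + (norm (x + t *\<^sub>R z))\<^sup>2)) ^ ?N" by (intro power_mono) auto
      then show ?thesis unfolding W_def power_mult_distrib
        by (intro *) (auto intro!: zero_less_power add_pos_nonneg)
    qed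
    define g where "g t = f (x + t *\<^sub>R z)" for t
    define g' where "g' t = (\<Sum>b\<in>Basis. (z \<bullet> b) *\<^sub>R iter_partial [b] f (x + t *\<^sub>R z))" for t
    define g'' where "g'' t = (\<Sum>b\<in>Basis. (z \<bullet> b) *\<^sub>R (\<Sum>c\<in>Basis. (z \<bullet> c) *\<^sub>R iter_partial [c, b] f (x + t *\<^sub>R z)))" for t
    have "norm (2 *\<^sub>R g 0 - g 1 - g (- 1)) \<le> 2 * (S * W * (norm z)\<^sup>2)"
    proof (rule second_difference_bound)
      fix t :: real assume t: "t \<in> {-1..1}"
      show "(g has_vector_derivative g' t) (at t)"
        unfolding g_def g'_def
        using has_vector_derivative_along_line[of f x t z] schwartz_differentiable[OF f, of "[]"] by simp
      show "(g' has_vector_derivative g'' t) (at t)"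
        unfolding g'_def g''_def
      proof (intro has_vector_derivative_sum)
        fix b :: 'a assume b: "b \<in> Basis"
        have "((\<lambda>t. iter_partial [b] f (x + t *\<^sub>R z)) has_vector_derivative
          (\<Sum>c\<in>Basis. (z \<bullet> c) *\<^sub>R iter_partial [c, b] f (x + t *\<^sub>R z))) (at t)"
          using has_vector_derivative_along_line[of "iter_partial [b] f" x t z] schwartz_differentiable[OF f, of "[b]"] b by simp
        then show "((\<lambda>t. (z \<bullet> b) *\<^sub>R iter_partial [b] f (x + t *\<^sub>R z)) has_vector_derivative
          (z \<bullet> b) *\<^sub>R (\<Sum>c\<in>Basis. (z \<bullet> c) *\<^sub>R iter_partial [c, b] f (x + t *\<^sub>R z))) (at t)"
          using bounded_linear.has_vector_derivative[OF bounded_linear_scaleR_right] by blast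
      qed
      have "norm (g'' t) \<le> (\<Sum>b\<in>Basis. norm z * (\<Sum>c\<in>Basis. norm z * (M b c * W)))"
        unfolding g''_def
      proof (intro sum_norm_le)
        fix b :: 'a assume b: "b \<in> Basis"
        have "norm (\<Sum>c\<in>Basis. (z \<bullet> c) *\<^sub>R iter_partial [c, b] f (x + t *\<^sub>R z)) \<le> (\<Sum>c\<in>Basis. norm z * (M b c * W))"
        proof (intro sum_norm_le)
          fix c :: 'a assume c: "c \<in> Basis"
          have "norm (iter_partial [c, b] f (x + t *\<^sub>R z)) \<le> M b c * (1 / (1 + (norm (x + t *\<^sub>R z))\<^sup>2) ^ ?N)"
            using M(2)[OF b c] by simp
          also have "\<dots> \<le> M b c * W" using M(1)[OF b c] W[OF t] by (rule mult_left_mono[rotated])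
          finally show "norm ((z \<bullet> c) *\<^sub>R iter_partial [c, b] f (x + t *\<^sub>R z)) \<le> norm z * (M b c * W)"
            unfolding norm_scaleR using c by (intro mult_mono) (auto simp: Basis_le_norm)
        qed
        then show "norm ((z \<bullet> b) *\<^sub>R (\<Sum>c\<in>Basis. (z \<bullet> c) *\<^sub>R iter_partial [c, b] f (x + t *\<^sub>R z))) \<le>
            norm z * (\<Sum>c\<in>Basis. norm z * (M b c * W))"
          unfolding norm_scaleR using b by (intro mult_mono) (auto simp: Basis_le_norm)
      qed
      also have "\<dots> = S * W * (norm z)\<^sup>2"
        by (simp add: S_def sum_distrib_left sum_distrib_right power2_eq_square ac_simps)
      finally show "norm (g'' t) \<le> S * W * (norm z)\<^sup>2" .
    qed
    then show ?thesis by (simp add: g_def W_def ac_simps)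
  qed
  show thesis
    by (rule that[of "2 * 3 ^ ?N * S"]) (use S0 main in auto)
qed

lemma has_bochner_integral_cos_kernel:
  fixes \<xi> :: "'a::euclidean_space" and s :: real
  assumes s: "0 < s" "s < 1"
  shows "has_bochner_integral lborel (\<lambda>z::'a. (1 - cos (z \<bullet> \<xi>)) * norm z powr (- (DIM('a) + 2 * s)))
    (frac_kernel_const DIM('a) s * norm \<xi> powr (2 * s))"
  using nn_integral_cos_kernel[OF s, of \<xi>] frac_kernel_const_pos[OF s, of "DIM('a)"]
  by (intro has_bochner_integral_from_nn) auto

lemma schwartz_tail:
  fixes f :: "'a::euclidean_space \<Rightarrow> complex" and s \<epsilon> :: real
  assumes f: "schwartz f" and s: "0 < s" "s < 1" and \<epsilon>: "0 < \<epsilon>"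
  shows "set_integrable lborel {y. \<epsilon> < dist x y} (\<lambda>y. (f x - f y) /\<^sub>R norm (x - y) powr (DIM('a) + 2 * s))"
proof -
  have [measurable]: "f \<in> borel_measurable borel" by (rule schwartz_measurable[OF f])
  obtain M where M: "0 \<le> M" "\<And>x. norm (f x) \<le> M"
    using schwartz_decay[OF f, of "[]" 0] by auto
  show ?thesis
    unfolding set_integrable_def
  proof (rule Bochner_Integration.integrable_bound)
    have "integrable lborel (\<lambda>z::'a. indicator {z. \<epsilon> < norm z} z *\<^sub>R norm z powr (- (DIM('a) + 2 * s)))"
      using integrable_kernel_tail[OF s \<epsilon>] unfolding set_integrable_def .
    then have "integrable lborel (\<lambda>y::'a. indicator {z. \<epsilon> < norm z} (x + (- 1) *\<^sub>R y) *\<^sub>R norm (x + (- 1) *\<^sub>R y) powr (- (DIM('a) + 2 * s)))"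
      by (subst integrable_isometry) auto
    then show "integrable lborel (\<lambda>y::'a. (2 * M) * (indicator {z. \<epsilon> < norm z} (x + (- 1) *\<^sub>R y) *\<^sub>R norm (x + (- 1) *\<^sub>R y) powr (- (DIM('a) + 2 * s))))"
      by (rule integrable_mult_right)
    have "norm (f x - f y) \<le> 2 * M" for y
      using norm_triangle_ineq4[of "f x" "f y"] M(2)[of x] M(2)[of y] by simp
    then show "AE y in lborel. norm (indicator {y. \<epsilon> < dist x y} y *\<^sub>R ((f x - f y) /\<^sub>R norm (x - y) powr (DIM('a) + 2 * s)))
      \<le> norm ((2 * M) * (indicator {z. \<epsilon> < norm z} (x + (- 1) *\<^sub>R y) *\<^sub>R norm (x + (- 1) *\<^sub>R y) powr (- (DIM('a) + 2 * s))))"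
      using M(1)
      by (intro AE_I2) (auto simp: indicator_def dist_norm powr_minus mult_right_mono mult.commute abs_mult simp del: minus_add_distrib)
  qed auto
qed

text \<open>For the \<open>L\<^sup>1\<close> norm of the second difference in \<open>x\<close> there are two bounds: \<open>O(|z|\<^sup>2)\<close> for \<open>|z| \<le> 1\<close>, and four times
the norm of \<open>f\<close> for all \<open>z\<close>. Together they are integrable against the kernel, which is what the exchange of
integrals in the Fourier transform requires.\<close>
lemma
  fixes f :: "'a::euclidean_space \<Rightarrow> complex" and s :: real
  assumes f: "schwartz f" and s: "0 < s" "s < 1"
  shows integrable_schwartz_second_difference: "integrable (lborel \<Otimes>\<^sub>M lborel)
      (\<lambda>(z, x). (2 *\<^sub>R f x - f (x + z) - f (x - z)) /\<^sub>R norm z powr (DIM('a) + 2 * s))" (is "integrable _ (\<lambda>(z, x). ?G z x)")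
    and has_pv_integral_schwartz: "has_pv_integral (\<lambda>y. (f x - f y) /\<^sub>R norm (x - y) powr (DIM('a) + 2 * s)) x
      ((1 / 2) *\<^sub>R (LINT z|lborel. (2 *\<^sub>R f x - f (x + z) - f (x - z)) /\<^sub>R norm z powr (DIM('a) + 2 * s)))"
proof -
  have fm [measurable]: "f \<in> borel_measurable borel" by (rule schwartz_measurable[OF f])
  have fi: "integrable lborel f" by (rule schwartz_integrable[OF f])
  obtain C where C: "0 \<le> C" "\<And>x z. norm z \<le> 1 \<Longrightarrow>
    norm (2 *\<^sub>R f x - f (x + z) - f (x - z)) \<le> C / (1 + (norm x)\<^sup>2) ^ DIM('a) * (norm z)\<^sup>2"
    using schwartz_second_difference[OF f] by blast
  show "has_pv_integral (\<lambda>y. (f x - f y) /\<^sub>R norm (x - y) powr (DIM('a) + 2 * s)) x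
      ((1 / 2) *\<^sub>R (LINT z|lborel. (2 *\<^sub>R f x - f (x + z) - f (x - z)) /\<^sub>R norm z powr (DIM('a) + 2 * s)))"
    by (rule has_pv_integral_second_difference[OF s fm schwartz_tail[OF f s] zero_less_one C(2)])
  define w where "w x = 1 / (1 + (norm x)\<^sup>2) ^ DIM('a)" for x :: 'a
  have w: "integrable lborel w" unfolding w_def[abs_def] by (rule integrable_inverse_power)
  have w0: "0 \<le> w x" for x by (simp add: w_def add_nonneg_nonneg)
  define I where "I = (LINT x|lborel. w x)"
  define J where "J = (LINT x|lborel. norm (f x))"
  have shift: "integrable lborel (\<lambda>x. f (x + z))" "integrable lborel (\<lambda>x. f (x - z))"
    "(LINT x|lborel. norm (f (x + z))) = J" "(LINT x|lborel. norm (f (x - z))) = J" for z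
    using integrable_isometry[OF fm, of 1 z] integrable_isometry[OF fm, of 1 "- z"] fi
      integral_isometry[of "\<lambda>x. norm (f x)" 1 z] integral_isometry[of "\<lambda>x. norm (f x)" 1 "- z"]
    by (simp_all add: J_def add.commute)
  define d where "d z x = 2 *\<^sub>R f x - f (x + z) - f (x - z)" for z x
  have d_int: "integrable lborel (d z)" for z unfolding d_def using shift fi by auto
  have d_near: "(LINT x|lborel. norm (d z x)) \<le> (2 * C * I) * (1 - exp (- (norm z)\<^sup>2))" if z: "norm z \<le> 1" for z
  proof -
    have "norm (d z x) \<le> (2 * C * (1 - exp (- (norm z)\<^sup>2))) * w x" for x
    proof -
      have "(norm z)\<^sup>2 \<le> (1 + 1) * (1 - exp (- (norm z)\<^sup>2))"
        using z by (intro le_one_minus_exp) (auto simp: power_le_one)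
      then have "C * w x * (norm z)\<^sup>2 \<le> C * w x * ((1 + 1) * (1 - exp (- (norm z)\<^sup>2)))"
        using C(1) w0 by (intro mult_left_mono) auto
      moreover have "norm (d z x) \<le> C * w x * (norm z)\<^sup>2" using C(2)[OF z, of x] by (simp add: d_def w_def)
      ultimately show ?thesis by (simp add: ac_simps)
    qed
    then have "(LINT x|lborel. norm (d z x)) \<le> (LINT x|lborel. (2 * C * (1 - exp (- (norm z)\<^sup>2))) * w x)"
      using d_int w by (intro integral_mono integrable_norm integrable_mult_right) auto
    then show ?thesis by (simp add: I_def ac_simps)
  qed
  have d_far: "(LINT x|lborel. norm (d z x)) \<le> 4 * J" for z
  proof -
    have "norm (d z x) \<le> 2 * norm (f x) + norm (f (x + z)) + norm (f (x - z))" for x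
      unfolding d_def using norm_triangle_ineq4[of "2 *\<^sub>R f x - f (x + z)" "f (x - z)"] norm_triangle_ineq4[of "2 *\<^sub>R f x" "f (x + z)"] by simp
    then have "(LINT x|lborel. norm (d z x)) \<le> (LINT x|lborel. 2 * norm (f x) + norm (f (x + z)) + norm (f (x - z)))"
      using d_int shift fi by (intro integral_mono) auto
    also have "\<dots> = 4 * J"
      using shift fi by (simp add: J_def)
    finally show ?thesis .
  qed
  have I0: "0 \<le> I" unfolding I_def using w0 by (intro Bochner_Integration.integral_nonneg) auto
  have J0: "0 \<le> J" unfolding J_def by (intro Bochner_Integration.integral_nonneg) auto
  show "integrable (lborel \<Otimes>\<^sub>M lborel) (\<lambda>(z, x). ?G z x)"
  proof (rule lborel_pair.Fubini_integrable)
    show "AE z in lborel. integrable lborel (\<lambda>x. case (z, x) of (z, x) \<Rightarrow> ?G z x)"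
      using d_int unfolding d_def[abs_def] by (auto intro!: AE_I2 integrable_scaleR_right)
    show "integrable lborel (\<lambda>z. LINT x|lborel. norm (case (z, x) of (z, x) \<Rightarrow> ?G z x))"
    proof (rule Bochner_Integration.integrable_bound)
      show "integrable lborel (\<lambda>z::'a. (2 * C * I) * ((1 - exp (- (norm z)\<^sup>2)) * norm z powr (- (DIM('a) + 2 * s))) +
         (4 * J) * (indicator {z. 1 < norm z} z *\<^sub>R norm z powr (- (DIM('a) + 2 * s))))"
        using integrable_gauss_kernel[OF s] integrable_kernel_tail[OF s zero_less_one]
        unfolding set_integrable_def
        by (intro Bochner_Integration.integrable_add integrable_mult_right)
      show "AE z in lborel. norm (LINT x|lborel. norm (case (z, x) of (z, x) \<Rightarrow> ?G z x)) \<le>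
        norm ((2 * C * I) * ((1 - exp (- (norm z)\<^sup>2)) * norm z powr (- (DIM('a) + 2 * s))) +
         (4 * J) * (indicator {z. 1 < norm z} z *\<^sub>R norm z powr (- (DIM('a) + 2 * s))))"
      proof (rule AE_I2)
        fix z :: 'a
        have eq: "(LINT x|lborel. norm (case (z, x) of (z, x) \<Rightarrow> ?G z x)) =
           (LINT x|lborel. norm (d z x)) * norm z powr (- (DIM('a) + 2 * s))"
          unfolding d_def by (simp add: powr_minus mult.commute del: minus_add_distrib)
        have nn: "0 \<le> (LINT x|lborel. norm (d z x))" by (intro Bochner_Integration.integral_nonneg) auto
        have e: "0 \<le> 1 - exp (- (norm z)\<^sup>2)" by simp
        have "(LINT x|lborel. norm (d z x)) \<le> (2 * C * I) * (1 - exp (- (norm z)\<^sup>2)) + (4 * J) * indicator {z. 1 < norm z} z"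
        proof (cases "norm z \<le> 1")
          case True
          then show ?thesis using d_near by simp
        next
          case False
          have "0 \<le> (2 * C * I) * (1 - exp (- (norm z)\<^sup>2))" using C(1) I0 e by simp
          then show ?thesis using d_far[of z] False by simp
        qed
        from mult_right_mono[OF this powr_ge_zero[of "norm z" "- (DIM('a) + 2 * s)"]]
        have "(LINT x|lborel. norm (d z x)) * norm z powr (- (DIM('a) + 2 * s)) \<le>
          (2 * C * I) * ((1 - exp (- (norm z)\<^sup>2)) * norm z powr (- (DIM('a) + 2 * s))) +
         (4 * J) * (indicator {z. 1 < norm z} z *\<^sub>R norm z powr (- (DIM('a) + 2 * s)))"
          by (simp only: distrib_right mult.assoc real_scaleR_def)
        then show "norm (LINT x|lborel. norm (case (z, x) of (z, x) \<Rightarrow> ?G z x)) \<le>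
          norm ((2 * C * I) * ((1 - exp (- (norm z)\<^sup>2)) * norm z powr (- (DIM('a) + 2 * s))) +
           (4 * J) * (indicator {z. 1 < norm z} z *\<^sub>R norm z powr (- (DIM('a) + 2 * s))))"
          unfolding eq using nn by simp
      qed
    qed measurable
  qed measurable
qed

lemma fourier_second_difference:
  fixes f :: "'a::euclidean_space \<Rightarrow> complex"
  assumes fi: "integrable lborel f"
  shows "(LINT x|lborel. exp (- (\<i> * of_real (x \<bullet> \<xi>))) * (2 *\<^sub>R f x - f (x + z) - f (x - z))) =
    of_real (2 * (1 - cos (z \<bullet> \<xi>))) * fourier f \<xi>"
proof -
  have [measurable]: "f \<in> borel_measurable borel" using fi by auto
  define e where "e x = exp (- (\<i> * of_real (x \<bullet> \<xi>)))" for x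
  have e1: "norm (e x) = 1" for x by (simp add: e_def)
  have [measurable]: "e \<in> borel_measurable borel" unfolding e_def by measurable
  have int: "integrable lborel (\<lambda>x. e x * f x)"
    by (rule Bochner_Integration.integrable_bound[OF fi]) (auto simp: norm_mult e1)
  have sh: "integrable lborel (\<lambda>x. e x * f (x + z)) \<and> (LINT x|lborel. e x * f (x + z)) = e (- z) * fourier f \<xi>" for z
  proof -
    have eq: "e x * f (x + z) = e (- z) * (e (z + 1 *\<^sub>R x) * f (z + 1 *\<^sub>R x))" for x
      by (simp add: e_def inner_add_left exp_add[symmetric] mult.assoc[symmetric] algebra_simps)
    show ?thesis
      unfolding eq using int integrable_isometry[of "\<lambda>x. e x * f x" 1 z] integral_isometry[of "\<lambda>x. e x * f x" 1 z]
      by (simp add: fourier_def e_def)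
  qed
  have "(LINT x|lborel. e x * (2 *\<^sub>R f x - f (x + z) - f (x - z))) =
     (LINT x|lborel. 2 *\<^sub>R (e x * f x) - e x * f (x + z) - e x * f (x + (- z)))"
    by (simp add: algebra_simps)
  also have "\<dots> = 2 *\<^sub>R fourier f \<xi> - e (- z) * fourier f \<xi> - e z * fourier f \<xi>"
    using int sh[of z] sh[of "- z"] by (simp add: fourier_def e_def)
  also have "\<dots> = (2 - (e (- z) + e z)) * fourier f \<xi>" by (simp add: algebra_simps scaleR_conv_of_real)
  also have "e (- z) + e z = of_real (2 * cos (z \<bullet> \<xi>))"
    by (simp add: e_def exp_Euler exp_minus_Euler flip: cos_of_real)
  finally show ?thesis by (simp add: e_def algebra_simps)
qed

text \<open>Translating by \<open>z\<close> multiplies the transform by a phase, so the second difference in direction \<open>z\<close> has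
multiplier \<open>2 (1 - cos (z \<bullet> \<xi>))\<close>. Integrating this against the kernel gives \<open>2 K |\<xi>|\<^sup>2\<^sup>s\<close>.\<close>

lemma fourier_multiplier:
  fixes f :: "'a::euclidean_space \<Rightarrow> complex" and s :: real
  defines "g \<equiv> \<lambda>x. (1 / frac_kernel_const DIM('a) s) *\<^sub>R ((1 / 2) *\<^sub>R
      (LINT z|lborel. (2 *\<^sub>R f x - f (x + z) - f (x - z)) /\<^sub>R norm z powr (DIM('a) + 2 * s)))"
  assumes f: "schwartz f" and s: "0 < s" "s < 1"
  shows "has_frac_laplacian_with (1 / frac_kernel_const DIM('a) s) s f x (g x)"
    and "integrable lborel g"
    and "fourier g \<xi> = of_real (norm \<xi> powr (2 * s)) * fourier f \<xi>"
proof -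
  let ?K = "frac_kernel_const DIM('a) s"
  have K: "0 < ?K" using frac_kernel_const_pos[OF s] by simp
  have fm [measurable]: "f \<in> borel_measurable borel" by (rule schwartz_measurable[OF f])
  show "has_frac_laplacian_with (1 / ?K) s f x (g x)"
    unfolding has_frac_laplacian_with_def g_def using has_pv_integral_schwartz[OF f s] by blast
  define G where "G z x = (2 *\<^sub>R f x - f (x + z) - f (x - z)) /\<^sub>R norm z powr (DIM('a) + 2 * s)" for z x
  have G: "integrable (lborel \<Otimes>\<^sub>M lborel) (case_prod G)"
    using integrable_schwartz_second_difference[OF f s] by (simp add: G_def[abs_def])
  have g_eq: "g x = (1 / ?K) *\<^sub>R ((1 / 2) *\<^sub>R (LINT z|lborel. G z x))" for x by (simp add: g_def G_def)
  show "integrable lborel g"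
    unfolding g_eq[abs_def] using lborel_pair.integrable_snd[OF G] by (intro integrable_scaleR_right)
  define e where "e x = exp (- (\<i> * of_real (x \<bullet> \<xi>)))" for x
  have [measurable]: "e \<in> borel_measurable borel" unfolding e_def by measurable
  have [measurable]: "case_prod G \<in> borel_measurable (lborel \<Otimes>\<^sub>M lborel)" unfolding G_def by measurable
  have eG: "integrable (lborel \<Otimes>\<^sub>M lborel) (case_prod (\<lambda>z x. e x * G z x))"
    by (rule Bochner_Integration.integrable_bound[OF G]) (auto simp: norm_mult e_def split: prod.split)
  have inner: "(LINT x|lborel. e x * G z x) = of_real (2 * ((1 - cos (z \<bullet> \<xi>)) * norm z powr (- (DIM('a) + 2 * s)))) * fourier f \<xi>" for z
  proof -
    have "(LINT x|lborel. e x * G z x) = (LINT x|lborel. (1 / norm z powr (DIM('a) + 2 * s)) *\<^sub>R (e x * (2 *\<^sub>R f x - f (x + z) - f (x - z))))"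
      by (simp add: G_def divide_inverse)
    also have "\<dots> = (1 / norm z powr (DIM('a) + 2 * s)) *\<^sub>R (of_real (2 * (1 - cos (z \<bullet> \<xi>))) * fourier f \<xi>)"
      using fourier_second_difference[OF schwartz_integrable[OF f], of \<xi> z] by (simp add: e_def)
    finally show ?thesis by (simp add: scaleR_conv_of_real powr_minus_divide field_simps del: minus_add_distrib)
  qed
  have "fourier g \<xi> = (LINT x|lborel. (1 / ?K) *\<^sub>R ((1 / 2) *\<^sub>R (LINT z|lborel. e x * G z x)))"
    unfolding fourier_def g_eq by (simp add: e_def)
  also have "\<dots> = (1 / ?K) *\<^sub>R ((1 / 2) *\<^sub>R (LINT x|lborel. LINT z|lborel. e x * G z x))"
    by simp
  also have "(LINT x|lborel. LINT z|lborel. e x * G z x) = (LINT z|lborel. LINT x|lborel. e x * G z x)"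
    by (rule lborel_pair.Fubini_integral[OF eG])
  also have "\<dots> = (LINT z|lborel. of_real (2 * ((1 - cos (z \<bullet> \<xi>)) * norm z powr (- (DIM('a) + 2 * s)))) * fourier f \<xi>)"
    unfolding inner ..
  also have "\<dots> = of_real (2 * (?K * norm \<xi> powr (2 * s))) * fourier f \<xi>"
  proof -
    note b = has_bochner_integral_mult_right[OF has_bochner_integral_cos_kernel[OF s, of \<xi>], of 2]
    show ?thesis
      by (subst integral_mult_left_zero, subst integral_complex_of_real) (simp only: has_bochner_integral_integral_eq[OF b])
  qed
  finally show "fourier g \<xi> = of_real (norm \<xi> powr (2 * s)) * fourier f \<xi>"
    using K by (simp add: scaleR_conv_of_real)
qed

lemma real_polynomial_directional_derivative:
  fixes p :: "'a::real_normed_vector \<Rightarrow> real"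
  assumes "real_polynomial_function p"
  shows "\<exists>q. real_polynomial_function q \<and> (\<forall>x. \<exists>D. (p has_derivative D) (at x) \<and> D b = q x)"
  using assms
proof (induction p rule: real_polynomial_function.induct)
  case (linear h)
  then show ?case
    by (intro exI[of _ "\<lambda>x. h b"]) (auto intro: bounded_linear_imp_has_derivative real_polynomial_function.intros(2))
next
  case (const c)
  show ?case
    by (intro exI[of _ "\<lambda>x. 0"]) (auto intro!: exI[of _ "\<lambda>h. 0"] real_polynomial_function.intros(2))
next
  case (add f g)
  obtain f' where f': "real_polynomial_function f'" "\<forall>x. \<exists>D. (f has_derivative D) (at x) \<and> D b = f' x"
    using add.IH(1) by (elim exE conjE)
  obtain g' where g': "real_polynomial_function g'" "\<forall>x. \<exists>D. (g has_derivative D) (at x) \<and> D b = g' x"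
    using add.IH(2) by (elim exE conjE)
  have "\<exists>D. ((\<lambda>x. f x + g x) has_derivative D) (at x) \<and> D b = f' x + g' x" for x
  proof -
    obtain D where D: "(f has_derivative D) (at x)" "D b = f' x" using f'(2) by blast
    obtain E where E: "(g has_derivative E) (at x)" "E b = g' x" using g'(2) by blast
    show ?thesis using D(2) E(2) has_derivative_add[OF D(1) E(1)]
      by (intro exI[of _ "\<lambda>h. D h + E h"]) simp
  qed
  then show ?case
    using real_polynomial_function.intros(3)[OF f'(1) g'(1)]
    by (intro exI[of _ "\<lambda>x. f' x + g' x"]) simp
next
  case (mult f g)
  obtain f' where f': "real_polynomial_function f'" "\<forall>x. \<exists>D. (f has_derivative D) (at x) \<and> D b = f' x"
    using mult.IH(1) by (elim exE conjE)
  obtain g' where g': "real_polynomial_function g'" "\<forall>x. \<exists>D. (g has_derivative D) (at x) \<and> D b = g' x"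
    using mult.IH(2) by (elim exE conjE)
  have "\<exists>D. ((\<lambda>x. f x * g x) has_derivative D) (at x) \<and> D b = f x * g' x + f' x * g x" for x
  proof -
    obtain D where D: "(f has_derivative D) (at x)" "D b = f' x" using f'(2) by blast
    obtain E where E: "(g has_derivative E) (at x)" "E b = g' x" using g'(2) by blast
    show ?thesis using D(2) E(2) has_derivative_mult[OF D(1) E(1)]
      by (intro exI[of _ "\<lambda>h. f x * E h + D h * g x"]) simp
  qed
  then show ?case
    using real_polynomial_function.intros(3)[OF real_polynomial_function.intros(4)[OF mult.hyps(1) g'(1)]
        real_polynomial_function.intros(4)[OF f'(1) mult.hyps(2)]]
    by (intro exI[of _ "\<lambda>x. f x * g' x + f' x * g x"]) simp
qed

lemma real_polynomial_growth:
  fixes p :: "'a::real_normed_vector \<Rightarrow> real"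
  assumes "real_polynomial_function p"
  shows "\<exists>C n. 0 \<le> C \<and> (\<forall>x. \<bar>p x\<bar> \<le> C * (1 + norm x) ^ n)"
  using assms
proof (induction p rule: real_polynomial_function.induct)
  case (linear h)
  then obtain K where K: "0 \<le> K" "\<And>x. norm (h x) \<le> norm x * K" using bounded_linear.nonneg_bounded by blast
  have "\<bar>h x\<bar> \<le> K * (1 + norm x) ^ 1" for x
    using K(2)[of x] K(1) by (simp add: algebra_simps)
  then show ?case using K(1) by blast
next
  case (const c)
  show ?case by (intro exI[of _ "\<bar>c\<bar>"] exI[of _ 0]) simp
next
  case (add f g)
  then obtain C m D n where *: "0 \<le> C" "\<And>x. \<bar>f x\<bar> \<le> C * (1 + norm x) ^ m" "0 \<le> D" "\<And>x. \<bar>g x\<bar> \<le> D * (1 + norm x) ^ n"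
    by blast
  have "\<bar>f x + g x\<bar> \<le> (C + D) * (1 + norm x) ^ (m + n)" for x
  proof -
    have "\<bar>f x + g x\<bar> \<le> C * (1 + norm x) ^ m + D * (1 + norm x) ^ n"
      using *(2)[of x] *(4)[of x] abs_triangle_ineq[of "f x" "g x"] by linarith
    also have "\<dots> \<le> C * (1 + norm x) ^ (m + n) + D * (1 + norm x) ^ (m + n)"
      using *(1,3) by (intro add_mono mult_left_mono power_increasing) auto
    finally show ?thesis by (simp add: algebra_simps)
  qed
  then show ?case using *(1,3) by (intro exI[of _ "C + D"] exI[of _ "m + n"]) auto
next
  case (mult f g)
  then obtain C m D n where *: "0 \<le> C" "\<And>x. \<bar>f x\<bar> \<le> C * (1 + norm x) ^ m" "0 \<le> D" "\<And>x. \<bar>g x\<bar> \<le> D * (1 + norm x) ^ n"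
    by blast
  have "\<bar>f x * g x\<bar> \<le> (C * D) * (1 + norm x) ^ (m + n)" for x
  proof -
    have "\<bar>f x * g x\<bar> \<le> (C * (1 + norm x) ^ m) * (D * (1 + norm x) ^ n)"
      unfolding abs_mult using * by (intro mult_mono) auto
    then show ?thesis by (simp add: power_add ac_simps)
  qed
  then show ?case using *(1,3) by (intro exI[of _ "C * D"] exI[of _ "m + n"]) auto
qed

text \<open>The \<open>n\<close>-th power of \<open>y/(n + 1) \<le> exp (y/(n + 1))\<close>; dividing by \<open>n + 1\<close> instead of \<open>n\<close> includes \<open>n = 0\<close>.\<close>

lemma power_le_exp:
  fixes y :: real
  assumes "0 \<le> y"
  shows "y ^ n \<le> real (Suc n) ^ n * exp y"
proof -
  have "y / Suc n \<le> exp (y / Suc n)" using exp_ge_add_one_self[of "y / Suc n"] by linarith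
  then have "(y / Suc n) ^ n \<le> exp (y / Suc n) ^ n" using assms by (intro power_mono) auto
  also have "\<dots> = exp (n * (y / Suc n))" by (rule exp_of_nat_mult[symmetric])
  also have "\<dots> \<le> exp y" using assms by (simp add: field_simps)
  finally have "y ^ n / real (Suc n) ^ n \<le> exp y" by (simp only: power_divide)
  moreover have "0 < real (Suc n) ^ n" by simp
  ultimately show ?thesis using pos_divide_le_eq[of "real (Suc n) ^ n" "y ^ n" "exp y"]
    by (simp only: mult.commute)
qed

text \<open>The functions \<open>p(x) exp (- |x|\<^sup>2)\<close> with a real polynomial \<open>p\<close> are closed under partial derivatives, and
each of them decays faster than any power.\<close>

lemma schwartz_gaussian: "schwartz (\<lambda>x::'a::euclidean_space. complex_of_real (exp (- (norm x)\<^sup>2)))"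
proof -
  define P where "P f \<longleftrightarrow> (\<exists>p. real_polynomial_function p \<and> f = (\<lambda>x::'a. complex_of_real (p x * exp (- (norm x)\<^sup>2))))" for f
  have deriv: "f differentiable (at x) \<and> P (\<lambda>x. frechet_derivative f (at x) b)" if Pf: "P f" for f x b
  proof -
    obtain p where p: "real_polynomial_function p" "f = (\<lambda>x. complex_of_real (p x * exp (- (norm x)\<^sup>2)))"
      using Pf unfolding P_def by (elim exE conjE)
    obtain q where q: "real_polynomial_function q" "\<forall>x. \<exists>D. (p has_derivative D) (at x) \<and> D b = q x"
      using real_polynomial_directional_derivative[OF p(1), of b] by (elim exE conjE)
    have *: "\<exists>D. (f has_derivative D) (at x) \<and> D b = complex_of_real ((q x + p x * (- 2 * (b \<bullet> x))) * exp (- (norm x)\<^sup>2))" for x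
    proof -
      obtain D where D: "(p has_derivative D) (at x)" "D b = q x" using q(2) by blast
      have "((\<lambda>x. p x * exp (- (x \<bullet> x))) has_derivative
         (\<lambda>h. p x * (exp (- (x \<bullet> x)) * (- (x \<bullet> h + h \<bullet> x))) + D h * exp (- (x \<bullet> x)))) (at x)"
        by (intro has_derivative_mult D(1)) (auto intro!: derivative_eq_intros)
      from has_derivative_of_real[OF this, where 'a=complex] show ?thesis
        unfolding p(2) power2_norm_eq_inner
        by (intro exI conjI, assumption) (simp add: D(2) inner_commute algebra_simps)
    qed
    have "frechet_derivative f (at x) b = complex_of_real ((q x + p x * (- 2 * (b \<bullet> x))) * exp (- (norm x)\<^sup>2))" for x
      using *[of x] frechet_derivative_at by metis
    moreover have "real_polynomial_function (\<lambda>x. q x + p x * (- 2 * (b \<bullet> x)))"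
    proof (rule real_polynomial_function.intros(3)[OF q(1) real_polynomial_function.intros(4)[OF p(1)]])
      show "real_polynomial_function (\<lambda>x. - 2 * (b \<bullet> x))"
        by (intro real_polynomial_function.intros(1) bounded_linear_const_mult bounded_linear_inner_right)
    qed
    ultimately have "P (\<lambda>x. frechet_derivative f (at x) b)" unfolding P_def by auto
    moreover have "f differentiable (at x)" using *[of x] unfolding differentiable_def by blast
    ultimately show ?thesis by blast
  qed
  have decay: "\<exists>M. \<forall>x. norm x ^ k * norm (f x) \<le> M" if Pf: "P f" for f k
  proof -
    obtain p where p: "real_polynomial_function p" "f = (\<lambda>x. complex_of_real (p x * exp (- (norm x)\<^sup>2)))"
      using Pf unfolding P_def by (elim exE conjE)
    obtain C n where C: "0 \<le> C" "\<forall>x. \<bar>p x\<bar> \<le> C * (1 + norm x) ^ n"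
      using real_polynomial_growth[OF p(1)] by (elim exE conjE)
    have "norm x ^ k * norm (f x) \<le> C * (real (Suc (k + n)) ^ (k + n) * exp 2)" for x
    proof -
      have "norm x ^ k * norm (f x) = norm x ^ k * (\<bar>p x\<bar> * exp (- (norm x)\<^sup>2))" by (simp add: p(2) norm_mult)
      also have "\<dots> \<le> (1 + norm x) ^ k * (C * (1 + norm x) ^ n * exp (- (norm x)\<^sup>2))"
        using C by (intro mult_mono power_mono) auto
      also have "\<dots> = C * ((1 + norm x) ^ (k + n) * exp (- (norm x)\<^sup>2))" by (simp add: power_add)
      also have "\<dots> \<le> C * ((real (Suc (k + n)) ^ (k + n) * exp (1 + norm x)) * exp (- (norm x)\<^sup>2))"
        using C(1) by (intro mult_left_mono mult_right_mono power_le_exp) auto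
      also have "\<dots> = C * (real (Suc (k + n)) ^ (k + n) * exp (1 + norm x - (norm x)\<^sup>2))"
        by (simp add: exp_diff exp_minus divide_inverse mult.assoc)
      also have "\<dots> \<le> C * (real (Suc (k + n)) ^ (k + n) * exp 2)"
      proof -
        have "1 + norm x - (norm x)\<^sup>2 \<le> 2"
          using zero_le_power2[of "norm x - 1 / 2"] by (simp add: power2_diff power_divide)
        then show ?thesis using C(1) by (intro mult_left_mono) auto
      qed
      finally show ?thesis .
    qed
    then show ?thesis by blast
  qed
  let ?f = "\<lambda>x::'a. complex_of_real (exp (- (norm x)\<^sup>2))"
  have "P (iter_partial bs ?f)" for bs
  proof (induction bs)
    case Nil
    show ?case unfolding P_def by (intro exI[of _ "\<lambda>x. 1"]) auto
  next
    case (Cons b bs)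
    then show ?case using deriv by simp
  qed
  then show ?thesis
    unfolding schwartz_def differentiable_on_def using deriv decay by simp
qed

lemma fourier_gaussian_nonzero: "fourier (\<lambda>x::'a::euclidean_space. complex_of_real (exp (- (norm x)\<^sup>2))) \<xi> \<noteq> 0"
proof -
  have "fourier (\<lambda>x::'a. complex_of_real (exp (- (norm x)\<^sup>2))) \<xi> =
    (LINT z|lborel. cis (z \<bullet> (- \<xi>)) * of_real (exp (- (1 * (norm z)\<^sup>2))))"
    unfolding fourier_def by (simp add: cis_conv_exp)
  also have "\<dots> \<noteq> 0" unfolding gaussian_fourier(2)[OF zero_less_one] by simp
  finally show ?thesis .
qed

lemma has_pv_integral_unique:
  assumes "has_pv_integral g x I" "has_pv_integral g x J"
  shows "I = J"
  using assms unfolding has_pv_integral_def by (auto intro: tendsto_unique[OF trivial_limit_at_right_real])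

text \<open>If \<open>c\<close> is another admissible constant, the values of the operator on the Gaussian differ by the factor
\<open>c K\<close>, as principal values are unique. Their Fourier transforms are the same and do not vanish at a point
with \<open>|\<xi>| = 1\<close>, which forces \<open>c K = 1\<close>.\<close>

lemma frac_laplacian_const_eq:
  fixes s :: real
  assumes s: "0 < s" "s < 1"
  shows "frac_laplacian_const TYPE('a::euclidean_space) s = 1 / frac_kernel_const DIM('a) s"
  unfolding frac_laplacian_const_def
proof (rule the_equality)
  let ?K = "frac_kernel_const DIM('a) s"
  have K: "0 < ?K" using frac_kernel_const_pos[OF s] by simp
  let ?Q = "\<lambda>c (f :: 'a \<Rightarrow> complex) g. (\<forall>x. has_frac_laplacian_with c s f x (g x)) \<and> integrable lborel g \<and>
      (\<forall>\<xi>. fourier g \<xi> = of_real (norm \<xi> powr (2 * s)) * fourier f \<xi>)"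
  have ex: "\<exists>g. ?Q (1 / ?K) f g" if f: "schwartz f" for f
    by (rule exI, intro conjI allI, rule fourier_multiplier(1)[OF f s], rule fourier_multiplier(2)[OF f s],
        rule fourier_multiplier(3)[OF f s])
  then show "0 < 1 / ?K \<and> (\<forall>f. schwartz f \<longrightarrow> (\<exists>g. ?Q (1 / ?K) f g))"
    using K by simp
  fix c assume c: "0 < c \<and> (\<forall>f. schwartz f \<longrightarrow> (\<exists>g. ?Q c f g))"
  define f where "f x = complex_of_real (exp (- (norm x)\<^sup>2))" for x :: 'a
  have f: "schwartz f" unfolding f_def by (rule schwartz_gaussian)
  obtain g where g: "?Q c f g" using c f by blast
  obtain h where h: "?Q (1 / ?K) f h" using ex[OF f] by blast
  have "g x = of_real (c * ?K) * h x" for x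
  proof -
    obtain I J where "has_pv_integral (\<lambda>y. (f x - f y) /\<^sub>R norm (x - y) powr (DIM('a) + 2 * s)) x I" "g x = c *\<^sub>R I"
      "has_pv_integral (\<lambda>y. (f x - f y) /\<^sub>R norm (x - y) powr (DIM('a) + 2 * s)) x J" "h x = (1 / ?K) *\<^sub>R J"
      using g h unfolding has_frac_laplacian_with_def by blast
    then show ?thesis using K has_pv_integral_unique by (fastforce simp: scaleR_conv_of_real)
  qed
  then have geq: "g = (\<lambda>x. of_real (c * ?K) * h x)" by blast
  obtain \<xi> :: 'a where \<xi>: "norm \<xi> = 1" using vector_choose_size[of 1] by auto
  have "fourier g \<xi> = of_real (c * ?K) * fourier h \<xi>"
  proof -
    have "fourier g \<xi> = (LINT x|lborel. of_real (c * ?K) * (exp (- (\<i> * of_real (x \<bullet> \<xi>))) * h x))"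
      unfolding geq fourier_def by (rule Bochner_Integration.integral_cong) (simp_all only: ac_simps)
    then show ?thesis unfolding fourier_def by (simp only: integral_mult_right_zero)
  qed
  moreover have "fourier g \<xi> = fourier f \<xi>" "fourier h \<xi> = fourier f \<xi>" using g h \<xi> by auto
  moreover have "fourier f \<xi> \<noteq> 0" unfolding f_def by (rule fourier_gaussian_nonzero)
  ultimately have "complex_of_real (c * ?K) = 1" by simp
  then have "c * ?K = 1" by (simp only: of_real_eq_1_iff)
  then show "c = 1 / ?K" using K by (simp add: field_simps)
qed

section \<open>Power solutions of the Choquard equation\<close>

lemma has_frac_laplacian_unique:
  fixes u :: "'a::euclidean_space \<Rightarrow> real"
  assumes "has_frac_laplacian s u x L" "has_frac_laplacian s u x M"
  shows "L = M"
proof -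
  obtain I J where "has_pv_integral (\<lambda>y. (u x - u y) /\<^sub>R norm (x - y) powr (DIM('a) + 2 * s)) x I"
    "L = frac_laplacian_const TYPE('a) s *\<^sub>R I"
    "has_pv_integral (\<lambda>y. (u x - u y) /\<^sub>R norm (x - y) powr (DIM('a) + 2 * s)) x J"
    "M = frac_laplacian_const TYPE('a) s *\<^sub>R J"
    using assms unfolding has_frac_laplacian_def has_frac_laplacian_with_def by (elim exE conjE)
  then show ?thesis using has_pv_integral_unique by metis
qed

text \<open>The second difference integral equals \<open>2 K \<Lambda>(\<beta>) |x|\<^sup>-\<^sup>\<beta>\<^sup>-\<^sup>2\<^sup>s\<close>; half of it is the principal value, and
the normalising constant \<open>1/K\<close> removes \<open>K\<close>.\<close>

lemma has_frac_laplacian_norm_powr: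
  fixes x :: "'a::euclidean_space" and s \<beta> B :: real
  assumes s: "0 < s" "s < 1" and x: "x \<noteq> 0" and \<beta>: "0 < \<beta>" "\<beta> < DIM('a) - 2 * s"
  shows "has_frac_laplacian s (\<lambda>y::'a. B * norm y powr (- \<beta>)) x
    (B * (Lambda_const DIM('a) s \<beta> * norm x powr (- \<beta> - 2 * s)))"
proof -
  let ?K = "frac_kernel_const DIM('a) s"
  let ?D = "\<lambda>z. (2 *\<^sub>R norm x powr (- \<beta>) - norm (x + z) powr (- \<beta>) - norm (x - z) powr (- \<beta>)) /\<^sub>R norm z powr (DIM('a) + 2 * s)"
  let ?L = "Lambda_const DIM('a) s \<beta> * norm x powr (- \<beta> - 2 * s)"
  have K: "0 < ?K" using frac_kernel_const_pos[OF s] by simp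
  obtain C where C: "\<And>z. norm z \<le> norm x / 2 \<Longrightarrow>
    norm (2 *\<^sub>R norm x powr (- \<beta>) - norm (x + z) powr (- \<beta>) - norm (x - z) powr (- \<beta>)) \<le> C * (norm z)\<^sup>2"
    using second_difference_norm_powr[OF x \<beta>(1)] by blast
  have m: "(\<lambda>y::'a. norm y powr (- \<beta>)) \<in> borel_measurable borel" by measurable
  have t: "set_integrable lborel {y. \<epsilon> < dist x y} (\<lambda>y. (norm x powr (- \<beta>) - norm y powr (- \<beta>)) /\<^sub>R norm (x - y) powr (DIM('a) + 2 * s))"
    if "0 < \<epsilon>" for \<epsilon>
    using s \<beta> by (intro set_integrable_power_over_kernel s x that) auto
  have r: "0 < norm x / 2" using x by simp
  have "has_pv_integral (\<lambda>y. (norm x powr (- \<beta>) - norm y powr (- \<beta>)) /\<^sub>R norm (x - y) powr (DIM('a) + 2 * s)) x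
     ((1 / 2) *\<^sub>R (LINT z|lborel. ?D z))"
    by (rule has_pv_integral_second_difference[OF s m t r C])
  also have "(LINT z|lborel. ?D z) = 2 * (?K * ?L)"
    by (rule integral_second_difference_norm_powr[OF s x \<beta> second_difference_integrable[OF s m t r C]])
  finally have pv: "has_pv_integral (\<lambda>y. (norm x powr (- \<beta>) - norm y powr (- \<beta>)) /\<^sub>R norm (x - y) powr (DIM('a) + 2 * s)) x (?K * ?L)"
    by simp
  have "has_pv_integral (\<lambda>y. B * ((norm x powr (- \<beta>) - norm y powr (- \<beta>)) /\<^sub>R norm (x - y) powr (DIM('a) + 2 * s))) x (B * (?K * ?L))"
    using pv unfolding has_pv_integral_def
    by (auto intro!: tendsto_mult_left set_integrable_mult_right)
  also have "(\<lambda>y. B * ((norm x powr (- \<beta>) - norm y powr (- \<beta>)) /\<^sub>R norm (x - y) powr (DIM('a) + 2 * s))) =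
    (\<lambda>y. (B * norm x powr (- \<beta>) - B * norm y powr (- \<beta>)) /\<^sub>R norm (x - y) powr (DIM('a) + 2 * s))"
    by (simp add: algebra_simps)
  finally have "has_pv_integral (\<lambda>y. (B * norm x powr (- \<beta>) - B * norm y powr (- \<beta>)) /\<^sub>R norm (x - y) powr (DIM('a) + 2 * s)) x (B * (?K * ?L))" .
  then show ?thesis
    unfolding has_frac_laplacian_def has_frac_laplacian_with_def frac_laplacian_const_eq[OF s]
    using K by (intro exI[of _ "B * (?K * ?L)"] conjI) simp_all
qed

lemma Lambda_const_pos:
  assumes "0 < s" "0 < \<beta>" "\<beta> < N - 2 * s"
  shows "0 < Lambda_const N s \<beta>"
  unfolding Lambda_const_def using assms by (auto intro!: divide_pos_pos mult_pos_pos Gamma_real_pos)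

lemma C_const_pos:
  assumes "0 < \<mu>" "\<mu> < N" "0 < \<beta> * p" "\<beta> * p < N" "\<mu> + \<beta> * p > N"
  shows "0 < C_const N \<mu> \<beta> p"
  unfolding C_const_def using assms by (auto intro!: divide_pos_pos mult_pos_pos Gamma_real_pos)

lemma riesz_potential_norm_powr:
  fixes x :: "'a::euclidean_space" and \<mu> \<beta> p B :: real
  assumes x: "x \<noteq> 0" and \<mu>: "0 < \<mu>" "\<mu> < DIM('a)"
    and bp: "0 < \<beta> * p" "\<beta> * p < DIM('a)" "\<mu> + \<beta> * p > DIM('a)" and B: "0 < B"
  shows "set_integrable lborel (- {0}) (\<lambda>y. (B * norm y powr (- \<beta>)) powr p / norm (x - y) powr \<mu>)"
    and "(LINT y:- {0}|lborel. (B * norm y powr (- \<beta>)) powr p / norm (x - y) powr \<mu>) =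
      B powr p * (C_const DIM('a) \<mu> \<beta> p * norm x powr (DIM('a) - \<beta> * p - \<mu>))"
proof -
  have C: "0 < C_const DIM('a) \<mu> \<beta> p"
    by (rule C_const_pos[OF \<mu> bp])
  have eq: "indicator (- {0}) y *\<^sub>R ((B * norm y powr (- \<beta>)) powr p / norm (x - y) powr \<mu>) =
     B powr p * (norm (x - y) powr (- \<mu>) * norm y powr (- (\<beta> * p)))" for y
  proof (cases "y = 0")
    case False
    have "(B * norm y powr (- \<beta>)) powr p = B powr p * norm y powr (- (\<beta> * p))"
      using B by (simp add: powr_mult powr_powr)
    then show ?thesis using False by (simp add: powr_minus_divide)
  qed simp
  have "has_bochner_integral lborel (\<lambda>y. norm (x - y) powr (- \<mu>) * norm y powr (- (\<beta> * p)))
     (C_const DIM('a) \<mu> \<beta> p * norm x powr (DIM('a) - \<beta> * p - \<mu>))"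
    using nn_integral_Riesz[OF x \<mu> bp] C by (intro has_bochner_integral_from_nn) auto
  from has_bochner_integral_mult_right[OF this, of "B powr p"]
  show "set_integrable lborel (- {0}) (\<lambda>y. (B * norm y powr (- \<beta>)) powr p / norm (x - y) powr \<mu>)"
    and "(LINT y:- {0}|lborel. (B * norm y powr (- \<beta>)) powr p / norm (x - y) powr \<mu>) =
      B powr p * (C_const DIM('a) \<mu> \<beta> p * norm x powr (DIM('a) - \<beta> * p - \<mu>))"
    unfolding set_integrable_def set_lebesgue_integral_def eq by (auto simp: has_bochner_integral_iff)
qed

text \<open>At a point \<open>x\<close> the equation reads \<open>\<Lambda> = B powr (p + q - 1) * C * |x| powr e\<close>, where \<open>e\<close> is the difference
of the two exponents. Taking \<open>|x| = 1\<close> gives the coefficient identity, and then \<open>|x| = 2\<close> gives \<open>e = 0\<close>.\<close>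

lemma choquard_solution_power_iff:
  fixes s \<mu> p q \<beta> B :: real
  assumes s: "0 < s" "s < 1" and \<mu>: "0 < \<mu>" "\<mu> < DIM('a::euclidean_space)"
    and \<beta>: "0 < \<beta>" "\<beta> < DIM('a) - 2 * s"
    and bp: "0 < \<beta> * p" "\<beta> * p < DIM('a)" "\<mu> + \<beta> * p > DIM('a)" and B: "0 < B" and pq: "p + q > 1"
  shows "choquard_solution s \<mu> p q (\<lambda>x::'a. B * norm x powr (- \<beta>)) \<longleftrightarrow>
    \<beta> = (DIM('a) - \<mu> + 2 * s) / (p + q - 1) \<and>
    B powr (p + q - 1) = Lambda_const DIM('a) s \<beta> / C_const DIM('a) \<mu> \<beta> p"
proof -
  define N where "N = real DIM('a)"
  define L where "L = Lambda_const N s \<beta>"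
  define C where "C = C_const N \<mu> \<beta> p"
  define e where "e = N - \<mu> + 2 * s - \<beta> * (p + q - 1)"
  have L: "0 < L" using Lambda_const_pos[OF s(1) \<beta>] by (simp add: L_def N_def)
  have C: "0 < C" using C_const_pos[OF \<mu> bp] by (simp add: C_def N_def)
  have pointwise: "has_frac_laplacian s (\<lambda>x. B * norm x powr (- \<beta>)) x
      ((LINT y:- {0}|lborel. (B * norm y powr (- \<beta>)) powr p / norm (x - y) powr \<mu>) * (B * norm x powr (- \<beta>)) powr q)
     \<longleftrightarrow> L = B powr (p + q - 1) * C * norm x powr e" (is "?lhs \<longleftrightarrow> _") if x: "x \<noteq> 0" for x :: 'a
  proof -
    have "?lhs \<longleftrightarrow> (B * (L * norm x powr (- \<beta> - 2 * s))) =
       B powr p * (C * norm x powr (N - \<beta> * p - \<mu>)) * (B * norm x powr (- \<beta>)) powr q"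
      using has_frac_laplacian_norm_powr[OF s x \<beta>, of B] has_frac_laplacian_unique
      unfolding riesz_potential_norm_powr(2)[OF x \<mu> bp B] L_def C_def N_def by metis
    also have "B powr p * (C * norm x powr (N - \<beta> * p - \<mu>)) * (B * norm x powr (- \<beta>)) powr q =
       (B powr p * B powr q) * C * (norm x powr (N - \<beta> * p - \<mu>) * norm x powr (- (\<beta> * q)))"
      using B by (simp add: powr_mult powr_powr)
    also have "B powr p * B powr q = B * B powr (p + q - 1)"
      using B powr_add[of B 1 "p + q - 1"] by (simp add: powr_add)
    also have "norm x powr (N - \<beta> * p - \<mu>) * norm x powr (- (\<beta> * q)) = norm x powr e * norm x powr (- \<beta> - 2 * s)"
      unfolding powr_add[symmetric] by (rule arg_cong[where f="\<lambda>c. norm x powr c"]) (simp add: e_def algebra_simps)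
    also have "(B * (L * norm x powr (- \<beta> - 2 * s)) = B * B powr (p + q - 1) * C * (norm x powr e * norm x powr (- \<beta> - 2 * s)))
       \<longleftrightarrow> L = B powr (p + q - 1) * C * norm x powr e"
    proof -
      have "0 < B * norm x powr (- \<beta> - 2 * s)" using B x by simp
      moreover have "B * (L * norm x powr (- \<beta> - 2 * s)) = (B * norm x powr (- \<beta> - 2 * s)) * L"
        "B * B powr (p + q - 1) * C * (norm x powr e * norm x powr (- \<beta> - 2 * s)) =
         (B * norm x powr (- \<beta> - 2 * s)) * (B powr (p + q - 1) * C * norm x powr e)"
        by (simp_all only: ac_simps)
      ultimately show ?thesis by (metis mult_cancel_left less_irrefl)
    qed
    finally show ?thesis .
  qed
  have "choquard_solution s \<mu> p q (\<lambda>x::'a. B * norm x powr (- \<beta>)) \<longleftrightarrow>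
     (\<forall>x::'a. x \<noteq> 0 \<longrightarrow> L = B powr (p + q - 1) * C * norm x powr e)"
    unfolding choquard_solution_def using pointwise riesz_potential_norm_powr(1)[OF _ \<mu> bp B] by blast
  also have "\<dots> \<longleftrightarrow> e = 0 \<and> L = B powr (p + q - 1) * C"
  proof
    assume *: "\<forall>x::'a. x \<noteq> 0 \<longrightarrow> L = B powr (p + q - 1) * C * norm x powr e"
    obtain x :: 'a where x: "norm x = 1" using vector_choose_size[of 1] by auto
    obtain y :: 'a where y: "norm y = 2" using vector_choose_size[of 2] by auto
    from x y have "x \<noteq> 0" "y \<noteq> 0" by auto
    have 1: "L = B powr (p + q - 1) * C" using *[rule_format, OF \<open>x \<noteq> 0\<close>] x by simp
    have "L = B powr (p + q - 1) * C * 2 powr e" using *[rule_format, OF \<open>y \<noteq> 0\<close>] y by simp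
    then have "L * 2 powr e = L" unfolding 1[symmetric] by simp
    then have "2 powr e = (1::real)" using L by simp
    then have "e = 0" by simp
    with 1 show "e = 0 \<and> L = B powr (p + q - 1) * C" by simp
  qed auto
  also have "e = 0 \<longleftrightarrow> \<beta> = (N - \<mu> + 2 * s) / (p + q - 1)"
    using pq by (auto simp: e_def field_simps)
  also have "L = B powr (p + q - 1) * C \<longleftrightarrow> B powr (p + q - 1) = L / C"
    using C by (auto simp: field_simps)
  finally show ?thesis by (simp add: N_def L_def C_def)
qed

theorem theorem1p3:
  fixes s \<mu> p q N \<alpha> :: real
  assumes N_def: "N = real DIM('a::euclidean_space)"
    and "0 < s" "s < 1" "N > 2 * s" "0 < \<mu>" "\<mu> < N" "p > 0" "q > 0" "p + q > 1"
    and alpha_def: "\<alpha> = (N - \<mu> + 2 * s) / (p + q - 1)"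
    and "0 < \<alpha>" "\<alpha> < N - 2 * s" "0 < \<alpha> * p" "\<alpha> * p < N" "\<mu> + \<alpha> * p > N"
  shows "Lambda_const N s \<alpha> > 0 \<and> C_const N \<mu> \<alpha> p > 0 \<and>
    (\<exists>!A. A > 0 \<and> choquard_solution s \<mu> p q (\<lambda>x::'a. A * norm x powr (- \<alpha>))) \<and>
    (\<forall>A>0. choquard_solution s \<mu> p q (\<lambda>x::'a. A * norm x powr (- \<alpha>)) \<longleftrightarrow>
       A powr (p + q - 1) = Lambda_const N s \<alpha> / C_const N \<mu> \<alpha> p) \<and>
    (\<forall>A B \<beta>. A > 0 \<and> choquard_solution s \<mu> p q (\<lambda>x::'a. A * norm x powr (- \<alpha>)) \<and>
       B > 0 \<and> \<beta> > 0 \<and> choquard_solution s \<mu> p q (\<lambda>x::'a. B * norm x powr (- \<beta>)) \<and>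
       0 < \<beta> \<and> \<beta> < N - 2 * s \<and> 0 < \<beta> * p \<and> \<beta> * p < N \<and> \<mu> + \<beta> * p > N \<longrightarrow>
       \<beta> = \<alpha> \<and> B = A)"
proof -
  define R where "R = Lambda_const N s \<alpha> / C_const N \<mu> \<alpha> p"
  have L: "0 < Lambda_const N s \<alpha>" by (rule Lambda_const_pos) (use assms in auto)
  have C: "0 < C_const N \<mu> \<alpha> p" by (rule C_const_pos) (use assms in auto)
  have R: "0 < R" using L C by (simp add: R_def)
  have char: "choquard_solution s \<mu> p q (\<lambda>x::'a. A * norm x powr (- \<beta>)) \<longleftrightarrow>
      \<beta> = \<alpha> \<and> A powr (p + q - 1) = Lambda_const N s \<beta> / C_const N \<mu> \<beta> p"
    if "0 < A" "0 < \<beta>" "\<beta> < N - 2 * s" "0 < \<beta> * p" "\<beta> * p < N" "\<mu> + \<beta> * p > N" for A \<beta>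
    unfolding alpha_def N_def by (rule choquard_solution_power_iff) (use assms that in auto)
  have iff: "choquard_solution s \<mu> p q (\<lambda>x::'a. A * norm x powr (- \<alpha>)) \<longleftrightarrow> A powr (p + q - 1) = R" if "0 < A" for A
    unfolding R_def using char[OF that, of \<alpha>] assms(11-15) by blast
  have inj: "A = B" if "0 < A" "0 < B" "A powr (p + q - 1) = R" "B powr (p + q - 1) = R" for A B
  proof -
    have "A = (A powr (p + q - 1)) powr (1 / (p + q - 1))" using \<open>0 < A\<close> \<open>p + q > 1\<close> by (simp add: powr_powr)
    also have "\<dots> = (B powr (p + q - 1)) powr (1 / (p + q - 1))" by (simp only: that)
    also have "\<dots> = B" using \<open>0 < B\<close> \<open>p + q > 1\<close> by (simp add: powr_powr)
    finally show ?thesis .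
  qed
  define A0 where "A0 = R powr (1 / (p + q - 1))"
  have A0: "0 < A0" "A0 powr (p + q - 1) = R"
    using R \<open>p + q > 1\<close> by (simp_all add: A0_def powr_powr)
  have "\<exists>!A. A > 0 \<and> choquard_solution s \<mu> p q (\<lambda>x::'a. A * norm x powr (- \<alpha>))"
    using A0 iff inj by (intro ex1I[of _ A0]) auto
  moreover have "\<beta> = \<alpha> \<and> B = A" if "A > 0" "choquard_solution s \<mu> p q (\<lambda>x::'a. A * norm x powr (- \<alpha>))"
    "B > 0" "choquard_solution s \<mu> p q (\<lambda>x::'a. B * norm x powr (- \<beta>))"
    "0 < \<beta>" "\<beta> < N - 2 * s" "0 < \<beta> * p" "\<beta> * p < N" "\<mu> + \<beta> * p > N" for A B \<beta>
  proof -
    have "\<beta> = \<alpha>" using char[OF that(3,5-9)] that(4) by blast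
    then show ?thesis using inj[OF that(3,1)] iff that(1-4) by blast
  qed
  ultimately show ?thesis using L C iff unfolding R_def by blast
qed

end
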